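(* Let $k$ be an algebraically closed field of characteristic zero and let $m\geq 1$ be an integer. Let $X\subset\mathbb{P}^{2m+1}$ be a variety projectively isomorphic to the rational normal scroll $S_{m,m}$. Consider the representation of $LSA(X)\cong\mathfrak{sl}_2+\mathfrak{sl}_2$ on the space $k^{2m+2}$ of linear forms on $\mathbb{P}^{2m+1}$, and let $Rep\colon\mathfrak{sl}_2\to\mathfrak{gl}(k^{2m+2})$ be its restriction to a direct summand $\mathfrak{sl}_2$ for which $k^{2m+2}$ decomposes as a sum of two irreducible representations of dimension $m+1$. Let $v,w\in k^{2m+2}$ be such that $v$ is an eigenvector of $Rep(h)$ with eigenvalue $m$ and $w=Rep(y)\cdot v$. Then the function $X\to\mathbb{P}^1$ defined by $w/v$ has as its fibers the lines of a ruling of $X$.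
   Context: Rational normal scroll: for $m\geq 1$, $S_{m,m}\subset\mathbb{P}^{2m+1}$ is the Zariski closure of the image of $(s,t)\mapsto(1:s:s^2:\ldots:s^m:t:st:s^2t:\ldots:s^mt)$. It is ruled by the pencil of lines $s=\text{constant}$; this ruling is unique if $m>1$, while for $m=1$ there are two rulings by lines. A ruling of a variety $X$ projectively isomorphic to $S_{m,m}$ is a corresponding pencil of lines on $X$. Lie algebra of a projective variety: for $X\subset\mathbb{P}^N$, $L(X)\subset\mathfrak{sl}_{N+1}$ is the tangent space at the identity of the algebraic group $\mathrm{PGL}_{N+1}(X)$ of all projective transformations of $\mathbb{P}^N$ mapping $X$ to itself, with its natural Lie product. $LSA(X)$ denotes a Levi subalgebra of $L(X)$, i.e. a semisimple subalgebra complementing the solvable radical; it is unique up to conjugation. For $X$ projectively isomorphic to $S_{m,m}$ it is known that $LSA(X)\cong\mathfrak{sl}_2+\mathfrak{sl}_2$ (direct sum of Lie algebras), and that the induced module of dimension $2m+2$ is the tensor product of the irreducible 2-dimensional representation of one summand and the irreducible $(m+1)$-dimensional representation of the other. Thus, restricted to one summand the module is a sum of $m+1$ irreducible 2-dimensional representations, and restricted to the other summand it is a sum of two irreducible $(m+1)$-dimensional representations; $Rep$ is the latter (for $m=1$ either summand may be taken). The Chevalley basis of $\mathfrak{sl}_2$ is $h=\begin{pmatrix}1&0\\0&-1\end{pmatrix}$, $x=\begin{pmatrix}0&1\\0&0\end{pmatrix}$, $y=\begin{pmatrix}0&0\\1&0\end{pmatrix}$, and the summand is identified with $\mathfrak{sl}_2$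 by a fixed Lie algebra isomorphism. The action on linear forms is the one induced by the inclusion $LSA(X)\subset\mathfrak{sl}_{2m+2}$: a matrix $A$ acts on a linear form $\ell$ by $(A\cdot\ell)(p)=-\ell(Ap)$. The function $w/v$ is the rational map $X\dashrightarrow\mathbb{P}^1$ which is $p\mapsto w(p)/v(p)$ where $v(p)\neq 0$, extended to its maximal domain of definition. *)

theory Defs
  imports "Jordan_Normal_Form.VS_Connect" "Jordan_Normal_Form.Char_Poly"
begin

section \<open>Projective geometry\<close>

text \<open>A point of \<open>P^N\<close> is the set of all of its homogeneous coordinate vectors in \<open>k^(N+1)\<close>;
  subsets of \<open>P^N\<close> are sets of such points.\<close>

definition proj_point :: "'a::field vec \<Rightarrow> 'a vec set" where
  "proj_point x = {c \<cdot>\<^sub>v x | c. c \<noteq> 0}"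

definition proj_space :: "nat \<Rightarrow> 'a::field vec set set" where
  "proj_space N = proj_point ` (carrier_vec (N + 1) - {0\<^sub>v (N + 1)})"

definition P1_point :: "'a::field \<Rightarrow> 'a \<Rightarrow> 'a vec set" where
  "P1_point a b = proj_point (vec_of_list [a, b])"

text \<open>Homogeneous polynomials in \<open>n\<close> variables, as functions on \<open>k^n\<close>. Over an infinite field
  a polynomial and the function it defines determine each other.\<close>

inductive homogeneous_poly :: "nat \<Rightarrow> nat \<Rightarrow> ('a::field vec \<Rightarrow> 'a) \<Rightarrow> bool" for n where
  const: "homogeneous_poly n 0 (\<lambda>_. c)"
| coord: "i < n \<Longrightarrow> homogeneous_poly n 1 (\<lambda>x. x $ i)"
| add: "homogeneous_poly n d f \<Longrightarrow> homogeneous_poly n d g \<Longrightarrow> homogeneous_poly n d (\<lambda>x. f x + g x)"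
| mult: "homogeneous_poly n d f \<Longrightarrow> homogeneous_poly n e g \<Longrightarrow>
    homogeneous_poly n (d + e) (\<lambda>x. f x * g x)"

definition vanishes_at :: "('a::field vec \<Rightarrow> 'a) \<Rightarrow> 'a vec set \<Rightarrow> bool" where
  "vanishes_at f p \<longleftrightarrow> (\<forall>x\<in>p. f x = 0)"

definition zariski_closure :: "nat \<Rightarrow> 'a::field vec set set \<Rightarrow> 'a vec set set" where
  "zariski_closure N S = {p \<in> proj_space N.
     \<forall>d f. homogeneous_poly (N + 1) d f \<and> (\<forall>q\<in>S. vanishes_at f q) \<longrightarrow> vanishes_at f p}"

definition general_linear :: "nat \<Rightarrow> 'a::field mat set" where
  "general_linear n = {A \<in> carrier_mat n n. invertible_mat A}"

definition proj_image :: "'a::field mat \<Rightarrow> 'a vec set set \<Rightarrow> 'a vec set set" where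
  "proj_image A S = (\<lambda>p. (\<lambda>x. A *\<^sub>v x) ` p) ` S"

definition proj_isomorphic :: "nat \<Rightarrow> 'a::field vec set set \<Rightarrow> 'a vec set set \<Rightarrow> bool" where
  "proj_isomorphic N X Y \<longleftrightarrow> (\<exists>A\<in>general_linear (N + 1). X = proj_image A Y)"


section \<open>The scroll and its rulings\<close>

definition scroll_param :: "nat \<Rightarrow> 'a::field \<Rightarrow> 'a \<Rightarrow> 'a vec" where
  "scroll_param m s t = vec (2 * m + 2) (\<lambda>i. if i \<le> m then s ^ i else t * s ^ (i - (m + 1)))"

definition scroll :: "nat \<Rightarrow> 'a::field vec set set" where
  "scroll m = zariski_closure (2 * m + 1) {proj_point (scroll_param m s t) | s t. True}"

text \<open>The line \<open>s = b/a\<close> for \<open>(a:b)\<close> in \<open>P^1\<close>: it is spanned by the points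
  \<open>(a^m : a^(m-1) b : ... : b^m : 0 : ... : 0)\<close> and \<open>(0 : ... : 0 : a^m : a^(m-1) b : ... : b^m)\<close>.
  For \<open>a = 0\<close> it is the member \<open>s = \<infinity>\<close> of the pencil.\<close>

definition scroll_line :: "nat \<Rightarrow> 'a::field \<Rightarrow> 'a \<Rightarrow> 'a vec set set" where
  "scroll_line m a b = {proj_point (vec (2 * m + 2) (\<lambda>i.
      if i \<le> m then c * (a ^ (m - i) * b ^ i)
      else d * (a ^ (m - (i - (m + 1))) * b ^ (i - (m + 1))))) | c d. (c, d) \<noteq> (0, 0)}"

definition standard_ruling :: "nat \<Rightarrow> 'a::field vec set set set" where
  "standard_ruling m = {scroll_line m a b | a b. (a, b) \<noteq> (0, 0)}"

text \<open>The rulings of \<open>X\<close> are the images of the pencil \<open>s = constant\<close> under the projective isomorphisms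
  from the scroll onto \<open>X\<close>. For \<open>m = 1\<close> both rulings of the quadric arise, because exchanging
  \<open>s\<close> and \<open>t\<close> is a projective automorphism of the scroll.\<close>

definition is_ruling :: "nat \<Rightarrow> 'a::field vec set set \<Rightarrow> 'a vec set set set \<Rightarrow> bool" where
  "is_ruling m X R \<longleftrightarrow> (\<exists>A\<in>general_linear (2 * m + 2).
     X = proj_image A (scroll m) \<and> R = proj_image A ` standard_ruling m)"


section \<open>Rational functions\<close>

text \<open>The graph of the rational map \<open>w/v\<close> from \<open>X\<close> to \<open>P^1\<close>, extended to its maximal domain of
  definition, for linear forms \<open>v\<close>, \<open>w\<close> given by their coefficient vectors and \<open>X\<close> irreducible.
  Near a point of its domain a rational map to \<open>P^1\<close> has the form \<open>(F : G)\<close> with \<open>F\<close>, \<open>G\<close>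
  homogeneous of the same degree and without common zero at the point. The value
  \<open>w(p)/v(p)\<close> is the point \<open>(w(p) : v(p))\<close> of \<open>P^1\<close>.\<close>

definition quotient_graph ::
  "nat \<Rightarrow> 'a::field vec set set \<Rightarrow> 'a vec \<Rightarrow> 'a vec \<Rightarrow> ('a vec set \<times> 'a vec set) set" where
  "quotient_graph N X w v = {(p, q). p \<in> X \<and> (\<exists>d F G.
     homogeneous_poly (N + 1) d F \<and> homogeneous_poly (N + 1) d G \<and>
     (\<exists>x\<in>p. (F x, G x) \<noteq> (0, 0) \<and> q = P1_point (F x) (G x)) \<and>
     (\<forall>p'\<in>X. \<forall>x\<in>p'. v \<bullet> x \<noteq> 0 \<and> (F x, G x) \<noteq> (0, 0) \<longrightarrow>
        P1_point (F x) (G x) = P1_point (w \<bullet> x) (v \<bullet> x)))}"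


section \<open>Lie algebras of matrices\<close>

abbreviation vec_subspace :: "nat \<Rightarrow> 'a::field vec set \<Rightarrow> bool" where
  "vec_subspace n U \<equiv> VectorSpace.subspace class_ring U (module_vec TYPE('a) n)"

abbreviation vec_dim :: "nat \<Rightarrow> 'a::field vec set \<Rightarrow> nat" where
  "vec_dim n U \<equiv> vectorspace.dim class_ring ((module_vec TYPE('a) n)\<lparr>carrier := U\<rparr>)"

abbreviation mat_subspace :: "nat \<Rightarrow> 'a::field mat set \<Rightarrow> bool" where
  "mat_subspace n S \<equiv> VectorSpace.subspace class_ring S (module_mat TYPE('a) n n)"

definition bracket :: "'a::field mat \<Rightarrow> 'a mat \<Rightarrow> 'a mat" where
  "bracket A B = A * B - B * A"

definition trace_mat :: "'a::field mat \<Rightarrow> 'a" where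
  "trace_mat A = (\<Sum>i<dim_row A. A $$ (i, i))"

definition sl :: "nat \<Rightarrow> 'a::field mat set" where
  "sl n = {A \<in> carrier_mat n n. trace_mat A = 0}"

definition lie_subalgebra :: "nat \<Rightarrow> 'a::field mat set \<Rightarrow> 'a mat set \<Rightarrow> bool" where
  "lie_subalgebra n S L \<longleftrightarrow> mat_subspace n S \<and> S \<subseteq> L \<and> (\<forall>A\<in>S. \<forall>B\<in>S. bracket A B \<in> S)"

definition lie_ideal :: "nat \<Rightarrow> 'a::field mat set \<Rightarrow> 'a mat set \<Rightarrow> bool" where
  "lie_ideal n I L \<longleftrightarrow> mat_subspace n I \<and> I \<subseteq> L \<and> (\<forall>A\<in>L. \<forall>B\<in>I. bracket A B \<in> I)"

definition derived_algebra :: "nat \<Rightarrow> 'a::field mat set \<Rightarrow> 'a mat set" where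
  "derived_algebra n L = \<Inter>{S. mat_subspace n S \<and> (\<forall>A\<in>L. \<forall>B\<in>L. bracket A B \<in> S)}"

definition lie_solvable :: "nat \<Rightarrow> 'a::field mat set \<Rightarrow> bool" where
  "lie_solvable n L \<longleftrightarrow> (\<exists>j. (derived_algebra n ^^ j) L = {0\<^sub>m n n})"

definition is_solvable_radical :: "nat \<Rightarrow> 'a::field mat set \<Rightarrow> 'a mat set \<Rightarrow> bool" where
  "is_solvable_radical n R L \<longleftrightarrow> lie_ideal n R L \<and> lie_solvable n R \<and>
     (\<forall>I. lie_ideal n I L \<and> lie_solvable n I \<longrightarrow> I \<subseteq> R)"

definition lie_semisimple :: "nat \<Rightarrow> 'a::field mat set \<Rightarrow> bool" where
  "lie_semisimple n L \<longleftrightarrow> is_solvable_radical n {0\<^sub>m n n} L"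

definition mat_direct_sum :: "nat \<Rightarrow> 'a::field mat set \<Rightarrow> 'a mat set \<Rightarrow> 'a mat set \<Rightarrow> bool" where
  "mat_direct_sum n S T L \<longleftrightarrow> S \<inter> T = {0\<^sub>m n n} \<and> L = {A + B | A B. A \<in> S \<and> B \<in> T}"

definition levi_subalgebra :: "nat \<Rightarrow> 'a::field mat set \<Rightarrow> 'a mat set \<Rightarrow> bool" where
  "levi_subalgebra n S L \<longleftrightarrow> lie_subalgebra n S L \<and> lie_semisimple n S \<and>
     (\<exists>R. is_solvable_radical n R L \<and> mat_direct_sum n S R L)"

definition lie_direct_sum :: "nat \<Rightarrow> 'a::field mat set \<Rightarrow> 'a mat set \<Rightarrow> 'a mat set \<Rightarrow> bool" where
  "lie_direct_sum n I J L \<longleftrightarrow> lie_ideal n I L \<and> lie_ideal n J L \<and> mat_direct_sum n I J L"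

definition lie_isomorphism ::
  "'a::field mat set \<Rightarrow> 'a mat set \<Rightarrow> ('a mat \<Rightarrow> 'a mat) \<Rightarrow> bool" where
  "lie_isomorphism L L' \<phi> \<longleftrightarrow> bij_betw \<phi> L L' \<and>
     (\<forall>A\<in>L. \<forall>B\<in>L. \<phi> (A + B) = \<phi> A + \<phi> B) \<and>
     (\<forall>c. \<forall>A\<in>L. \<phi> (c \<cdot>\<^sub>m A) = c \<cdot>\<^sub>m \<phi> A) \<and>
     (\<forall>A\<in>L. \<forall>B\<in>L. \<phi> (bracket A B) = bracket (\<phi> A) (\<phi> B))"

definition sl2_h :: "'a::field mat" where "sl2_h = mat_of_rows_list 2 [[1, 0], [0, -1]]"
definition sl2_x :: "'a::field mat" where "sl2_x = mat_of_rows_list 2 [[0, 1], [0, 0]]"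
definition sl2_y :: "'a::field mat" where "sl2_y = mat_of_rows_list 2 [[0, 0], [1, 0]]"


section \<open>The Lie algebra of a projective variety\<close>

text \<open>The preimage in \<open>GL\<close> of the group of projective transformations mapping \<open>X\<close> to itself.\<close>

definition proj_stabilizer :: "nat \<Rightarrow> 'a::field vec set set \<Rightarrow> 'a mat set" where
  "proj_stabilizer N X = {A \<in> general_linear (N + 1). proj_image A X = X}"

inductive matrix_poly :: "nat \<Rightarrow> ('a::field mat \<Rightarrow> 'a) \<Rightarrow> bool" for n where
  const: "matrix_poly n (\<lambda>_. c)"
| coord: "i < n \<Longrightarrow> j < n \<Longrightarrow> matrix_poly n (\<lambda>A. A $$ (i, j))"
| add: "matrix_poly n f \<Longrightarrow> matrix_poly n g \<Longrightarrow> matrix_poly n (\<lambda>A. f A + g A)"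
| mult: "matrix_poly n f \<Longrightarrow> matrix_poly n g \<Longrightarrow> matrix_poly n (\<lambda>A. f A * g A)"

text \<open>Zariski tangent space at the identity of a set \<open>G\<close> of invertible matrices that is Zariski
  closed in \<open>GL_n\<close>: the common kernel of the differentials at \<open>1\<close> of the polynomials vanishing on
  \<open>G\<close>. Denominators \<open>det^j\<close> do not change it. The differential of \<open>f\<close> in the direction
  \<open>B\<close> is the derivative at \<open>0\<close> of the univariate polynomial \<open>P(t) = f(1 + t B)\<close>.\<close>

definition tangent_at_one :: "nat \<Rightarrow> 'a::field mat set \<Rightarrow> 'a mat set" where
  "tangent_at_one n G = {B \<in> carrier_mat n n.
     \<forall>f. matrix_poly n f \<and> (\<forall>A\<in>G. f A = 0) \<longrightarrow>
       (\<exists>P. (\<forall>t. poly P t = f (1\<^sub>m n + t \<cdot>\<^sub>m B)) \<and> poly (pderiv P) 0 = 0)}"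

text \<open>The tangent space of \<open>PGL_(N+1)(X)\<close> is that of its preimage in \<open>GL_(N+1)\<close> modulo scalar
  matrices; in characteristic zero the quotient is represented by the trace-free matrices.\<close>

definition lie_algebra_of :: "nat \<Rightarrow> 'a::field vec set set \<Rightarrow> 'a mat set" where
  "lie_algebra_of N X = tangent_at_one (N + 1) (proj_stabilizer N X) \<inter> sl (N + 1)"


section \<open>Representations\<close>

text \<open>Matrix of the action of \<open>A\<close> on linear forms, a form \<open>p \<mapsto> l \<bullet> p\<close> being given by its
  coefficient vector \<open>l\<close>.\<close>

definition action_on_forms :: "'a::field mat \<Rightarrow> 'a mat" where
  "action_on_forms A = - transpose_mat A"

lemma action_on_forms_apply:
  assumes "A \<in> carrier_mat n n" "l \<in> carrier_vec n" "p \<in> carrier_vec n"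
  shows "(action_on_forms A *\<^sub>v l) \<bullet> p = - (l \<bullet> (A *\<^sub>v p))"
proof -
  have "(transpose_mat A *\<^sub>v l) \<bullet> p = l \<bullet> (A *\<^sub>v p)"
    using assms by (metis transpose_vec_mult_scalar)
  moreover have "action_on_forms A *\<^sub>v l = - (transpose_mat A *\<^sub>v l)"
    using assms by (intro eq_vecI) (auto simp: action_on_forms_def)
  ultimately show ?thesis
    using assms by simp
qed

definition invariant_subspace ::
  "nat \<Rightarrow> 'a::field mat set \<Rightarrow> ('a mat \<Rightarrow> 'a mat) \<Rightarrow> 'a vec set \<Rightarrow> bool" where
  "invariant_subspace n L \<rho> U \<longleftrightarrow> vec_subspace n U \<and> (\<forall>z\<in>L. \<forall>u\<in>U. \<rho> z *\<^sub>v u \<in> U)"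

definition irreducible_subrep ::
  "nat \<Rightarrow> 'a::field mat set \<Rightarrow> ('a mat \<Rightarrow> 'a mat) \<Rightarrow> 'a vec set \<Rightarrow> bool" where
  "irreducible_subrep n L \<rho> U \<longleftrightarrow> invariant_subspace n L \<rho> U \<and> U \<noteq> {0\<^sub>v n} \<and>
     (\<forall>W. invariant_subspace n L \<rho> W \<and> W \<subseteq> U \<longrightarrow> W = {0\<^sub>v n} \<or> W = U)"

definition vec_direct_sum :: "nat \<Rightarrow> 'a::field vec set \<Rightarrow> 'a vec set \<Rightarrow> bool" where
  "vec_direct_sum n U W \<longleftrightarrow> U \<inter> W = {0\<^sub>v n} \<and> carrier_vec n = {u + w | u w. u \<in> U \<and> w \<in> W}"

end

theory Submission
  imports Defs
begin

text \<open>
  In the chart \<open>(s, t)\<close> of the scroll a linear form becomes a function \<open>F = f(s) + t g(s)\<close> with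
  polynomials \<open>f\<close> and \<open>g\<close> of degree at most \<open>m\<close>. The infinitesimal symmetries of the scroll are
  the scalars and the vector fields that move the lines \<open>s = const\<close> or move points along them:
  each acts on forms by
  \<open>F \<mapsto> \<kappa> F + (\<rho> \<partial>F/\<partial>t - \<rho>'/2 F) + (\<mu> \<partial>F/\<partial>s - m/2 \<mu>' F)\<close>
  with a constant \<open>\<kappa>\<close>, a quadratic polynomial \<open>\<rho>\<close> in \<open>t\<close> and a quadratic polynomial \<open>\<mu>\<close> in \<open>s\<close>
  (\<open>acts_by\<close>). This normal form comes from the quadrics through the scroll, the \<open>2 \<times> 2\<close> minors of
  a \<open>2 \<times> 2m\<close> matrix of coordinates: an element of the Lie algebra annihilates them to first order
  (\<open>tangent_minor\<close>), which is a recursion for the rows of its matrix with only these solutions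
  (\<open>acts_by_of_minors\<close>). Brackets of matrices become brackets of vector fields
  (\<open>acts_by_bracket\<close>), so \<open>h, x, y\<close> in the summand give two triples of quadratic polynomials, one
  in \<open>t\<close> and one in \<open>s\<close>, each satisfying the relations of \<open>sl\<^sub>2\<close>.

  A nonzero triple has trivial centralizer among the vector fields on the line
  (\<open>vf_triple_commutant\<close>). If both triples were nonzero, the other summand, which commutes with
  the first, would consist of scalar matrices of trace zero, that is, of zero. They are not both
  zero either, since \<open>m\<close> is a weight.

  Suppose that only the triple \<open>H, E, Y\<close> in \<open>s\<close> is nonzero. On linear polynomials in \<open>s\<close> the field
  \<open>H\<close> has eigenvalue \<open>-1\<close>; let \<open>a\<close> be an eigenvector and \<open>b = Y a\<close>, which is not a multiple of
  \<open>a\<close> (\<open>vf_triple_eigenform\<close>). The components \<open>f\<close> and \<open>g\<close> of \<open>v\<close> satisfy the first-order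
  equation \<open>H f = - m f\<close>, whose solutions are the multiples of \<open>a\<^sup>m\<close>. Hence \<open>a (Y f) = m f b\<close>
  (\<open>lie_deriv_eigen_ratio\<close>), the same for \<open>g\<close>, and \<open>w/v = - m b/a\<close> is a fractional linear
  function of \<open>s\<close>. Its fibers are the lines \<open>s = const\<close>. If only the triple in \<open>t\<close> is nonzero, it
  acts on forms with the weights \<open>1\<close> and \<open>-1\<close> alone. So \<open>m = 1\<close>, and exchanging \<open>s\<close> and \<open>t\<close>
  leads back to the first situation.

  The quotient \<open>(b : a)\<close> is regular on all of \<open>X\<close>, and any other local representative of \<open>w/v\<close>
  agrees with it, because an identity of polynomials in the homogeneous parameters of the scroll
  that holds where a further polynomial is nonzero holds everywhere
  (\<open>polynomial_on_lines_mult_eq_0\<close>).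
\<close>

section \<open>Parametrization of the scroll\<close>

text \<open>Bihomogeneous coordinates on the cone over the scroll: degree one in \<open>(T0, T1)\<close> and degree
  \<open>m\<close> in \<open>(S0, S1)\<close>. The chart is \<open>T0 = S0 = 1\<close>, \<open>t = T1\<close>, \<open>s = S1\<close>. With \<open>(S0, S1)\<close> fixed, the
  points run through a line of the ruling.\<close>

definition scroll_point :: "nat \<Rightarrow> 'a::field \<Rightarrow> 'a \<Rightarrow> 'a \<Rightarrow> 'a \<Rightarrow> 'a vec" where
  "scroll_point m T0 T1 S0 S1 = vec (2 * m + 2) (\<lambda>i.
      if i \<le> m then T0 * (S0 ^ (m - i) * S1 ^ i)
      else T1 * (S0 ^ (m - (i - (m + 1))) * S1 ^ (i - (m + 1))))"

lemma scroll_point_carrier [simp]: "scroll_point m T0 T1 S0 S1 \<in> carrier_vec (2 * m + 2)"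
  by (simp add: scroll_point_def)

lemma scroll_point_carrier_Suc [simp]:
  "scroll_point m T0 T1 S0 S1 \<in> carrier_vec (Suc (Suc (2 * m)))"
  by (simp add: scroll_point_def)

lemma dim_scroll_point [simp]: "dim_vec (scroll_point m T0 T1 S0 S1) = 2 * m + 2"
  by (simp add: scroll_point_def)

lemma scroll_point_index_lower:
  "j \<le> m \<Longrightarrow> scroll_point m T0 T1 S0 S1 $ j = T0 * (S0 ^ (m - j) * S1 ^ j)"
  by (simp add: scroll_point_def)

lemma scroll_point_index_upper:
  "j \<le> m \<Longrightarrow> scroll_point m T0 T1 S0 S1 $ Suc (m + j) = T1 * (S0 ^ (m - j) * S1 ^ j)"
  by (simp add: scroll_point_def)

lemma block_index_cases:
  fixes i m :: nat
  assumes "i < 2 * m + 2"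
  obtains (lower) "i \<le> m" | (upper) j where "i = Suc (m + j)" "j \<le> m"
proof (cases "i \<le> m")
  case False
  then have "i = Suc (m + (i - Suc m))" "i - Suc m \<le> m" using assms by auto
  then show ?thesis using that(2) by blast
qed (use that in blast)

lemma sum_blocks:
  fixes h :: "nat \<Rightarrow> 'b::comm_monoid_add"
  shows "(\<Sum>i<2 * m + 2. h i) = (\<Sum>j\<le>m. h j) + (\<Sum>j\<le>m. h (Suc (m + j)))"
proof -
  have "{..<2 * m + 2} = {..m} \<union> (\<lambda>j. Suc (m + j)) ` {..m}"
  proof (intro equalityI subsetI)
    fix i assume "i \<in> {..<2 * m + 2}"
    then have "i < 2 * m + 2" by simp
    then show "i \<in> {..m} \<union> (\<lambda>j. Suc (m + j)) ` {..m}" by (cases rule: block_index_cases) auto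
  qed auto
  moreover have disjoint: "{..m} \<inter> (\<lambda>j. Suc (m + j)) ` {..m} = {}"
    by (rule equals0I) (elim IntE imageE, simp)
  ultimately have "(\<Sum>i<2 * m + 2. h i) = (\<Sum>j\<le>m. h j) + sum h ((\<lambda>j. Suc (m + j)) ` {..m})"
    by (simp only:) (rule sum.union_disjoint[OF _ _ disjoint], simp_all)
  also have "sum h ((\<lambda>j. Suc (m + j)) ` {..m}) = (\<Sum>j\<le>m. h (Suc (m + j)))"
    by (subst sum.reindex) (auto simp: inj_on_def)
  finally show ?thesis .
qed

lemma scroll_point_scale:
  assumes "T0 \<noteq> 0" "S0 \<noteq> 0"
  shows "scroll_point m T0 T1 S0 S1 = (T0 * S0 ^ m) \<cdot>\<^sub>v scroll_point m 1 (T1 / T0) 1 (S1 / S0)"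
proof (rule eq_vecI)
  fix i assume "i < dim_vec ((T0 * S0 ^ m) \<cdot>\<^sub>v scroll_point m 1 (T1 / T0) 1 (S1 / S0))"
  then have i: "i < 2 * m + 2" by simp
  have S: "S0 ^ (m - j) * S1 ^ j = S0 ^ m * (S1 / S0) ^ j" if "j \<le> m" for j
    using that assms by (simp add: power_diff power_divide)
  from i show "scroll_point m T0 T1 S0 S1 $ i =
      ((T0 * S0 ^ m) \<cdot>\<^sub>v scroll_point m 1 (T1 / T0) 1 (S1 / S0)) $ i"
  proof (cases rule: block_index_cases)
    case lower
    then show ?thesis using i S[of i] by (simp add: scroll_point_index_lower)
  next
    case (upper j)
    then show ?thesis using i S[of j] assms by (simp add: scroll_point_index_upper)
  qed
qed simp

section \<open>Polynomial identities on the parameter space\<close>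

text \<open>A stand-in for polynomial functions in four variables. Restriction to lines is all that is
  needed to conclude from the vanishing of a product that a factor vanishes, and the condition
  is visibly stable under sums and products.\<close>

definition polynomial_on_lines :: "('a::field \<Rightarrow> 'a \<Rightarrow> 'a \<Rightarrow> 'a \<Rightarrow> 'a) \<Rightarrow> bool" where
  "polynomial_on_lines F \<longleftrightarrow> (\<forall>T0 T0' T1 T1' S0 S0' S1 S1'. \<exists>P. \<forall>r.
     poly P r = F (T0 + r * T0') (T1 + r * T1') (S0 + r * S0') (S1 + r * S1'))"

lemma polynomial_on_lines_const: "polynomial_on_lines (\<lambda>_ _ _ _. c)"
  unfolding polynomial_on_lines_def by (intro allI exI[of _ "[:c:]"]) simp

lemma affine_function_is_poly: "\<exists>P. \<forall>r. poly P r = a + r * b"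
  by (rule exI[of _ "[:a, b:]"]) simp

lemma polynomial_on_lines_coords:
  "polynomial_on_lines (\<lambda>T0 T1 S0 S1. T0)" "polynomial_on_lines (\<lambda>T0 T1 S0 S1. T1)"
  "polynomial_on_lines (\<lambda>T0 T1 S0 S1. S0)" "polynomial_on_lines (\<lambda>T0 T1 S0 S1. S1)"
  by (simp_all add: polynomial_on_lines_def affine_function_is_poly)

lemma polynomial_on_lines_combine:
  assumes F: "polynomial_on_lines F" and G: "polynomial_on_lines G"
    and h: "\<And>P Q r. poly (H P Q) r = h (poly P r) (poly Q r)"
  shows "polynomial_on_lines (\<lambda>T0 T1 S0 S1. h (F T0 T1 S0 S1) (G T0 T1 S0 S1))"
  unfolding polynomial_on_lines_def
proof (intro allI)
  fix T0 T0' T1 T1' S0 S0' S1 S1'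
  obtain P where P: "\<forall>r. poly P r = F (T0 + r * T0') (T1 + r * T1') (S0 + r * S0') (S1 + r * S1')"
    using F unfolding polynomial_on_lines_def by blast
  obtain Q where Q: "\<forall>r. poly Q r = G (T0 + r * T0') (T1 + r * T1') (S0 + r * S0') (S1 + r * S1')"
    using G unfolding polynomial_on_lines_def by blast
  show "\<exists>R. \<forall>r. poly R r = h (F (T0 + r * T0') (T1 + r * T1') (S0 + r * S0') (S1 + r * S1'))
      (G (T0 + r * T0') (T1 + r * T1') (S0 + r * S0') (S1 + r * S1'))"
    by (rule exI[of _ "H P Q"]) (simp add: h P Q)
qed

lemmas polynomial_on_lines_add = polynomial_on_lines_combine[where h = "(+)" and H = "(+)", OF _ _ poly_add]
lemmas polynomial_on_lines_diff = polynomial_on_lines_combine[where h = "(-)" and H = "(-)", OF _ _ poly_diff]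
lemmas polynomial_on_lines_mult = polynomial_on_lines_combine[where h = "(*)" and H = "(*)", OF _ _ poly_mult]

lemma polynomial_on_lines_power:
  assumes "polynomial_on_lines F"
  shows "polynomial_on_lines (\<lambda>T0 T1 S0 S1. F T0 T1 S0 S1 ^ k)"
  by (rule polynomial_on_lines_combine[where h = "\<lambda>x _. x ^ k" and H = "\<lambda>P _. P ^ k", OF assms assms]) simp

lemmas polynomial_on_lines_intros = polynomial_on_lines_const polynomial_on_lines_coords
  polynomial_on_lines_add polynomial_on_lines_diff polynomial_on_lines_mult polynomial_on_lines_power

lemma polynomial_on_lines_homogeneous:
  assumes "homogeneous_poly n d f" "n = 2 * m + 2" 
  shows "polynomial_on_lines (\<lambda>T0 T1 S0 S1. f (scroll_point m T0 T1 S0 S1))"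
  using assms
proof induction
  case (coord i)
  from coord(1)[unfolded coord(2)] show ?case
  proof (cases rule: block_index_cases)
    case lower
    then show ?thesis by (simp only: scroll_point_index_lower) (intro polynomial_on_lines_intros)
  next
    case (upper j)
    then show ?thesis by (simp only: scroll_point_index_upper) (intro polynomial_on_lines_intros)
  qed
qed (auto intro: polynomial_on_lines_intros)

text \<open>This is where the irreducibility of the scroll enters. On the line that joins a point where
  \<open>G\<close> is nonzero to an arbitrary point, the product of two univariate polynomials is zero, and
  the one coming from \<open>G\<close> is not; so the one coming from \<open>F\<close> is.\<close>

lemma polynomial_on_lines_mult_eq_0:
  fixes F G :: "'a::field_char_0 \<Rightarrow> 'a \<Rightarrow> 'a \<Rightarrow> 'a \<Rightarrow> 'a"
  assumes F: "polynomial_on_lines F" and G: "polynomial_on_lines G"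
    and prod: "\<And>T0 T1 S0 S1. F T0 T1 S0 S1 * G T0 T1 S0 S1 = 0"
    and G0: "G t0 t1 s0 s1 \<noteq> 0"
  shows "F T0 T1 S0 S1 = 0"
proof -
  let ?c = "\<lambda>x y r. x + r * (y - x)"
  obtain P where P: "\<forall>r. poly P r = F (?c t0 T0 r) (?c t1 T1 r) (?c s0 S0 r) (?c s1 S1 r)"
    using F unfolding polynomial_on_lines_def by blast
  obtain Q where Q: "\<forall>r. poly Q r = G (?c t0 T0 r) (?c t1 T1 r) (?c s0 S0 r) (?c s1 S1 r)"
    using G unfolding polynomial_on_lines_def by blast
  have "poly (P * Q) r = 0" for r using prod by (simp add: P Q)
  then have "P * Q = 0" by (metis poly_all_0_iff_0)
  moreover have "Q \<noteq> 0" using Q[rule_format, of 0] G0 by auto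
  ultimately have "P = 0" by simp
  then show ?thesis using P[rule_format, of 1] by simp
qed

lemma homogeneous_poly_scale:
  assumes "homogeneous_poly n d f" "x \<in> carrier_vec n"
  shows "f (c \<cdot>\<^sub>v x) = c ^ d * f x"
  using assms by induction (auto simp: algebra_simps power_add)

text \<open>The points outside the chart are the zeros of the polynomial \<open>T0 * S0\<close>.\<close>

lemma polynomial_on_lines_eq_0_of_chart:
  fixes F :: "'a::field_char_0 \<Rightarrow> 'a \<Rightarrow> 'a \<Rightarrow> 'a \<Rightarrow> 'a"
  assumes F: "polynomial_on_lines F" 
    and chart: "\<And>T0 T1 S0 S1. T0 \<noteq> 0 \<Longrightarrow> S0 \<noteq> 0 \<Longrightarrow> F T0 T1 S0 S1 = 0"
  shows "F T0 T1 S0 S1 = 0"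
proof (rule polynomial_on_lines_mult_eq_0[OF F, of "\<lambda>T0 T1 S0 S1. T0 * S0" 1 1 1 1])
  show "polynomial_on_lines (\<lambda>T0 T1 S0 S1. T0 * S0 :: 'a)" by (intro polynomial_on_lines_intros)
  show "F T0 T1 S0 S1 * (T0 * S0) = 0" for T0 T1 S0 S1
    using chart[of T0 S0 T1 S1] by (cases "T0 = 0 \<or> S0 = 0") auto
qed simp

lemma homogeneous_poly_vanish_of_chart:
  fixes f :: "'a::field_char_0 vec \<Rightarrow> 'a"
  assumes f: "homogeneous_poly (2 * m + 2) d f"
    and chart: "\<And>s t. f (scroll_point m 1 t 1 s) = 0"
  shows "f (scroll_point m T0 T1 S0 S1) = 0"
proof (rule polynomial_on_lines_eq_0_of_chart[of "\<lambda>T0 T1 S0 S1. f (scroll_point m T0 T1 S0 S1)"])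
  show "polynomial_on_lines (\<lambda>T0 T1 S0 S1. f (scroll_point m T0 T1 S0 S1))"
    using polynomial_on_lines_homogeneous[OF f] by simp
  fix T0 T1 S0 S1 :: 'a assume nz: "T0 \<noteq> 0" "S0 \<noteq> 0"
  show "f (scroll_point m T0 T1 S0 S1) = 0"
    unfolding scroll_point_scale[OF nz]
    by (subst homogeneous_poly_scale[OF f scroll_point_carrier]) (simp add: chart)
qed

section \<open>Equations of the scroll\<close>

lemma proj_point_self: "x \<in> proj_point x"
  unfolding proj_point_def mem_Collect_eq by (rule exI[of _ 1]) simp

lemma proj_point_smult:
  assumes "c \<noteq> 0" shows "proj_point (c \<cdot>\<^sub>v x) = proj_point x"
proof (intro equalityI subsetI)
  fix y assume "y \<in> proj_point (c \<cdot>\<^sub>v x)"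
  then obtain d where "d \<noteq> 0" "y = d \<cdot>\<^sub>v (c \<cdot>\<^sub>v x)" by (auto simp: proj_point_def)
  then have "y = (d * c) \<cdot>\<^sub>v x" "d * c \<noteq> 0" using assms by (simp_all add: smult_smult_assoc)
  then show "y \<in> proj_point x" unfolding proj_point_def by blast
next
  fix y assume "y \<in> proj_point x"
  then obtain d where "d \<noteq> 0" "y = d \<cdot>\<^sub>v x" by (auto simp: proj_point_def)
  then have "y = (d / c) \<cdot>\<^sub>v (c \<cdot>\<^sub>v x)" "d / c \<noteq> 0" using assms by (simp_all add: smult_smult_assoc)
  then show "y \<in> proj_point (c \<cdot>\<^sub>v x)" unfolding proj_point_def by blast
qed

lemma proj_point_eqI_mem:
  assumes "y \<in> proj_point x" shows "proj_point y = proj_point x"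
proof -
  obtain c where "c \<noteq> 0" "y = c \<cdot>\<^sub>v x" using assms by (auto simp: proj_point_def)
  then show ?thesis using proj_point_smult by simp
qed

text \<open>The indices \<open>k\<close> for which the coordinates \<open>k\<close> and \<open>k + 1\<close> lie in the same block of length
  \<open>m + 1\<close>. These pairs are the columns of the \<open>2 \<times> 2m\<close> matrix that has rank one along the
  scroll, and \<open>minor i k\<close> is the minor on the columns \<open>i\<close> and \<open>k\<close>.\<close>

definition column_start :: "nat \<Rightarrow> nat \<Rightarrow> bool" where
  "column_start m k \<longleftrightarrow> k < m \<or> (m + 1 \<le> k \<and> k < 2 * m + 1)"

definition minor :: "nat \<Rightarrow> nat \<Rightarrow> 'a::field vec \<Rightarrow> 'a" where
  "minor i k x = x $ i * x $ Suc k - x $ Suc i * x $ k"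

lemma homogeneous_minor:
  assumes "column_start m i" "column_start m k"
  shows "homogeneous_poly (2 * m + 2) 2 (minor i k)"
proof -
  have bnd: "i < 2*m+2" "Suc i < 2*m+2" "k < 2*m+2" "Suc k < 2*m+2"
    using assms by (auto simp: column_start_def)
  have c: "homogeneous_poly (2 * m + 2) (1 + 1) (\<lambda>x. x $ a * x $ b :: 'a)"
    if "a < 2*m+2" "b < 2*m+2" for a b
    using that by (intro homogeneous_poly.intros)
  have "homogeneous_poly (2 * m + 2) (1 + 1 + 0) (\<lambda>x. x $ Suc i * x $ k * (-1 :: 'a))"
    by (rule homogeneous_poly.mult[OF c[OF bnd(2,3)] homogeneous_poly.const])
  then have "homogeneous_poly (2 * m + 2) (1 + 1) (\<lambda>x. x $ i * x $ Suc k + x $ Suc i * x $ k * (-1 :: 'a))"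
    by (intro homogeneous_poly.add[OF c[OF bnd(1,4)]]) simp
  moreover have "minor i k = (\<lambda>x. x $ i * x $ Suc k + x $ Suc i * x $ k * (-1 :: 'a))"
    by (simp add: minor_def fun_eq_iff)
  ultimately show ?thesis by (simp add: numeral_2_eq_2)
qed

lemma scroll_point_Suc:
  assumes "column_start m k"
  shows "S1 * scroll_point m T0 T1 S0 S1 $ k = S0 * scroll_point m T0 T1 S0 S1 $ Suc k"
proof -
  have p: "S1 * (T * (S0 ^ (m - j) * S1 ^ j)) = S0 * (T * (S0 ^ (m - Suc j) * S1 ^ Suc j))"
    if "j < m" for j T
  proof -
    have "m - j = Suc (m - Suc j)" using that by simp
    then show ?thesis by simp
  qed
  show ?thesis
  proof (cases "k < m")
    case True
    then show ?thesis using p[of k T0] scroll_point_index_lower[of k m T0 T1 S0 S1]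
      scroll_point_index_lower[of "Suc k" m T0 T1 S0 S1] by simp
  next
    case False
    define j where "j = k - Suc m"
    have j: "k = Suc (m + j)" "Suc k = Suc (m + Suc j)" "j < m"
      using assms False unfolding column_start_def j_def by auto
    then show ?thesis using p[OF j(3), of T1] scroll_point_index_upper[of j m T0 T1 S0 S1]
      scroll_point_index_upper[of "Suc j" m T0 T1 S0 S1] unfolding j(1,2) by simp
  qed
qed

lemma minor_scroll_point_affine:
  assumes "column_start m i" "column_start m k"
  shows "minor i k (scroll_point m 1 t 1 s) = 0"
proof -
  let ?x = "scroll_point m 1 t 1 s"
  have "?x $ Suc i = s * ?x $ i" "?x $ Suc k = s * ?x $ k"
    using scroll_point_Suc[OF assms(1), of s 1 t 1] scroll_point_Suc[OF assms(2), of s 1 t 1]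
    by (simp_all only: mult_1)
  then show ?thesis unfolding minor_def by (simp only: mult.left_commute mult.assoc diff_self)
qed

lemma power_mult_power_nonzero:
  fixes S0 S1 :: "'a::field"
  assumes "(S0, S1) \<noteq> (0, 0)"
  shows "\<exists>j\<le>m. S0 ^ (m - j) * S1 ^ j \<noteq> 0"
proof (cases "S0 = 0")
  case True
  then show ?thesis using assms by (intro exI[of _ m]) auto
next
  case False
  then show ?thesis by (intro exI[of _ 0]) auto
qed

lemma scroll_point_nonzero:
  assumes "(T0, T1) \<noteq> (0, 0)" "(S0, S1) \<noteq> (0, 0)"
  shows "scroll_point m T0 T1 S0 S1 \<noteq> 0\<^sub>v (2 * m + 2)"
proof
  assume z: "scroll_point m T0 T1 S0 S1 = 0\<^sub>v (2 * m + 2)"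
  obtain j where j: "j \<le> m" "S0 ^ (m - j) * S1 ^ j \<noteq> 0"
    using power_mult_power_nonzero[OF assms(2)] by blast
  have "T0 * (S0 ^ (m - j) * S1 ^ j) = 0"
    using scroll_point_index_lower[OF j(1), of T0 T1 S0 S1] j unfolding z by simp
  moreover have "T1 * (S0 ^ (m - j) * S1 ^ j) = 0"
    using scroll_point_index_upper[OF j(1), of T0 T1 S0 S1] j unfolding z by simp
  ultimately have "T0 = 0" "T1 = 0" using j(2) by (simp_all only: mult_eq_0_iff simp_thms)
  then show False using assms by simp
qed

lemma scroll_eq_chart_closure:
  "scroll m = zariski_closure (2 * m + 1) {proj_point (scroll_point m 1 t 1 s) | s t. True}"
proof -
  have "scroll_param m s t = scroll_point m 1 t 1 s" for s t :: 'a
    by (rule eq_vecI) (auto simp: scroll_param_def scroll_point_def)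
  then show ?thesis by (simp add: scroll_def)
qed

lemma geometric_run:
  fixes x :: "'a::field vec"
  assumes "S0 \<noteq> 0" "\<And>j. j < m \<Longrightarrow> S1 * x $ (e + j) = S0 * x $ (e + Suc j)" "j \<le> m"
  shows "x $ (e + j) = x $ e / S0 ^ m * (S0 ^ (m - j) * S1 ^ j)"
  using assms(3)
proof (induction j)
  case 0
  then show ?case using assms(1) by simp
next
  case (Suc j)
  then have "S0 * x $ (e + Suc j) = S1 * (x $ e / S0 ^ m * (S0 ^ (m - j) * S1 ^ j))"
    using assms(2)[of j] by simp
  also have "S0 ^ (m - j) = S0 * S0 ^ (m - Suc j)" using Suc(2) by (simp add: Suc_diff_Suc[symmetric])
  finally have "S0 * x $ (e + Suc j) = S0 * (x $ e / S0 ^ m * (S0 ^ (m - Suc j) * S1 ^ Suc j))"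
    by (simp only: power_Suc mult_ac)
  then show ?case using mult_left_cancel[OF assms(1)] by blast
qed

text \<open>If all minors vanish at a nonzero vector \<open>x\<close>, the two rows of the matrix are proportional: some
  \<open>(S0, S1)\<close> satisfies \<open>S1 * x\<^sub>k = S0 * x\<^sub>k\<^sub>+\<^sub>1\<close> for every column. Inside a block the coordinates are then
  a geometric progression, which is the parametrization. Conversely, a form vanishing on the chart
  vanishes at all parameters by density.\<close>

lemma scroll_eq:
  "scroll m = {proj_point (scroll_point m T0 T1 S0 S1) |T0 T1 S0 S1.
     (T0, T1) \<noteq> (0, 0) \<and> (S0, S1) \<noteq> (0, 0 :: 'a::field_char_0)}" (is "_ = ?R")
proof (intro equalityI subsetI)
  fix p :: "'a vec set" assume p: "p \<in> scroll m"
  have p': "p \<in> proj_space (2 * m + 1)"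
    and van: "\<And>d f. homogeneous_poly (2 * m + 2) d f \<Longrightarrow>
      (\<And>s t. vanishes_at f (proj_point (scroll_point m 1 t 1 s))) \<Longrightarrow> vanishes_at f p"
  proof -
    show "p \<in> proj_space (2 * m + 1)" using p
      unfolding scroll_eq_chart_closure zariski_closure_def by blast
    fix d and f :: "'a vec \<Rightarrow> 'a" assume f: "homogeneous_poly (2 * m + 2) d f"
      and van: "\<And>s t. vanishes_at f (proj_point (scroll_point m 1 t 1 s))"
    have "homogeneous_poly (2 * m + 1 + 1) d f" using f by simp
    moreover have "\<forall>q\<in>{proj_point (scroll_point m 1 t 1 s) | s t. True}. vanishes_at f q"
      using van by blast
    ultimately show "vanishes_at f p"
      using p unfolding scroll_eq_chart_closure zariski_closure_def by blast
  qed
  from p' obtain x where x: "x \<in> carrier_vec (2 * m + 2)" "x \<noteq> 0\<^sub>v (2 * m + 2)" "p = proj_point x"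
    by (auto simp: proj_space_def)
  have minors: "minor i k x = 0" if "column_start m i" "column_start m k" for i k
  proof -
    have "vanishes_at (minor i k) (proj_point (scroll_point m 1 t 1 s))" for s t :: 'a
      unfolding vanishes_at_def proj_point_def
      using homogeneous_poly_scale[OF homogeneous_minor[OF that, where 'a = 'a] scroll_point_carrier]
        minor_scroll_point_affine[OF that] by auto
    from van[OF homogeneous_minor[OF that] this] show ?thesis
      using x(3) proj_point_self unfolding vanishes_at_def by blast
  qed
  obtain S0 S1 where S: "(S0, S1) \<noteq> (0, 0)"
    and rec: "\<And>k. column_start m k \<Longrightarrow> S1 * x $ k = S0 * x $ Suc k"
  proof (cases "\<exists>i. column_start m i \<and> (x $ i, x $ Suc i) \<noteq> (0, 0)")
    case True
    then obtain i where i: "column_start m i" "(x $ i, x $ Suc i) \<noteq> (0, 0)" by blast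
    have "x $ Suc i * x $ k = x $ i * x $ Suc k" if "column_start m k" for k
      using minors[OF i(1) that] by (simp add: minor_def)
    with i(2) show ?thesis using that by blast
  next
    case False
    then show ?thesis using that[of 1 0] by auto
  qed
  \<comment> \<open>The factor of the block starting at \<open>e\<close>. For \<open>S0 = 0\<close> only the last coordinate of a block
    survives, otherwise the first one determines the others.\<close>
  define T where "T e = (if S0 = 0 then x $ (e + m) / S1 ^ m else x $ e / S0 ^ m)" for e
  have key: "x $ (e + j) = T e * (S0 ^ (m - j) * S1 ^ j)" if e: "e = 0 \<or> e = Suc m" and j: "j \<le> m" for e j
  proof -
    have r: "S1 * x $ (e + j) = S0 * x $ (e + Suc j)" if "j < m" for j
      using rec[of "e + j"] e that by (auto simp: column_start_def)
    show ?thesis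
    proof (cases "S0 = 0")
      case True
      then have "S1 \<noteq> 0" using S by simp
      then show ?thesis using r[of j] True j by (cases "j = m") (auto simp: T_def)
    next
      case False
      then show ?thesis using geometric_run[OF False r j] by (simp add: T_def)
    qed
  qed
  have xeq: "x = scroll_point m (T 0) (T (Suc m)) S0 S1"
  proof (rule eq_vecI)
    fix i assume "i < dim_vec (scroll_point m (T 0) (T (Suc m)) S0 S1)"
    then have "i < 2 * m + 2" by simp
    then show "x $ i = scroll_point m (T 0) (T (Suc m)) S0 S1 $ i"
    proof (cases rule: block_index_cases)
      case lower
      then show ?thesis using key[of 0 i] by (simp add: scroll_point_index_lower)
    next
      case (upper j)
      then show ?thesis using key[of "Suc m" j] by (simp add: scroll_point_index_upper)
    qed
  qed (use x in simp)
  moreover have "(T 0, T (Suc m)) \<noteq> (0, 0)"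
  proof
    assume "(T 0, T (Suc m)) = (0, 0)"
    then have "x = 0\<^sub>v (2 * m + 2)" unfolding xeq by (intro eq_vecI) (auto simp: scroll_point_def)
    then show False using x(2) by simp
  qed
  ultimately show "p \<in> ?R" using x(3) S by blast
next
  fix p :: "'a vec set" assume "p \<in> ?R"
  then obtain T0 T1 S0 S1 where T: "(T0, T1) \<noteq> (0, 0)" "(S0, S1) \<noteq> (0, 0)"
    and p: "p = proj_point (scroll_point m T0 T1 S0 S1)" by blast
  have "p \<in> proj_space (2 * m + 1)"
    unfolding p proj_space_def using scroll_point_nonzero[OF T] by auto
  moreover have "vanishes_at f p"
    if f: "homogeneous_poly (2 * m + 2) d f"
      and van: "\<forall>q\<in>{proj_point (scroll_point m 1 t 1 s) |s t. True}. vanishes_at f q" for d f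
  proof -
    have "f (scroll_point m 1 t 1 s) = 0" for s t
      using van proj_point_self unfolding vanishes_at_def by blast
    from homogeneous_poly_vanish_of_chart[OF f this]
    show ?thesis
      unfolding vanishes_at_def p proj_point_def
      using homogeneous_poly_scale[OF f scroll_point_carrier] by auto
  qed
  ultimately show "p \<in> scroll m"
    unfolding scroll_eq_chart_closure zariski_closure_def mem_Collect_eq[of p] by simp blast
qed

lemma minor_scroll:
  assumes "column_start m i" "column_start m k" "p \<in> scroll m" "x \<in> p"
  shows "minor i k (x :: 'a::field_char_0 vec) = 0"
proof -
  obtain T0 T1 S0 S1 c where x: "x = c \<cdot>\<^sub>v scroll_point m T0 T1 S0 S1"
    using assms(3,4) unfolding scroll_eq proj_point_def by blast
  have "minor i k (scroll_point m T0 T1 S0 S1) = 0"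
    using homogeneous_poly_vanish_of_chart[OF homogeneous_minor[OF assms(1,2)]]
      minor_scroll_point_affine[OF assms(1,2)] by blast
  then show ?thesis unfolding x
    using homogeneous_poly_scale[OF homogeneous_minor[OF assms(1,2), where 'a='a] scroll_point_carrier] by auto
qed

section \<open>Linear forms as pairs of polynomials\<close>

text \<open>In the chart a linear form is \<open>f(s) + t g(s)\<close>; here \<open>lower_form\<close> is \<open>f\<close> and \<open>upper_form\<close> is \<open>g\<close>.\<close>

definition lower_form :: "nat \<Rightarrow> 'a::field vec \<Rightarrow> 'a poly" where
  "lower_form m l = (\<Sum>j\<le>m. monom (l $ j) j)"

definition upper_form :: "nat \<Rightarrow> 'a::field vec \<Rightarrow> 'a poly" where
  "upper_form m l = (\<Sum>j\<le>m. monom (l $ Suc (m + j)) j)"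

lemma coeff_lower_form: "coeff (lower_form m l) i = (if i \<le> m then l $ i else 0)"
  by (simp add: lower_form_def coeff_sum)

lemma coeff_upper_form: "coeff (upper_form m l) i = (if i \<le> m then l $ Suc (m + i) else 0)"
  by (simp add: upper_form_def coeff_sum)

lemma degree_lower_form: "degree (lower_form m l) \<le> m"
  by (rule degree_le) (simp add: coeff_lower_form)

lemma degree_upper_form: "degree (upper_form m l) \<le> m"
  by (rule degree_le) (simp add: coeff_upper_form)


lemma form_polys_eqD:
  assumes "l \<in> carrier_vec (2 * m + 2)" "l' \<in> carrier_vec (2 * m + 2)"
    and "lower_form m l = lower_form m l'" "upper_form m l = upper_form m l'"
  shows "l = l'"
proof (rule eq_vecI)
  fix i assume "i < dim_vec l'"
  then have "i < 2 * m + 2" using assms(2) by simp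
  then show "l $ i = l' $ i"
  proof (cases rule: block_index_cases)
    case lower
    then show ?thesis using coeff_lower_form[of m l i] coeff_lower_form[of m l' i] assms(3) by simp
  next
    case (upper j)
    then show ?thesis using coeff_upper_form[of m l j] coeff_upper_form[of m l' j] assms(4) by simp
  qed
qed (use assms in simp)

lemma form_polys_exist:
  fixes f g :: "'a::field poly"
  assumes "degree f \<le> m" "degree g \<le> m"
  obtains l where "l \<in> carrier_vec (2 * m + 2)" "lower_form m l = f" "upper_form m l = g"
proof
  let ?l = "vec (2 * m + 2) (\<lambda>i. if i \<le> m then coeff f i else coeff g (i - Suc m))"
  show "?l \<in> carrier_vec (2 * m + 2)" by simp
  show "lower_form m ?l = f" "upper_form m ?l = g"
    using assms by (intro poly_eqI; auto simp: coeff_lower_form coeff_upper_form coeff_eq_0)+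
qed

lemma form_polys_diff:
  assumes "l \<in> carrier_vec (2 * m + 2)" "l' \<in> carrier_vec (2 * m + 2)"
  shows "lower_form m (l - l') = lower_form m l - lower_form m l'"
    "upper_form m (l - l') = upper_form m l - upper_form m l'"
  using assms by (intro poly_eqI; simp add: coeff_lower_form coeff_upper_form)+

lemma form_polys_smult:
  assumes "l \<in> carrier_vec (2 * m + 2)"
  shows "lower_form m (c \<cdot>\<^sub>v l) = smult c (lower_form m l)"
    "upper_form m (c \<cdot>\<^sub>v l) = smult c (upper_form m l)"
  using assms by (intro poly_eqI; simp add: coeff_lower_form coeff_upper_form)+

lemma form_polys_minus:
  assumes "l \<in> carrier_vec (2 * m + 2)"
  shows "lower_form m (- l) = - lower_form m l" "upper_form m (- l) = - upper_form m l"
  using assms by (intro poly_eqI; simp add: coeff_lower_form coeff_upper_form)+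

lemma form_polys_nonzero:
  assumes l: "l \<in> carrier_vec (2 * m + 2)" and nz: "l \<noteq> 0\<^sub>v (2 * m + 2)"
  shows "(lower_form m l, upper_form m l) \<noteq> (0, 0)"
proof
  assume z: "(lower_form m l, upper_form m l) = (0, 0)"
  have "lower_form m (0\<^sub>v (2 * m + 2)) = (0 :: 'a poly)" "upper_form m (0\<^sub>v (2 * m + 2)) = (0 :: 'a poly)"
    by (intro poly_eqI; simp add: coeff_lower_form coeff_upper_form)+
  then have "l = 0\<^sub>v (2 * m + 2)" using z by (intro form_polys_eqD[OF l zero_carrier_vec]) simp_all
  then show False using nz by simp
qed

lemma scalar_prod_scroll_point:
  assumes "l \<in> carrier_vec (2 * m + 2)"
  shows "l \<bullet> scroll_point m T0 T1 S0 S1 =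
    T0 * (\<Sum>j\<le>m. l $ j * (S0 ^ (m - j) * S1 ^ j)) + T1 * (\<Sum>j\<le>m. l $ Suc (m + j) * (S0 ^ (m - j) * S1 ^ j))"
proof -
  have "l \<bullet> scroll_point m T0 T1 S0 S1 = (\<Sum>i<2 * m + 2. l $ i * scroll_point m T0 T1 S0 S1 $ i)"
    unfolding scalar_prod_def dim_scroll_point atLeast0LessThan ..
  also have "\<dots> = (\<Sum>j\<le>m. l $ j * scroll_point m T0 T1 S0 S1 $ j) +
      (\<Sum>j\<le>m. l $ Suc (m + j) * scroll_point m T0 T1 S0 S1 $ Suc (m + j))"
    by (rule sum_blocks)
  also have "\<dots> = T0 * (\<Sum>j\<le>m. l $ j * (S0 ^ (m - j) * S1 ^ j)) + T1 * (\<Sum>j\<le>m. l $ Suc (m + j) * (S0 ^ (m - j) * S1 ^ j))"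
    by (simp add: scroll_point_index_lower scroll_point_index_upper sum_distrib_left mult.left_commute)
  finally show ?thesis .
qed

lemma scalar_prod_scroll_point_affine:
  assumes "l \<in> carrier_vec (2 * m + 2)"
  shows "l \<bullet> scroll_point m 1 t 1 s = poly (lower_form m l) s + t * poly (upper_form m l) s"
  unfolding scalar_prod_scroll_point[OF assms] lower_form_def upper_form_def
  by (simp add: poly_sum poly_monom)

section \<open>Tangent vectors and the quadrics through the scroll\<close>

lemma matrix_poly_sum:
  assumes "finite S" "\<And>i. i \<in> S \<Longrightarrow> matrix_poly n (f i)"
  shows "matrix_poly n (\<lambda>M. \<Sum>i\<in>S. f i M)"
  using assms by (induction S rule: finite_induct) (auto intro: matrix_poly.intros)

lemma smult_mat_mult_vec:
  fixes B :: "'a::comm_semiring_0 mat"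
  assumes "B \<in> carrier_mat n k" "x \<in> carrier_vec k"
  shows "(r \<cdot>\<^sub>m B) *\<^sub>v x = r \<cdot>\<^sub>v (B *\<^sub>v x)"
  using assms by (intro eq_vecI) (auto simp: scalar_prod_def sum_distrib_left mult.assoc)

text \<open>If \<open>M\<close> stabilizes \<open>X\<close> and \<open>x\<close> is on the cone over the scroll, so is \<open>Ai M A x\<close>. Thus a minor
  at \<open>Ai M A x\<close> is a polynomial in \<open>M\<close> that vanishes on the stabilizer. Its derivative at the
  identity in the direction \<open>B\<close> is the polarization of the minor at \<open>x\<close> and \<open>Ai B A x\<close>.\<close>

lemma tangent_minor:
  fixes A Ai B :: "'a::field_char_0 mat" and m :: nat
  defines "n \<equiv> 2 * m + 2"
  assumes B: "B \<in> lie_algebra_of (2 * m + 1) (proj_image A (scroll m))"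
    and A: "A \<in> carrier_mat n n" and Ai: "Ai \<in> carrier_mat n n" and AiA: "Ai * A = 1\<^sub>m n"
    and cols: "column_start m i" "column_start m k"
    and x: "x = scroll_point m 1 t 1 s" and y: "y = (Ai * B * A) *\<^sub>v x"
  shows "y $ i * x $ Suc k + x $ i * y $ Suc k - (y $ Suc i * x $ k + x $ Suc i * y $ k) = 0"
proof -
  have Bc: "B \<in> carrier_mat n n"
    using B by (simp add: lie_algebra_of_def tangent_at_one_def n_def)
  have xc: "x \<in> carrier_vec n" by (simp add: x n_def)
  have bnd: "i < n" "Suc i < n" "k < n" "Suc k < n"
    using cols by (auto simp: column_start_def n_def)
  \<comment> \<open>Coordinate \<open>j\<close> of \<open>Ai M A x\<close>, written out as a polynomial in the entries of \<open>M\<close>.\<close>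
  define g where "g j M = (\<Sum>a<n. \<Sum>b<n. Ai $$ (j, a) * M $$ (a, b) * (A *\<^sub>v x) $ b)" for j M
  have g_poly: "matrix_poly n (g j)" for j
    unfolding g_def by (intro matrix_poly_sum matrix_poly.intros) auto
  have g: "g j M = (Ai *\<^sub>v (M *\<^sub>v (A *\<^sub>v x))) $ j" if "M \<in> carrier_mat n n" "j < n" for j M
    using that A Ai xc
    by (simp add: g_def scalar_prod_def atLeast0LessThan sum_distrib_left mult.assoc)
  define f where "f M = g i M * g (Suc k) M + (-1) * (g (Suc i) M * g k M)" for M
  have "matrix_poly n f" unfolding f_def by (intro matrix_poly.intros g_poly)
  moreover have "f M = 0" if M: "M \<in> proj_stabilizer (2 * m + 1) (proj_image A (scroll m))" for M
  proof -
    have Mc: "M \<in> carrier_mat n n" and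
      Mi: "proj_image M (proj_image A (scroll m)) = proj_image A (scroll m)"
      using M by (simp_all add: proj_stabilizer_def general_linear_def n_def)
    have "proj_point x \<in> scroll m" unfolding scroll_eq x
      by (intro CollectI exI[of _ 1] exI[of _ t] exI[of _ s] conjI refl) simp_all
    then have "(\<lambda>x. M *\<^sub>v x) ` (\<lambda>x. A *\<^sub>v x) ` proj_point x \<in> proj_image M (proj_image A (scroll m))"
      unfolding proj_image_def by blast
    then obtain p' where p': "p' \<in> scroll m"
      "(\<lambda>x. M *\<^sub>v x) ` (\<lambda>x. A *\<^sub>v x) ` proj_point x = (\<lambda>x. A *\<^sub>v x) ` p'"
      unfolding Mi unfolding proj_image_def by blast
    then have "M *\<^sub>v (A *\<^sub>v x) \<in> (\<lambda>x. A *\<^sub>v x) ` p'" using proj_point_self by blast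
    then obtain x' where x': "x' \<in> p'" "M *\<^sub>v (A *\<^sub>v x) = A *\<^sub>v x'" by blast
    have x'c: "x' \<in> carrier_vec n"
      using x'(1) p'(1) unfolding scroll_eq proj_point_def n_def by force
    have "Ai *\<^sub>v (M *\<^sub>v (A *\<^sub>v x)) = x'"
      unfolding x'(2) using assoc_mult_mat_vec[OF Ai A x'c] x'c by (simp add: AiA)
    then show "f M = 0"
      using minor_scroll[OF cols p'(1) x'(1)] bnd
      by (simp add: f_def g[OF Mc] minor_def)
  qed
  moreover have "\<forall>f. matrix_poly n f \<and>
      (\<forall>M\<in>proj_stabilizer (2 * m + 1) (proj_image A (scroll m)). f M = 0) \<longrightarrow>
      (\<exists>P. (\<forall>r. poly P r = f (1\<^sub>m n + r \<cdot>\<^sub>m B)) \<and> poly (pderiv P) 0 = 0)"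
    using B by (simp add: lie_algebra_of_def tangent_at_one_def n_def)
  ultimately have "\<exists>P. (\<forall>r. poly P r = f (1\<^sub>m n + r \<cdot>\<^sub>m B)) \<and> poly (pderiv P) 0 = 0"
    by blast
  then obtain P where P: "\<And>r. poly P r = f (1\<^sub>m n + r \<cdot>\<^sub>m B)" and P0: "poly (pderiv P) 0 = 0"
    by blast
  have lin: "g j (1\<^sub>m n + r \<cdot>\<^sub>m B) = x $ j + r * y $ j" if j: "j < n" for j r
  proof -
    have Axc: "A *\<^sub>v x \<in> carrier_vec n" using A xc by simp
    have BAxc: "B *\<^sub>v (A *\<^sub>v x) \<in> carrier_vec n" using Bc Axc by simp
    have "(1\<^sub>m n + r \<cdot>\<^sub>m B) *\<^sub>v (A *\<^sub>v x) = A *\<^sub>v x + r \<cdot>\<^sub>v (B *\<^sub>v (A *\<^sub>v x))"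
      using add_mult_distrib_mat_vec[of "1\<^sub>m n" n n "r \<cdot>\<^sub>m B" "A *\<^sub>v x"] Axc Bc
      by (simp add: smult_mat_mult_vec[of _ n n])
    then have "Ai *\<^sub>v ((1\<^sub>m n + r \<cdot>\<^sub>m B) *\<^sub>v (A *\<^sub>v x)) = Ai *\<^sub>v (A *\<^sub>v x) + r \<cdot>\<^sub>v (Ai *\<^sub>v (B *\<^sub>v (A *\<^sub>v x)))"
      using mult_add_distrib_mat_vec[OF Ai Axc, of "r \<cdot>\<^sub>v (B *\<^sub>v (A *\<^sub>v x))"]
        mult_mat_vec[OF Ai, of "B *\<^sub>v (A *\<^sub>v x)" r] Bc Axc by simp
    moreover have "Ai *\<^sub>v (A *\<^sub>v x) = x"
      using assoc_mult_mat_vec[OF Ai A xc] xc by (simp add: AiA)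
    moreover have "Ai *\<^sub>v (B *\<^sub>v (A *\<^sub>v x)) = y"
      unfolding y using assoc_mult_mat_vec[of "Ai * B" n n A n x] assoc_mult_mat_vec[of Ai n n B n "A *\<^sub>v x"]
        A Ai Bc xc by simp
    moreover have "y \<in> carrier_vec n"
      unfolding y using mult_mat_vec_carrier[OF mult_carrier_mat[OF mult_carrier_mat[OF Ai Bc] A] xc] .
    ultimately show ?thesis using g[of "1\<^sub>m n + r \<cdot>\<^sub>m B" j] Bc xc j by simp
  qed
  let ?L = "\<lambda>j. [:x $ j, y $ j:]"
  have "poly P r = poly (?L i * ?L (Suc k) - ?L (Suc i) * ?L k) r" for r
    unfolding P f_def using bnd by (simp add: lin algebra_simps)
  then have "P = ?L i * ?L (Suc k) - ?L (Suc i) * ?L k"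
    by (simp add: poly_eq_poly_eq_iff[symmetric] fun_eq_iff)
  then show ?thesis using P0 by (simp add: pderiv_mult pderiv_diff pderiv_pCons algebra_simps)
qed

section \<open>Normal form of the infinitesimal symmetries\<close>

text \<open>The Lie derivative along the vector field \<open>\<mu> d/ds\<close> of \<open>f (d/ds)\<^bsup>m/2\<^esup>\<close>, a section of
  \<open>O(m)\<close> on the projective line. For quadratic \<open>\<mu>\<close> it preserves the polynomials of degree at most
  \<open>m\<close>.\<close>

definition lie_deriv :: "nat \<Rightarrow> 'a::field poly \<Rightarrow> 'a poly \<Rightarrow> 'a poly" where
  "lie_deriv m \<mu> f = \<mu> * pderiv f - smult (of_nat m / 2) (pderiv \<mu> * f)"

text \<open>For \<open>F = f + t g\<close> the right-hand sides are the components of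
  \<open>\<kappa> F + (\<rho> \<partial>F/\<partial>t - \<rho>'/2 F) + (\<mu> \<partial>F/\<partial>s - m/2 \<mu>' F)\<close>; the powers of \<open>t\<close> above the first
  cancel. The transpose appears because forms are pulled back along \<open>D\<close>.\<close>

definition acts_by :: "nat \<Rightarrow> 'a::field mat \<Rightarrow> 'a \<Rightarrow> 'a poly \<Rightarrow> 'a poly \<Rightarrow> bool" where
  "acts_by m D \<kappa> \<rho> \<mu> \<longleftrightarrow> D \<in> carrier_mat (2 * m + 2) (2 * m + 2) \<and> degree \<rho> \<le> 2 \<and> degree \<mu> \<le> 2 \<and>
    (\<forall>l\<in>carrier_vec (2 * m + 2).
      lower_form m (transpose_mat D *\<^sub>v l) = smult (\<kappa> - coeff \<rho> 1 / 2) (lower_form m l) +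
        smult (coeff \<rho> 0) (upper_form m l) + lie_deriv m \<mu> (lower_form m l) \<and>
      upper_form m (transpose_mat D *\<^sub>v l) = smult (\<kappa> + coeff \<rho> 1 / 2) (upper_form m l) -
        smult (coeff \<rho> 2) (lower_form m l) + lie_deriv m \<mu> (upper_form m l))"

lemma poly_eqI_all:
  fixes p q :: "'a::field_char_0 poly"
  assumes "\<And>x. poly p x = poly q x"
  shows "p = q"
  using assms by (simp add: poly_eq_poly_eq_iff[symmetric] fun_eq_iff)

lemma quadratic_eq_0:
  fixes u v w :: "'a::field_char_0"
  assumes "\<And>t. u + t * v + t * t * w = 0"
  shows "u = 0" "v = 0" "w = 0"
proof -
  have a: "u = 0" "u + v + w = 0" "u - v + w = 0"
    using assms[of 0] assms[of 1] assms[of "-1"] by simp_all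
  then have "v = w" "v = - w" by (simp_all add: eq_neg_iff_add_eq_0)
  then have "w = 0" by simp
  with a \<open>v = w\<close> show "u = 0" "v = 0" "w = 0" by simp_all
qed

lemma degree_of_monom_mult:
  fixes p :: "'a::field poly"
  assumes "degree (monom 1 k * p) \<le> k + d" shows "degree p \<le> d"
  using assms by (cases "p = 0") (auto simp: degree_mult_eq degree_monom_eq monom_eq_0_iff)

text \<open>The recursion satisfied by the rows of a tangent vector. Its solution is \<open>s\<^sup>j\<close> times the initial
  row plus the multiple \<open>\<mu>\<close> of the derivative of \<open>s\<^sup>j\<close>, which is how a vector field shows up.\<close>

lemma recurrence_solution:
  fixes P :: "nat \<Rightarrow> 'a::field poly"
  assumes "\<And>j. j < m \<Longrightarrow> P (Suc j) = monom 1 1 * P j + monom 1 j * \<mu>" and "j \<le> m"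
  shows "P j = monom 1 j * P 0 + monom (of_nat j) (j - 1) * \<mu>"
  using assms(2)
proof (induction j)
  case (Suc j)
  then have IH: "P j = monom 1 j * P 0 + monom (of_nat j) (j - 1) * \<mu>" by simp
  have "monom 1 1 * monom (of_nat j) (j - 1) + monom 1 j = (monom (of_nat (Suc j)) j :: 'a poly)"
    by (cases j) (simp_all add: mult_monom add_monom)
  note step = this
  have "P (Suc j) = monom 1 1 * (monom 1 j * P 0 + monom (of_nat j) (j - 1) * \<mu>) + monom 1 j * \<mu>"
    using assms(1)[of j] Suc(2) IH by simp
  also have "\<dots> = (monom 1 1 * monom 1 j) * P 0 + (monom 1 1 * monom (of_nat j) (j - 1) + monom 1 j) * \<mu>"
    by (simp only: distrib_left distrib_right mult.assoc add.assoc)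
  also have "\<dots> = monom 1 (Suc j) * P 0 + monom (of_nat (Suc j)) j * \<mu>"
    by (simp only: step) (simp add: mult_monom)
  finally show ?case by simp
qed simp

lemma sum_form_recurrence:
  fixes f :: "nat \<Rightarrow> 'a::field_char_0"
  shows "(\<Sum>j\<le>m. smult (f j) (monom 1 j * a + monom (of_nat j) (j - 1) * \<mu>)) =
    (\<Sum>j\<le>m. monom (f j) j) * a + pderiv (\<Sum>j\<le>m. monom (f j) j) * \<mu>"
proof -
  have m1: "monom c j = smult c (monom 1 j)" for c :: 'a and j by (simp add: smult_monom)
  have "smult (f j) (monom 1 j * a + monom (of_nat j) (j - 1) * \<mu>) =
      monom (f j) j * a + pderiv (monom (f j) j) * \<mu>" for j
    unfolding pderiv_monom unfolding m1[of "f j" j] m1[of "of_nat j * f j"] m1[of "of_nat j" "j - 1"]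
    by (simp add: smult_add_right mult.commute[of "f j"])
  then show ?thesis by (simp only: sum.distrib sum_distrib_right pderiv_sum)
qed

lemma sum_recurrence_solution:
  fixes f :: "nat \<Rightarrow> 'a::field_char_0"
  assumes "\<And>j. j \<le> m \<Longrightarrow> P j = monom 1 j * a + monom (of_nat j) (j - 1) * \<mu>"
  shows "(\<Sum>j\<le>m. smult (f j) (P j)) = (\<Sum>j\<le>m. monom (f j) j) * a + pderiv (\<Sum>j\<le>m. monom (f j) j) * \<mu>"
  unfolding sum_form_recurrence[symmetric] by (rule sum.cong) (simp_all add: assms)

text \<open>Applied to the multiplier \<open>a\<close> in row \<open>0\<close>: that row \<open>m\<close> has degree at most \<open>m\<close> forces the
  coefficients of \<open>s\<^sup>2\<close> and higher of \<open>s a\<close> to cancel those of \<open>m \<mu>\<close>, and leaves one constant free.\<close>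

lemma coefficient_of_vector_field:
  fixes a \<mu> :: "'a::field_char_0 poly"
  assumes "degree (monom 1 1 * a + smult (of_nat m) \<mu>) \<le> 1" "degree \<mu> \<le> 2"
  obtains \<alpha> where "a = [:\<alpha>:] - smult (of_nat m / 2) (pderiv \<mu>)"
proof
  show "a = [:coeff a 0 + of_nat m / 2 * coeff \<mu> 1:] - smult (of_nat m / 2) (pderiv \<mu>)"
  proof (rule poly_eqI)
    fix i
    have c: "coeff (monom 1 1 * a + smult (of_nat m) \<mu>) (Suc (Suc i)) = 0" for i
      by (rule coeff_eq_0) (use assms(1) in simp)
    have c': "coeff a (Suc i) = - of_nat m * coeff \<mu> (Suc (Suc i))" for i
      using c[of i] by (simp add: coeff_monom_mult eq_neg_iff_add_eq_0)
    have d: "coeff \<mu> (Suc (Suc (Suc i))) = 0" for i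
      by (rule coeff_eq_0) (use assms(2) in simp)
    consider "i = 0" | "i = 1" | k where "i = Suc (Suc k)"
      by (metis One_nat_def not0_implies_Suc)
    then show "coeff a i = coeff ([:coeff a 0 + of_nat m / 2 * coeff \<mu> 1:] - smult (of_nat m / 2) (pderiv \<mu>)) i"
      by cases (simp_all add: coeff_pderiv c' d)
  qed
qed

lemma lower_form_transpose:
  assumes "D \<in> carrier_mat (2 * m + 2) (2 * m + 2)" "l \<in> carrier_vec (2 * m + 2)"
  shows "lower_form m (transpose_mat D *\<^sub>v l) = (\<Sum>j\<le>m. smult (l $ j) (lower_form m (row D j))) +
    (\<Sum>j\<le>m. smult (l $ Suc (m + j)) (lower_form m (row D (Suc (m + j)))))" (is ?L)
    and "upper_form m (transpose_mat D *\<^sub>v l) = (\<Sum>j\<le>m. smult (l $ j) (upper_form m (row D j))) +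
    (\<Sum>j\<le>m. smult (l $ Suc (m + j)) (upper_form m (row D (Suc (m + j)))))" (is ?U)
proof -
  have e: "(transpose_mat D *\<^sub>v l) $ i = (\<Sum>k<2 * m + 2. l $ k * row D k $ i)" if "i < 2 * m + 2" for i
    using that assms by (simp add: scalar_prod_def atLeast0LessThan mult.commute)
  show ?L unfolding sum_blocks[of "\<lambda>j. smult (l $ j) (lower_form m (row D j))", symmetric]
    by (rule poly_eqI) (simp add: coeff_sum coeff_lower_form e)
  show ?U unfolding sum_blocks[of "\<lambda>j. smult (l $ j) (upper_form m (row D j))", symmetric]
    by (rule poly_eqI) (simp add: coeff_sum coeff_upper_form e)
qed

text \<open>Let \<open>a j + t b j\<close> and \<open>c j + t d j\<close> be the rows of \<open>D\<close> in the two blocks, as functions on the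
  chart. Polarizing the minors on the first column and a column of either block, and separating
  the powers of \<open>t\<close>, gives the same recursion for \<open>a\<close> and \<open>d\<close>, with a common \<open>\<mu>\<close>, and the
  recursion with \<open>\<mu> = 0\<close> for \<open>b\<close> and \<open>c\<close>. Since every row has degree at most \<open>m\<close>, the last two
  consist of multiples of \<open>s\<^sup>j\<close>, \<open>\<mu>\<close> is quadratic, and \<open>a 0\<close> and \<open>d 0\<close> are determined up to
  constants. The four remaining constants form a \<open>2 \<times> 2\<close> matrix, which is \<open>\<kappa>\<close> together with \<open>\<rho>\<close>.\<close>

lemma acts_by_of_minors:
  fixes D :: "'a::field_char_0 mat"
  assumes m: "m \<ge> 1" and D: "D \<in> carrier_mat (2 * m + 2) (2 * m + 2)"
    and minors: "\<And>i k t s x y. column_start m i \<Longrightarrow> column_start m k \<Longrightarrow> x = scroll_point m 1 t 1 s \<Longrightarrow>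
      y = D *\<^sub>v x \<Longrightarrow> y $ i * x $ Suc k + x $ i * y $ Suc k - (y $ Suc i * x $ k + x $ Suc i * y $ k) = 0"
  shows "\<exists>\<kappa> \<rho> \<mu>. acts_by m D \<kappa> \<rho> \<mu>"
proof -
  define a b c d where "a j = lower_form m (row D j)" and "b j = upper_form m (row D j)"
    and "c j = lower_form m (row D (Suc (m + j)))" and "d j = upper_form m (row D (Suc (m + j)))" for j
  have deg: "degree (a j) \<le> m" "degree (b j) \<le> m" "degree (c j) \<le> m" "degree (d j) \<le> m" for j
    by (simp_all add: a_def b_def c_def d_def degree_lower_form degree_upper_form)
  have y: "(D *\<^sub>v scroll_point m 1 t 1 s) $ i =
      poly (lower_form m (row D i)) s + t * poly (upper_form m (row D i)) s" if "i < 2 * m + 2" for i t s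
    using that D scalar_prod_scroll_point_affine[of "row D i" m t s] by simp
  have yl: "(D *\<^sub>v scroll_point m 1 t 1 s) $ j = poly (a j) s + t * poly (b j) s" if "j \<le> m" for j t s
    using y[of j t s] that by (simp add: a_def b_def)
  have yu: "(D *\<^sub>v scroll_point m 1 t 1 s) $ Suc (m + j) = poly (c j) s + t * poly (d j) s" if "j \<le> m" for j t s
    using y[of "Suc (m + j)" t s] that by (simp add: c_def d_def)
  have xl: "scroll_point m 1 t 1 s $ j = s ^ j" if "j \<le> m" for j and t s :: 'a
    using that by (simp add: scroll_point_index_lower)
  have xu: "scroll_point m 1 t 1 s $ Suc (m + j) = t * s ^ j" if "j \<le> m" for j and t s :: 'a
    using that by (simp add: scroll_point_index_upper)
  have c0: "column_start m 0" using m by (simp add: column_start_def)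
  let ?X = "monom 1 1 :: 'a poly"
  define \<mu> where "\<mu> = a 1 - ?X * a 0"
  have lowrel: "a (Suc j) = ?X * a j + monom 1 j * \<mu>" "b (Suc j) = ?X * b j + monom 1 j * (b 1 - ?X * b 0)"
    if j: "j < m" for j
  proof -
    have cj: "column_start m j" using j by (simp add: column_start_def)
    have r: "(poly (a 0) s * s ^ Suc j + poly (a (Suc j)) s - poly (a 1) s * s ^ j - s * poly (a j) s) +
        t * (poly (b 0) s * s ^ Suc j + poly (b (Suc j)) s - poly (b 1) s * s ^ j - s * poly (b j) s) + t * t * 0 = 0" for s t
      using minors[OF c0 cj refl refl, of t s] m j xl[of 0 t s] xl[of 1 t s] xl[of j t s] xl[of "Suc j" t s]
        yl[of 0 t s] yl[of 1 t s] yl[of j t s] yl[of "Suc j" t s]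
      by (simp add: algebra_simps)
    show "a (Suc j) = ?X * a j + monom 1 j * \<mu>"
      by (rule poly_eqI_all) (use quadratic_eq_0(1)[OF r] in \<open>simp add: \<mu>_def poly_monom algebra_simps\<close>)
    show "b (Suc j) = ?X * b j + monom 1 j * (b 1 - ?X * b 0)"
      by (rule poly_eqI_all) (use quadratic_eq_0(2)[OF r] in \<open>simp add: poly_monom algebra_simps\<close>)
  qed
  have uprel: "c (Suc j) = ?X * c j + monom 1 j * 0" "d (Suc j) = ?X * d j + monom 1 j * \<mu>"
    "monom 1 j * (b 1 - ?X * b 0) = 0"
    if j: "j < m" for j
  proof -
    have cj: "column_start m (Suc (m + j))" using j by (simp add: column_start_def)
    have r: "(poly (c (Suc j)) s - s * poly (c j) s) +
        t * (poly (a 0) s * s ^ Suc j + poly (d (Suc j)) s - poly (a 1) s * s ^ j - s * poly (d j) s) +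
        t * t * (poly (b 0) s * s ^ Suc j - poly (b 1) s * s ^ j) = 0" for s t
      using minors[OF c0 cj refl refl, of t s] m j xl[of 0 t s] xl[of 1 t s] xu[of j t s] xu[of "Suc j" t s]
        yl[of 0 t s] yl[of 1 t s] yu[of j t s] yu[of "Suc j" t s]
      by (simp add: algebra_simps)
    show "c (Suc j) = ?X * c j + monom 1 j * 0"
      by (rule poly_eqI_all) (use quadratic_eq_0(1)[OF r] in \<open>simp add: poly_monom algebra_simps\<close>)
    show "d (Suc j) = ?X * d j + monom 1 j * \<mu>"
      by (rule poly_eqI_all) (use quadratic_eq_0(2)[OF r] in \<open>simp add: \<mu>_def poly_monom algebra_simps\<close>)
    show "monom 1 j * (b 1 - ?X * b 0) = 0"
    proof (rule poly_eqI_all)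
      fix s show "poly (monom 1 j * (b 1 - ?X * b 0)) s = poly 0 s"
        using quadratic_eq_0(3)[OF r, of s] by (auto simp: poly_monom algebra_simps)
    qed
  qed
  have b1: "b 1 - ?X * b 0 = 0" using uprel(3)[of 0] m by (simp add: monom_0 one_pCons[symmetric])
  have as: "a j = monom 1 j * a 0 + monom (of_nat j) (j - 1) * \<mu>"
    and bs: "b j = monom 1 j * b 0 + monom (of_nat j) (j - 1) * 0"
    and cs: "c j = monom 1 j * c 0 + monom (of_nat j) (j - 1) * 0"
    and ds: "d j = monom 1 j * d 0 + monom (of_nat j) (j - 1) * \<mu>" if "j \<le> m" for j
    using recurrence_solution[OF lowrel(1) that] recurrence_solution[OF lowrel(2)[unfolded b1] that]
      recurrence_solution[OF uprel(1) that] recurrence_solution[OF uprel(2) that] by blast+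
  have factor: "monom 1 j * p + monom (of_nat j) (j - 1) * \<mu> =
      monom 1 (j - 1) * (?X * p + smult (of_nat j) \<mu>)" if "j \<ge> 1" for j p
  proof -
    have "monom 1 j = monom 1 (j - 1) * ?X" "monom (of_nat j) (j - 1) = smult (of_nat j) (monom 1 (j - 1) :: 'a poly)"
      using that by (simp_all add: mult_monom smult_monom)
    then show ?thesis by (simp add: algebra_simps)
  qed
  have "degree (b 0) \<le> 0" "degree (c 0) \<le> 0"
    using bs[of m] cs[of m] deg[of m] degree_of_monom_mult[of m "b 0" 0] degree_of_monom_mult[of m "c 0" 0]
    by simp_all
  then obtain \<beta> \<gamma> where bc: "b 0 = [:\<beta>:]" "c 0 = [:\<gamma>:]" by (metis degree_0_id le_zero_eq degree_eq_zeroE)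
  have e1: "degree (?X * a 0 + smult (of_nat m) \<mu>) \<le> 1" "degree (?X * d 0 + smult (of_nat m) \<mu>) \<le> 1"
    using as[of m] ds[of m] deg[of m] m factor[OF m, of "a 0"] factor[OF m, of "d 0"]
      degree_of_monom_mult[of "m - 1" "?X * a 0 + smult (of_nat m) \<mu>" 1]
      degree_of_monom_mult[of "m - 1" "?X * d 0 + smult (of_nat m) \<mu>" 1]
    by simp_all
  have mu: "degree \<mu> \<le> 2"
  proof (cases "m = 1")
    case True
    have "degree (?X * a 0) \<le> 1 + 1"
      using degree_mult_le[of ?X "a 0"] deg(1)[of 0] True degree_monom_le[of "1 :: 'a" 1] by linarith
    moreover have "degree (a 1) \<le> 1 + 1" using deg(1)[of 1] True by simp
    ultimately show ?thesis unfolding \<mu>_def using degree_diff_le[of "a 1" 2 "?X * a 0"] by simp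
  next
    case False
    then have "degree (monom 1 (m - 1 - 1) * (?X * a 0 + smult (of_nat (m - 1)) \<mu>)) \<le> (m - 1 - 1) + 2"
      using as[of "m - 1"] factor[of "m - 1" "a 0"] deg(1)[of "m - 1"] m by simp
    then have "degree (?X * a 0 + smult (of_nat (m - 1)) \<mu>) \<le> 2" by (rule degree_of_monom_mult)
    moreover have "degree (?X * a 0 + smult (of_nat m) \<mu>) \<le> 2" using e1(1) by simp
    moreover have "\<mu> = (?X * a 0 + smult (of_nat m) \<mu>) - (?X * a 0 + smult (of_nat (m - 1)) \<mu>)"
    proof -
      have "smult (of_nat m) \<mu> = smult (of_nat (m - 1)) \<mu> + \<mu>"
        using m smult_add_left[of "of_nat (m - 1)" 1 \<mu>] by (simp add: of_nat_diff)
      then show ?thesis by simp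
    qed
    ultimately show ?thesis by (metis degree_diff_le)
  qed
  obtain \<alpha> \<delta> where ad: "a 0 = [:\<alpha>:] - smult (of_nat m / 2) (pderiv \<mu>)" "d 0 = [:\<delta>:] - smult (of_nat m / 2) (pderiv \<mu>)"
    using coefficient_of_vector_field[OF e1(1) mu] coefficient_of_vector_field[OF e1(2) mu] by metis
  have "acts_by m D ((\<alpha> + \<delta>) / 2) [:\<gamma>, \<delta> - \<alpha>, - \<beta>:] \<mu>"
    unfolding acts_by_def
  proof (intro conjI ballI D mu)
    show "degree [:\<gamma>, \<delta> - \<alpha>, - \<beta>:] \<le> 2" by (simp add: degree_pCons_le)
    fix l :: "'a vec" assume l: "l \<in> carrier_vec (2 * m + 2)"
    let ?f = "lower_form m l" and ?g = "upper_form m l"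
    have \<alpha>\<delta>: "(\<alpha> + \<delta>) / 2 - (\<delta> - \<alpha>) / 2 = \<alpha>" "(\<alpha> + \<delta>) / 2 + (\<delta> - \<alpha>) / 2 = \<delta>"
      by (simp_all add: field_simps)
    have prods: "p * a 0 = smult \<alpha> p - smult (of_nat m / 2) (pderiv \<mu> * p)"
      "p * d 0 = smult \<delta> p - smult (of_nat m / 2) (pderiv \<mu> * p)"
      "p * c 0 = smult \<gamma> p" "p * b 0 = smult \<beta> p" for p
      by (simp_all add: ad bc right_diff_distrib mult.commute[of p "pderiv \<mu>"])
    have coeffs: "coeff [:\<gamma>, \<delta> - \<alpha>, - \<beta>:] 0 = \<gamma>" "coeff [:\<gamma>, \<delta> - \<alpha>, - \<beta>:] 1 = \<delta> - \<alpha>"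
      "coeff [:\<gamma>, \<delta> - \<alpha>, - \<beta>:] 2 = - \<beta>"
      by (simp_all add: numeral_2_eq_2)
    have "lower_form m (transpose_mat D *\<^sub>v l) = (?f * a 0 + pderiv ?f * \<mu>) + (?g * c 0 + pderiv ?g * 0)"
      unfolding lower_form_transpose(1)[OF D l] c_def[symmetric] unfolding a_def[symmetric]
        lower_form_def[of m l] upper_form_def[of m l]
      by (simp only: sum_recurrence_solution[of m a, OF as] sum_recurrence_solution[of m c, OF cs])
    then show "lower_form m (transpose_mat D *\<^sub>v l) =
      smult ((\<alpha> + \<delta>) / 2 - coeff [:\<gamma>, \<delta> - \<alpha>, - \<beta>:] 1 / 2) ?f + smult (coeff [:\<gamma>, \<delta> - \<alpha>, - \<beta>:] 0) ?g + lie_deriv m \<mu> ?f"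
      unfolding coeffs \<alpha>\<delta> prods lie_deriv_def by (simp add: mult.commute[of \<mu>])
    have "upper_form m (transpose_mat D *\<^sub>v l) = (?f * b 0 + pderiv ?f * 0) + (?g * d 0 + pderiv ?g * \<mu>)"
      unfolding lower_form_transpose(2)[OF D l] d_def[symmetric] unfolding b_def[symmetric]
        lower_form_def[of m l] upper_form_def[of m l]
      by (simp only: sum_recurrence_solution[of m b, OF bs] sum_recurrence_solution[of m d, OF ds])
    then show "upper_form m (transpose_mat D *\<^sub>v l) =
      smult ((\<alpha> + \<delta>) / 2 + coeff [:\<gamma>, \<delta> - \<alpha>, - \<beta>:] 1 / 2) ?g - smult (coeff [:\<gamma>, \<delta> - \<alpha>, - \<beta>:] 2) ?f + lie_deriv m \<mu> ?g"
      unfolding coeffs \<alpha>\<delta> prods lie_deriv_def by (simp add: mult.commute[of \<mu>])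
  qed
  then show ?thesis by blast
qed

section \<open>Vector fields acting on forms\<close>

definition vf_bracket :: "'a::field poly \<Rightarrow> 'a poly \<Rightarrow> 'a poly" where
  "vf_bracket \<mu> \<nu> = \<mu> * pderiv \<nu> - \<nu> * pderiv \<mu>"

lemma lie_deriv_add: "lie_deriv m \<mu> (f + g) = lie_deriv m \<mu> f + lie_deriv m \<mu> g"
  by (simp add: lie_deriv_def pderiv_add algebra_simps smult_add_right)

lemma lie_deriv_diff: "lie_deriv m \<mu> (f - g) = lie_deriv m \<mu> f - lie_deriv m \<mu> g"
  by (simp add: lie_deriv_def pderiv_diff algebra_simps smult_diff_right)

lemma lie_deriv_minus: "lie_deriv m \<mu> (- f) = - lie_deriv m \<mu> f"
  by (simp add: lie_deriv_def pderiv_minus algebra_simps)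

lemma lie_deriv_smult: "lie_deriv m \<mu> (smult c f) = smult c (lie_deriv m \<mu> f)"
  by (simp add: lie_deriv_def pderiv_smult smult_diff_right mult.commute)

lemma lie_deriv_zero_right [simp]: "lie_deriv m \<mu> 0 = 0"
  by (simp add: lie_deriv_def)

lemma lie_deriv_zero_left [simp]: "lie_deriv m 0 f = 0"
  by (simp add: lie_deriv_def)

text \<open>The terms of second order cancel, and \<open>\<mu> \<nu>'' - \<nu> \<mu>''\<close> is the derivative of the bracket.\<close>

lemma lie_deriv_commutator:
  fixes \<mu> \<nu> f :: "'a::field_char_0 poly"
  shows "lie_deriv m \<mu> (lie_deriv m \<nu> f) - lie_deriv m \<nu> (lie_deriv m \<mu> f) = lie_deriv m (vf_bracket \<mu> \<nu>) f"
proof -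
  define K where "K = [:of_nat m / 2 :: 'a:]"
  have K: "smult (of_nat m / 2) p = K * p" for p by (simp add: K_def)
  have K': "pderiv (K * p) = K * pderiv p" for p by (simp add: K_def pderiv_smult)
  have K0: "pderiv K = 0" by (simp add: K_def pderiv_pCons)
  show ?thesis unfolding lie_deriv_def vf_bracket_def K
    by (simp only: pderiv_diff pderiv_mult K') (simp add: algebra_simps K0)
qed

lemma quadratic_poly_cases:
  fixes p :: "'a::zero poly"
  assumes "degree p \<le> 2" obtains a b c where "p = [:a, b, c:]"
proof
  show "p = [:coeff p 0, coeff p 1, coeff p 2:]"
  proof (rule poly_eqI)
    fix i show "coeff p i = coeff [:coeff p 0, coeff p 1, coeff p 2:] i"
      using assms by (cases i; cases "i - 1"; cases "i - 2")
        (auto simp: coeff_pCons numeral_2_eq_2 split: nat.splits intro!: coeff_eq_0)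
  qed
qed

lemma vf_bracket_quadratic:
  "vf_bracket [:a, b, c:] [:a', b', c':] = [:a * b' - a' * b, 2 * (a * c' - a' * c), b * c' - b' * c:]"
  by (simp add: vf_bracket_def pderiv_pCons algebra_simps)

lemma degree_vf_bracket:
  assumes "degree \<mu> \<le> 2" "degree \<nu> \<le> 2" shows "degree (vf_bracket \<mu> \<nu>) \<le> 2"
proof -
  obtain a b c where "\<mu> = [:a, b, c:]" using quadratic_poly_cases[OF assms(1)] .
  moreover obtain a' b' c' where "\<nu> = [:a', b', c':]" using quadratic_poly_cases[OF assms(2)] .
  ultimately show ?thesis by (simp add: vf_bracket_quadratic degree_pCons_le)
qed

lemma acts_byD:
  assumes "acts_by m D \<kappa> \<rho> \<mu>" "l \<in> carrier_vec (2 * m + 2)"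
  shows "lower_form m (transpose_mat D *\<^sub>v l) = smult (\<kappa> - coeff \<rho> 1 / 2) (lower_form m l) +
        smult (coeff \<rho> 0) (upper_form m l) + lie_deriv m \<mu> (lower_form m l)"
      "upper_form m (transpose_mat D *\<^sub>v l) = smult (\<kappa> + coeff \<rho> 1 / 2) (upper_form m l) -
        smult (coeff \<rho> 2) (lower_form m l) + lie_deriv m \<mu> (upper_form m l)"
  using assms unfolding acts_by_def by blast+

lemma transpose_mat_smult: "transpose_mat (c \<cdot>\<^sub>m A) = c \<cdot>\<^sub>m transpose_mat A"
  by (rule eq_matI) simp_all

lemma acts_by_smult:
  fixes D :: "'a::field_char_0 mat"
  assumes "acts_by m D \<kappa> \<rho> \<mu>" shows "acts_by m (c \<cdot>\<^sub>m D) (c * \<kappa>) (smult c \<rho>) (smult c \<mu>)"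
  unfolding acts_by_def
proof (intro conjI ballI)
  have D: "D \<in> carrier_mat (2 * m + 2) (2 * m + 2)" and deg: "degree \<rho> \<le> 2" "degree \<mu> \<le> 2"
    using assms unfolding acts_by_def by blast+
  then show "c \<cdot>\<^sub>m D \<in> carrier_mat (2 * m + 2) (2 * m + 2)" by simp
  show "degree (smult c \<rho>) \<le> 2" "degree (smult c \<mu>) \<le> 2" using deg by (meson degree_smult_le le_trans)+
  fix l :: "'a vec" assume l: "l \<in> carrier_vec (2 * m + 2)"
  have T: "transpose_mat (c \<cdot>\<^sub>m D) *\<^sub>v l = c \<cdot>\<^sub>v (transpose_mat D *\<^sub>v l)"
    using D l smult_mat_mult_vec[of "transpose_mat D" "2 * m + 2" "2 * m + 2" l c]
    by (simp add: transpose_mat_smult)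
  have Dl: "transpose_mat D *\<^sub>v l \<in> carrier_vec (2 * m + 2)" using D l by simp
  have ld: "lie_deriv m (smult c \<mu>) f = smult c (lie_deriv m \<mu> f)" for f
    by (simp add: lie_deriv_def pderiv_smult smult_diff_right mult.commute)
  show "lower_form m (transpose_mat (c \<cdot>\<^sub>m D) *\<^sub>v l) = smult (c * \<kappa> - coeff (smult c \<rho>) 1 / 2) (lower_form m l) +
        smult (coeff (smult c \<rho>) 0) (upper_form m l) + lie_deriv m (smult c \<mu>) (lower_form m l)"
    unfolding T form_polys_smult[OF Dl] acts_byD[OF assms l] ld
    by (simp add: smult_add_right algebra_simps)
  show "upper_form m (transpose_mat (c \<cdot>\<^sub>m D) *\<^sub>v l) = smult (c * \<kappa> + coeff (smult c \<rho>) 1 / 2) (upper_form m l) -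
        smult (coeff (smult c \<rho>) 2) (lower_form m l) + lie_deriv m (smult c \<mu>) (upper_form m l)"
    unfolding T form_polys_smult[OF Dl] acts_byD[OF assms l] ld
    by (simp add: smult_add_right smult_diff_right algebra_simps)
qed

text \<open>Passing to forms reverses the order of products, hence the exchanged arguments of the brackets.\<close>

lemma acts_by_bracket:
  fixes D E :: "'a::field_char_0 mat"
  assumes D: "acts_by m D \<kappa> \<rho> \<mu>" and E: "acts_by m E \<kappa>' \<rho>' \<mu>'"
  shows "acts_by m (bracket D E) 0 (vf_bracket \<rho>' \<rho>) (vf_bracket \<mu>' \<mu>)"
  unfolding acts_by_def
proof (intro conjI ballI)
  let ?n = "2 * m + 2"
  have c: "D \<in> carrier_mat ?n ?n" "E \<in> carrier_mat ?n ?n"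
    and deg: "degree \<rho> \<le> 2" "degree \<mu> \<le> 2" "degree \<rho>' \<le> 2" "degree \<mu>' \<le> 2"
    using D E unfolding acts_by_def by blast+
  then show "bracket D E \<in> carrier_mat ?n ?n"
    unfolding bracket_def by (intro minus_carrier_mat mult_carrier_mat)
  show "degree (vf_bracket \<rho>' \<rho>) \<le> 2" "degree (vf_bracket \<mu>' \<mu>) \<le> 2" using deg degree_vf_bracket by blast+
  fix l :: "'a vec" assume l: "l \<in> carrier_vec ?n"
  let ?D = "transpose_mat D" and ?E = "transpose_mat E"
  have cl: "?D *\<^sub>v l \<in> carrier_vec ?n" "?E *\<^sub>v l \<in> carrier_vec ?n"
    "?E *\<^sub>v (?D *\<^sub>v l) \<in> carrier_vec ?n" "?D *\<^sub>v (?E *\<^sub>v l) \<in> carrier_vec ?n" using c l by simp_all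
  have T: "transpose_mat (bracket D E) *\<^sub>v l = ?E *\<^sub>v (?D *\<^sub>v l) - ?D *\<^sub>v (?E *\<^sub>v l)"
  proof -
    have "transpose_mat (bracket D E) = ?E * ?D - ?D * ?E"
      unfolding bracket_def using c transpose_minus[of "D * E" ?n ?n "E * D"] transpose_mult[OF c] transpose_mult[OF c(2,1)]
      by simp
    then show ?thesis using c l minus_mult_distrib_mat_vec[of "?E * ?D" ?n ?n "?D * ?E" l]
      assoc_mult_mat_vec[of ?E ?n ?n ?D ?n l] assoc_mult_mat_vec[of ?D ?n ?n ?E ?n l] by simp
  qed
  obtain p q r where \<rho>: "\<rho> = [:p, q, r:]" using quadratic_poly_cases[OF deg(1)] .
  obtain p' q' r' where \<rho>': "\<rho>' = [:p', q', r':]" using quadratic_poly_cases[OF deg(3)] .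
  let ?f = "lower_form m l" and ?g = "upper_form m l"
  have comm: "coeff (lie_deriv m (vf_bracket \<mu>' \<mu>) f) k =
      coeff (lie_deriv m \<mu>' (lie_deriv m \<mu> f)) k - coeff (lie_deriv m \<mu> (lie_deriv m \<mu>' f)) k" for f k
    by (simp flip: lie_deriv_commutator)
  have cf: "coeff [:a, b, d:] 0 = a" "coeff [:a, b, d:] 1 = b" "coeff [:a, b, d:] 2 = d" for a b d :: 'a
    by (simp_all add: numeral_2_eq_2)
  show "lower_form m (transpose_mat (bracket D E) *\<^sub>v l) = smult (0 - coeff (vf_bracket \<rho>' \<rho>) 1 / 2) ?f +
        smult (coeff (vf_bracket \<rho>' \<rho>) 0) ?g + lie_deriv m (vf_bracket \<mu>' \<mu>) ?f"
    unfolding T form_polys_diff[OF cl(3,4)] acts_byD[OF E cl(1)] acts_byD[OF D cl(2)] acts_byD[OF D l] acts_byD[OF E l]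
      \<rho> \<rho>' vf_bracket_quadratic cf lie_deriv_add lie_deriv_diff lie_deriv_smult
    by (rule poly_eqI) (simp add: comm field_simps)
  show "upper_form m (transpose_mat (bracket D E) *\<^sub>v l) = smult (0 + coeff (vf_bracket \<rho>' \<rho>) 1 / 2) ?g -
        smult (coeff (vf_bracket \<rho>' \<rho>) 2) ?f + lie_deriv m (vf_bracket \<mu>' \<mu>) ?g"
    unfolding T form_polys_diff[OF cl(3,4)] acts_byD[OF E cl(1)] acts_byD[OF D cl(2)] acts_byD[OF D l] acts_byD[OF E l]
      \<rho> \<rho>' vf_bracket_quadratic cf lie_deriv_add lie_deriv_diff lie_deriv_smult
    by (rule poly_eqI) (simp add: comm field_simps)
qed

text \<open>The action on the forms \<open>1\<close>, \<open>t\<close> and \<open>s\<close> determines all the data; for \<open>m = 0\<close> the function \<open>s\<close>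
  would not be a form, and \<open>\<mu>\<close> would be lost.\<close>

lemma acts_by_unique:
  fixes D :: "'a::field_char_0 mat"
  assumes m: "m \<ge> 1" and D: "acts_by m D \<kappa> \<rho> \<mu>" and D': "acts_by m D \<kappa>' \<rho>' \<mu>'"
  shows "\<kappa> = \<kappa>'" "\<rho> = \<rho>'" "\<mu> = \<mu>'"
proof -
  have deg: "degree \<rho> \<le> 2" "degree \<rho>' \<le> 2" using D D' unfolding acts_by_def by blast+
  obtain p q r where \<rho>: "\<rho> = [:p, q, r:]" using quadratic_poly_cases[OF deg(1)] .
  obtain p' q' r' where \<rho>': "\<rho>' = [:p', q', r':]" using quadratic_poly_cases[OF deg(2)] .
  have cf: "coeff [:a, b, d:] 0 = a" "coeff [:a, b, d:] 1 = b" "coeff [:a, b, d:] 2 = d" for a b d :: 'a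
    by (simp_all add: numeral_2_eq_2)
  have eq: "smult (\<kappa> - q / 2) f + smult p g + lie_deriv m \<mu> f = smult (\<kappa>' - q' / 2) f + smult p' g + lie_deriv m \<mu>' f"
    "smult (\<kappa> + q / 2) g - smult r f + lie_deriv m \<mu> g = smult (\<kappa>' + q' / 2) g - smult r' f + lie_deriv m \<mu>' g"
    if fg: "degree f \<le> m" "degree g \<le> m" for f g
  proof -
    obtain l where l: "l \<in> carrier_vec (2 * m + 2)" "lower_form m l = f" "upper_form m l = g"
      using form_polys_exist[OF fg] .
    show "smult (\<kappa> - q / 2) f + smult p g + lie_deriv m \<mu> f = smult (\<kappa>' - q' / 2) f + smult p' g + lie_deriv m \<mu>' f"
      "smult (\<kappa> + q / 2) g - smult r f + lie_deriv m \<mu> g = smult (\<kappa>' + q' / 2) g - smult r' f + lie_deriv m \<mu>' g"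
      using acts_byD[OF D l(1)] acts_byD[OF D' l(1)] unfolding l \<rho> \<rho>' cf by simp_all
  qed
  have p: "p = p'" using eq(1)[of 0 1] by simp
  have r: "r = r'" using eq(2)[of 1 0] by simp
  have A: "smult (\<kappa> - q / 2) 1 + lie_deriv m \<mu> 1 = smult (\<kappa>' - q' / 2) 1 + lie_deriv m \<mu>' 1"
    using eq(1)[of 1 0] by simp
  have B: "smult (\<kappa> + q / 2) 1 + lie_deriv m \<mu> 1 = smult (\<kappa>' + q' / 2) 1 + lie_deriv m \<mu>' 1"
    using eq(2)[of 0 1] by simp
  define c c' where "c = coeff (lie_deriv m \<mu> 1) 0" and "c' = coeff (lie_deriv m \<mu>' 1) 0"
  have A0: "\<kappa> - q / 2 + c = \<kappa>' - q' / 2 + c'" and B0: "\<kappa> + q / 2 + c = \<kappa>' + q' / 2 + c'"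
    using arg_cong[OF A, of "\<lambda>p. coeff p 0"] arg_cong[OF B, of "\<lambda>p. coeff p 0"] by (simp_all add: c_def c'_def)
  have "q = (\<kappa> + q / 2 + c) - (\<kappa> - q / 2 + c)" by simp
  also have "\<dots> = q'" unfolding A0 B0 by simp
  finally have q: "q = q'" .
  define X :: "'a poly" where "X = [:0, 1:]"
  have lX: "lie_deriv m \<nu> X = lie_deriv m \<nu> 1 * X + \<nu>" for \<nu>
    by (simp add: lie_deriv_def X_def pderiv_pCons)
  have "smult (\<kappa> - q / 2) X + lie_deriv m \<mu> X = smult (\<kappa>' - q' / 2) X + lie_deriv m \<mu>' X"
    using eq(1)[of X 0] m by (simp add: X_def)
  then have "(smult (\<kappa> - q / 2) 1 + lie_deriv m \<mu> 1) * X + \<mu> = (smult (\<kappa>' - q' / 2) 1 + lie_deriv m \<mu>' 1) * X + \<mu>'"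
    unfolding lX by (simp add: distrib_right add.assoc)
  then show \<mu>: "\<mu> = \<mu>'" unfolding A by simp
  show "\<kappa> = \<kappa>'" using A unfolding \<mu> q by simp
  show "\<rho> = \<rho>'" by (simp add: \<rho> \<rho>' p q r)
qed

lemma acts_by_scalar:
  assumes "acts_by m D \<kappa> 0 0" shows "D = \<kappa> \<cdot>\<^sub>m 1\<^sub>m (2 * m + 2)"
proof -
  let ?n = "2 * m + 2"
  have D: "D \<in> carrier_mat ?n ?n" using assms unfolding acts_by_def by blast
  have T: "transpose_mat D *\<^sub>v l = \<kappa> \<cdot>\<^sub>v l" if l: "l \<in> carrier_vec ?n" for l
    by (rule form_polys_eqD[of _ m]) (use l D acts_byD[OF assms l] form_polys_smult[OF l] in simp_all)
  show ?thesis
  proof (rule eq_matI)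
    fix i j assume "i < dim_row (\<kappa> \<cdot>\<^sub>m 1\<^sub>m ?n)" "j < dim_col (\<kappa> \<cdot>\<^sub>m 1\<^sub>m ?n)"
    then have ij: "i < ?n" "j < ?n" by simp_all
    have "D $$ (i, j) = (transpose_mat D *\<^sub>v unit_vec ?n i) $ j"
      using D ij by simp
    also have "\<dots> = \<kappa> * unit_vec ?n i $ j" using T[of "unit_vec ?n i"] ij by simp
    finally show "D $$ (i, j) = (\<kappa> \<cdot>\<^sub>m 1\<^sub>m ?n) $$ (i, j)" using ij by (simp add: unit_vec_def)
  qed (use D in simp_all)
qed

section \<open>Representations of \<open>sl\<^sub>2\<close> by vector fields on the line\<close>

text \<open>The relations \<open>[h, x] = 2 x\<close>, \<open>[h, y] = -2 y\<close>, \<open>[x, y] = h\<close>, with the arguments of each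
  bracket exchanged as in the action on forms.\<close>

definition vf_triple :: "'a::field poly \<Rightarrow> 'a poly \<Rightarrow> 'a poly \<Rightarrow> bool" where
  "vf_triple H X Y \<longleftrightarrow> degree H \<le> 2 \<and> degree X \<le> 2 \<and> degree Y \<le> 2 \<and>
    vf_bracket X H = smult 2 X \<and> vf_bracket Y H = smult (- 2) Y \<and> vf_bracket Y X = H"

lemma vf_triple_zero:
  fixes H :: "'a::field_char_0 poly"
  assumes "vf_triple H X Y" "X = 0" shows "H = 0" "Y = 0"
proof -
  show "H = 0" using assms by (auto simp: vf_triple_def vf_bracket_def)
  then have "smult (- 2) Y = 0" using assms unfolding vf_triple_def by (auto simp: vf_bracket_def)
  then show "Y = 0" by simp
qed

text \<open>On quadratic vector fields \<open>ad H\<close> has the eigenvalues \<open>0\<close> and the two square roots of the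
  discriminant of \<open>H\<close>; the relation for \<open>X\<close> makes \<open>2\<close> one of them up to sign.\<close>

lemma vf_triple_disc:
  fixes p q r :: "'a::field_char_0"
  assumes t: "vf_triple [:p, q, r:] X Y" and X: "X \<noteq> 0"
  shows "q * q - 4 * p * r = 4"
proof -
  obtain x0 x1 x2 where x: "X = [:x0, x1, x2:]"
    using quadratic_poly_cases t unfolding vf_triple_def by metis
  have "vf_bracket X [:p, q, r:] = smult 2 X" using t unfolding vf_triple_def by blast
  then have "x0 * q - p * x1 = 2 * x0" "2 * (x0 * r - p * x2) = 2 * x1" "x1 * r - q * x2 = 2 * x2"
    unfolding x vf_bracket_quadratic by simp_all
  note f = this
  have e1: "x0 * (q - 2) = p * x1" using f(1) by (simp add: algebra_simps)
  have e2: "x0 * r - p * x2 = x1" using f(2) unfolding mult_cancel_left by simp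
  have e3: "x2 * (q + 2) = x1 * r" using f(3) by (simp add: algebra_simps)
  have nz: "x0 \<noteq> 0 \<or> x1 \<noteq> 0 \<or> x2 \<noteq> 0" using X x by auto
  have "(q - 2) * x1 = r * (x0 * (q - 2)) - p * x2 * (q - 2)" unfolding e2[symmetric] by (simp add: algebra_simps)
  also have "\<dots> = p * (x2 * (q + 2)) - p * x2 * (q - 2)" unfolding e1 e3 by (simp add: algebra_simps)
  finally have k1: "(q - 2) * x1 = 4 * p * x2" by (simp add: algebra_simps)
  have "(q + 2) * x1 = (q + 2) * x0 * r - p * (x2 * (q + 2))" unfolding e2[symmetric] by (simp add: algebra_simps)
  also have "\<dots> = (q + 2) * x0 * r - r * (x0 * (q - 2))" unfolding e1 e3 by (simp add: algebra_simps)
  finally have k2: "(q + 2) * x1 = 4 * r * x0" by (simp add: algebra_simps)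
  have "(q * q - 4 * p * r - 4) * x1 = (q + 2) * ((q - 2) * x1) - 4 * p * r * x1" by (simp add: algebra_simps)
  also have "\<dots> = 4 * p * (x2 * (q + 2)) - 4 * p * r * x1" unfolding k1 by (simp add: algebra_simps)
  also have "\<dots> = 0" unfolding e3 by (simp add: algebra_simps)
  finally have z1: "(q * q - 4 * p * r - 4) * x1 = 0" .
  have "(q * q - 4 * p * r - 4) * x0 = (q + 2) * (x0 * (q - 2)) - p * (4 * r * x0)" by (simp add: algebra_simps)
  also have "\<dots> = 0" unfolding e1 k2[symmetric] by (simp add: algebra_simps)
  finally have z0: "(q * q - 4 * p * r - 4) * x0 = 0" .
  have "(q * q - 4 * p * r - 4) * x2 = (q - 2) * (x2 * (q + 2)) - r * (4 * p * x2)" by (simp add: algebra_simps)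
  also have "\<dots> = 0" unfolding e3 k1[symmetric] by (simp add: algebra_simps)
  finally have z2: "(q * q - 4 * p * r - 4) * x2 = 0" .
  note z0 z1 z2
  with nz show ?thesis by auto
qed

lemma lie_deriv_linear:
  fixes p :: "'a::field_char_0"
  shows "lie_deriv 1 [:p, q, r:] [:a0, a1:] = [:p * a1 - q * a0 / 2, q * a1 / 2 - r * a0:]"
  by (simp add: lie_deriv_def pderiv_pCons algebra_simps)

text \<open>A vector field \<open>p + q s + r s\<^sup>2\<close> acts on linear polynomials by a matrix whose square is a quarter
  of the discriminant. The hypotheses say that \<open>(x, y)\<close> is an eigenvector with eigenvalue \<open>- M\<close>,
  so \<open>M\<^sup>2 = 1\<close> unless it is zero.\<close>

lemma disc_eigenvalue:
  fixes x y :: "'a::field_char_0"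
  assumes disc: "q * q - 4 * p * r = 4"
    and e: "2 * p * y = (q - 2 * M) * x" "2 * r * x = (q + 2 * M) * y"
  shows "(M * M - 1) * x = 0" "(M * M - 1) * y = 0"
proof -
  have "4 * p * r * x = 2 * p * (2 * r * x)" by simp
  also have "\<dots> = (q + 2 * M) * (2 * p * y)" unfolding e(2) by (simp add: mult_ac)
  also have "\<dots> = (q * q - 4 * (M * M)) * x" unfolding e(1) by (simp add: algebra_simps)
  finally have "(q * q - 4 * p * r - 4 * (M * M)) * x = 0" by (simp add: algebra_simps)
  then show "(M * M - 1) * x = 0" unfolding disc by auto
  have "4 * p * r * y = 2 * r * (2 * p * y)" by simp
  also have "\<dots> = (q - 2 * M) * (2 * r * x)" unfolding e(1) by (simp add: mult_ac)
  also have "\<dots> = (q * q - 4 * (M * M)) * y" unfolding e(2) by (simp add: algebra_simps)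
  finally have "(q * q - 4 * p * r - 4 * (M * M)) * y = 0" by (simp add: algebra_simps)
  then show "(M * M - 1) * y = 0" unfolding disc by auto
qed

text \<open>By the discriminant, \<open>H\<close> acts on linear polynomials with square one and trace zero, so \<open>- 1\<close> is
  an eigenvalue; let \<open>a\<close> be an eigenvector. If \<open>Y a\<close> were a multiple of \<open>a\<close>, the relation for
  \<open>Y\<close> would give \<open>Y a = 0\<close>. The relation for \<open>X\<close> makes \<open>X a\<close> an eigenvector with eigenvalue
  \<open>- 3\<close>, so \<open>X a = 0\<close>. Then \<open>- a = H a\<close> would be zero as a commutator.\<close>

lemma vf_triple_eigenform:
  fixes H :: "'a::field_char_0 poly"
  assumes t: "vf_triple H X Y" and X: "X \<noteq> 0"
  obtains a0 a1 b0 b1 where "lie_deriv 1 H [:a0, a1:] = - [:a0, a1:]"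
    "lie_deriv 1 Y [:a0, a1:] = [:b0, b1:]" "a0 * b1 - a1 * b0 \<noteq> 0"
proof -
  have deg: "degree H \<le> 2" "degree X \<le> 2" "degree Y \<le> 2"
    and br: "vf_bracket X H = smult 2 X" "vf_bracket Y H = smult (- 2) Y" "vf_bracket Y X = H"
    using t unfolding vf_triple_def by blast+
  obtain p q r where H: "H = [:p, q, r:]" using quadratic_poly_cases[OF deg(1)] .
  obtain x0 x1 x2 where Xx: "X = [:x0, x1, x2:]" using quadratic_poly_cases[OF deg(2)] .
  obtain y0 y1 y2 where Y: "Y = [:y0, y1, y2:]" using quadratic_poly_cases[OF deg(3)] .
  have disc: "q * q - 4 * p * r = 4" using vf_triple_disc t X unfolding H by blast
  obtain a0 a1 where a: "(a0, a1) \<noteq> (0, 0)" "p * a1 - q * a0 / 2 = - a0" "q * a1 / 2 - r * a0 = - a1"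
  proof (cases "p = 0 \<and> q = 2")
    case True
    then show ?thesis using disc that[of 2 r] by (simp add: field_simps)
  next
    case False
    have "q * (q / 2 - 1) / 2 - r * p = - (q / 2 - 1)"
      using disc by (simp add: field_simps)
    then show ?thesis using False that[of p "q / 2 - 1"] by (auto simp: field_simps)
  qed
  let ?a = "[:a0, a1:]"
  have Ha: "lie_deriv 1 H ?a = - ?a" using a unfolding H lie_deriv_linear by simp
  define b0 b1 where "b0 = y0 * a1 - y1 * a0 / 2" and "b1 = y1 * a1 / 2 - y2 * a0"
  have Yb: "lie_deriv 1 Y ?a = [:b0, b1:]" unfolding Y lie_deriv_linear b0_def b1_def ..
  have "a0 * b1 - a1 * b0 \<noteq> 0"
  proof
    assume w: "a0 * b1 - a1 * b0 = 0"
    obtain c where c: "[:b0, b1:] = smult c ?a"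
    proof (cases "a0 = 0")
      case True
      then have "b0 = 0" "a1 \<noteq> 0" using w a(1) by auto
      then show ?thesis using True that[of "b1 / a1"] by simp
    next
      case False
      then have "b1 = b0 / a0 * a1" using w by (simp add: field_simps)
      then show ?thesis using False that[of "b0 / a0"] by simp
    qed
    have sm: "lie_deriv 1 (smult k \<mu>) f = smult k (lie_deriv 1 \<mu> f)" for k \<mu> and f :: "'a poly"
      by (simp add: lie_deriv_def pderiv_smult smult_diff_right mult.commute)
    have "lie_deriv 1 Y (- ?a) - lie_deriv 1 H (smult c ?a) = smult (- 2) (smult c ?a)"
      using lie_deriv_commutator[of 1 Y H ?a] unfolding br sm Ha Yb c .
    then have "smult c ?a = 0"
      unfolding lie_deriv_minus lie_deriv_smult Yb Ha c by simp
    then have Ya: "lie_deriv 1 Y ?a = 0" using Yb c by simp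
    define d0 d1 where "d0 = x0 * a1 - x1 * a0 / 2" and "d1 = x1 * a1 / 2 - x2 * a0"
    let ?d = "[:d0, d1:]"
    have Xd: "lie_deriv 1 X ?a = ?d" unfolding Xx lie_deriv_linear d0_def d1_def ..
    have "lie_deriv 1 X (- ?a) - lie_deriv 1 H ?d = smult 2 ?d"
      using lie_deriv_commutator[of 1 X H ?a] unfolding br sm Ha Xd .
    then have "lie_deriv 1 H ?d = - ?d - smult 2 ?d"
      unfolding lie_deriv_minus Xd by (metis diff_diff_eq2 add_diff_cancel_left')
    then have Hd: "lie_deriv 1 H ?d = smult (- 3) ?d" by simp
    then have e: "p * d1 - q * d0 / 2 = - 3 * d0" "q * d1 / 2 - r * d0 = - 3 * d1"
      unfolding H lie_deriv_linear by simp_all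
    then have "2 * p * d1 = (q - 2 * 3) * d0" "2 * r * d0 = (q + 2 * 3) * d1"
      by (simp_all add: field_simps)
    from disc_eigenvalue[OF disc this] have "d0 = 0" "d1 = 0" by simp_all
    then have Xa: "lie_deriv 1 X ?a = 0" using Xd by simp
    have "- ?a = 0"
      using lie_deriv_commutator[of 1 Y X ?a] unfolding br Xa Ya Ha by simp
    then show False using a(1) by simp
  qed
  then show ?thesis using that Ha Yb by blast
qed

text \<open>Commuting vector fields on the line are proportional, and a multiple of \<open>X\<close> that commutes with
  \<open>H\<close> is zero.\<close>

lemma vf_triple_commutant:
  fixes H :: "'a::field_char_0 poly"
  assumes t: "vf_triple H X Y" and X: "X \<noteq> 0" and Z: "degree Z \<le> 2"
    and ZH: "vf_bracket Z H = 0" and ZX: "vf_bracket Z X = 0"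
  shows "Z = 0"
proof -
  have deg: "degree X \<le> 2" and br: "vf_bracket X H = smult 2 X"
    using t unfolding vf_triple_def by blast+
  obtain x0 x1 x2 where Xx: "X = [:x0, x1, x2:]" using quadratic_poly_cases[OF deg] .
  obtain z0 z1 z2 where Zz: "Z = [:z0, z1, z2:]" using quadratic_poly_cases[OF Z] .
  have e: "z0 * x1 = x0 * z1" "z0 * x2 = x0 * z2" "z1 * x2 = x1 * z2"
    using ZX unfolding Xx Zz vf_bracket_quadratic by simp_all
  obtain c where c: "Z = smult c X"
  proof -
    consider "x0 \<noteq> 0" | "x1 \<noteq> 0" | "x2 \<noteq> 0" using X Xx by auto
    then show ?thesis
    proof cases
      case 1
      then show ?thesis using that[of "z0 / x0"] e by (simp add: Xx Zz field_simps)
    next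
      case 2
      then show ?thesis using that[of "z1 / x1"] e by (simp add: Xx Zz field_simps)
    next
      case 3
      then show ?thesis using that[of "z2 / x2"] e by (simp add: Xx Zz field_simps)
    qed
  qed
  have "vf_bracket Z H = smult c (vf_bracket X H)"
    by (simp add: c vf_bracket_def pderiv_smult smult_diff_right mult.commute)
  then have "smult (c * 2) X = 0" using ZH br by simp
  then show ?thesis using X c by simp
qed

text \<open>Eliminating \<open>H'\<close> from the two eigenvalue equations leaves \<open>a f' = m f a'\<close>, the differential
  equation of the multiples of \<open>a\<^sup>m\<close>. Already this equation implies that every \<open>Y\<close> acts on \<open>f\<close>
  as it would act on \<open>a\<^sup>m\<close>, so \<open>f\<close> need not be computed.\<close>

lemma lie_deriv_eigen_ratio:
  fixes f a H Y :: "'a::field_char_0 poly"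
  assumes f: "lie_deriv m H f = - smult (of_nat m) f" and a: "lie_deriv 1 H a = - a" and H: "H \<noteq> 0"
  shows "lie_deriv m Y f * a = smult (of_nat m) (f * lie_deriv 1 Y a)"
proof -
  define K where "K = [:of_nat m :: 'a:]"
  define h where "h = [:1 / 2 :: 'a:]"
  have half: "smult (of_nat k / 2) p = of_nat k * h * p" for k and p :: "'a poly"
    by (simp add: h_def of_nat_poly)
  have K: "smult (of_nat m) p = K * p" and hm: "smult (of_nat m / 2) p = K * h * p" and h1: "smult (of_nat 1 / 2) p = h * p" for p
    by (simp_all add: K_def h_def)
  have f': "H * pderiv f - K * h * (pderiv H * f) = - (K * f)"
    using f unfolding lie_deriv_def K hm .
  have a': "H * pderiv a - h * (pderiv H * a) = - a"
    using a unfolding lie_deriv_def h1 .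
  have Hf: "H * pderiv f = K * h * (pderiv H * f) - K * f" using f' by (simp add: algebra_simps)
  have Ha: "H * pderiv a = h * (pderiv H * a) - a" using a' by (simp add: algebra_simps)
  have "H * (pderiv f * a - K * f * pderiv a) = (H * pderiv f) * a - K * f * (H * pderiv a)"
    by (simp add: algebra_simps)
  also have "\<dots> = 0" unfolding Hf Ha by (simp add: algebra_simps)
  finally have *: "pderiv f * a = K * f * pderiv a" using H by simp
  have "(Y * pderiv f - K * h * (pderiv Y * f)) * a = Y * (pderiv f * a) - K * h * (pderiv Y * f) * a"
    by (simp add: algebra_simps)
  also have "\<dots> = K * (f * (Y * pderiv a - h * (pderiv Y * a)))"
    unfolding * by (simp add: algebra_simps)
  finally show ?thesis unfolding lie_deriv_def K hm h1 .
qed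

text \<open>A vector field in \<open>t\<close> acts on \<open>f + t g\<close> coefficient by coefficient in \<open>s\<close>, as on linear polynomials
  in \<open>t\<close>. So with discriminant \<open>4\<close> its eigenvalues are \<open>1\<close> and \<open>- 1\<close>.\<close>

lemma scalar_quadratic_eigen:
  fixes f g :: "'a::field_char_0 poly"
  assumes disc: "q * q - 4 * p * r = 4" and fg: "(f, g) \<noteq> (0, 0)"
    and f: "smult p g - smult (q / 2) f = - smult (of_nat m) f"
    and g: "smult (q / 2) g - smult r f = - smult (of_nat m) g"
  shows "m = 1"
proof -
  have "(of_nat m * of_nat m - 1) * coeff f k = 0 \<and> (of_nat m * of_nat m - 1) * coeff g k = 0" for k
  proof -
    define x y M where "x = coeff f k" and "y = coeff g k" and "M = (of_nat m :: 'a)"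
    have "coeff (smult p g - smult (q / 2) f) k = coeff (- smult (of_nat m) f) k"
      "coeff (smult (q / 2) g - smult r f) k = coeff (- smult (of_nat m) g) k"
      unfolding f g by simp_all
    then have e: "2 * p * y = (q - 2 * M) * x" "2 * r * x = (q + 2 * M) * y"
      unfolding x_def[symmetric] y_def[symmetric] M_def[symmetric]
      by (simp_all add: x_def[symmetric] y_def[symmetric] M_def[symmetric] field_simps)
    then show ?thesis
      using disc_eigenvalue[OF disc e] unfolding x_def[symmetric] y_def[symmetric] M_def[symmetric] by simp
  qed
  then have "of_nat m * of_nat m - 1 = (0 :: 'a)" using fg by (auto simp: poly_eq_iff)
  then have "(of_nat (m * m) :: 'a) = of_nat 1" by simp
  then have "m * m = 1" by (simp only: of_nat_eq_iff)
  then show ?thesis by simp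
qed

section \<open>Rational functions whose fibers form a pencil of lines\<close>

lemma homogeneous_linear_form:
  assumes "n > 0"
  shows "homogeneous_poly n 1 (\<lambda>x. \<Sum>i<n. c i * x $ i)"
proof -
  have "homogeneous_poly n 1 (\<lambda>x. \<Sum>i<k. c i * x $ i)" if "k \<le> n" for k
    using that
  proof (induction k)
    case 0
    have "homogeneous_poly n (0 + 1) (\<lambda>x. 0 * x $ 0)"
      using assms by (intro homogeneous_poly.intros)
    then show ?case by simp
  next
    case (Suc k)
    have "homogeneous_poly n (0 + 1) (\<lambda>x. c k * x $ k)"
      using Suc(2) by (intro homogeneous_poly.intros) simp
    then show ?case using homogeneous_poly.add[of n 1 "\<lambda>x. \<Sum>i<k. c i * x $ i" "\<lambda>x. c k * x $ k"] Suc
      by (simp add: lessThan_Suc add.commute)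
  qed
  then show ?thesis by blast
qed

lemma polynomial_on_lines_scalar_prod:
  assumes "l \<in> carrier_vec (2 * m + 2)"
  shows "polynomial_on_lines (\<lambda>T0 T1 S0 S1. l \<bullet> scroll_point m T0 T1 S0 S1)"
proof -
  have "l \<bullet> scroll_point m T0 T1 S0 S1 = (\<Sum>i<2 * m + 2. l $ i * scroll_point m T0 T1 S0 S1 $ i)" for T0 T1 S0 S1
    unfolding scalar_prod_def dim_scroll_point atLeast0LessThan ..
  then show ?thesis
    using polynomial_on_lines_homogeneous[OF homogeneous_linear_form[of "2 * m + 2" "\<lambda>i. l $ i"] refl] by simp
qed

lemma polynomial_on_lines_homogeneous_mat:
  assumes "homogeneous_poly n d f" "n = 2 * m + 2" and A: "A \<in> carrier_mat (2 * m + 2) (2 * m + 2)"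
  shows "polynomial_on_lines (\<lambda>T0 T1 S0 S1. f (A *\<^sub>v scroll_point m T0 T1 S0 S1))"
  using assms(1,2)
proof induction
  case (coord i)
  have "(A *\<^sub>v scroll_point m T0 T1 S0 S1) $ i = row A i \<bullet> scroll_point m T0 T1 S0 S1" for T0 T1 S0 S1
    using coord A by simp
  moreover have "row A i \<in> carrier_vec (2 * m + 2)"
    using row_carrier[of A i] unfolding carrier_matD(2)[OF A] .
  ultimately show ?case using polynomial_on_lines_scalar_prod[of "row A i" m] by (simp only:)
qed (auto intro: polynomial_on_lines_intros)

lemma P1_point_smult: "c \<noteq> 0 \<Longrightarrow> P1_point (c * a) (c * b) = P1_point a b"
proof -
  assume c: "c \<noteq> 0"
  have "vec_of_list [c * a, c * b] = c \<cdot>\<^sub>v vec_of_list [a, b]"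
    by (rule eq_vecI) (auto simp: less_Suc_eq)
  then show ?thesis unfolding P1_point_def using proj_point_smult[OF c] by simp
qed

lemma P1_point_eqI:
  assumes "(a, b) \<noteq> (0, 0)" "(a', b') \<noteq> (0, 0)" "a * b' = b * a'"
  shows "P1_point a b = P1_point a' b'"
proof (cases "a' = 0")
  case True
  then have "b' \<noteq> 0" "a = 0" using assms by auto
  moreover from this have "b \<noteq> 0" using assms by auto
  ultimately show ?thesis using P1_point_smult[of "b / b'" a' b'] True by simp
next
  case False
  then have "b = (a / a') * b'" using assms by (simp add: field_simps)
  moreover from this have "a \<noteq> 0" using assms(1) by auto
  ultimately show ?thesis using P1_point_smult[of "a / a'" a' b'] False by simp
qed

lemma P1_point_eqD:
  assumes "P1_point a b = P1_point a' b'"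
  shows "a * b' = b * a'"
proof -
  have "vec_of_list [a, b] \<in> proj_point (vec_of_list [a', b'])"
    using assms proj_point_self unfolding P1_point_def by blast
  then obtain c where c: "vec_of_list [a, b] = c \<cdot>\<^sub>v vec_of_list [a', b']" by (auto simp: proj_point_def)
  have "a = c * a'" using arg_cong[OF c, of "\<lambda>v. v $ 0"] by simp
  moreover have "b = c * b'" using arg_cong[OF c, of "\<lambda>v. v $ 1"] by simp
  ultimately show ?thesis by simp
qed

lemma proj_space_1: "proj_space 1 = proj_point ` (carrier_vec 2 - {0\<^sub>v 2})"
  unfolding proj_space_def one_add_one ..

lemma P1_point_in_proj_space:
  assumes "(a, b) \<noteq> (0, 0)" shows "P1_point a b \<in> proj_space 1"
proof -
  have "vec_of_list [a, b] \<noteq> 0\<^sub>v 2"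
  proof
    assume z: "vec_of_list [a, b] = 0\<^sub>v 2"
    have "a = 0" using arg_cong[OF z, of "\<lambda>v. v $ 0"] by simp
    moreover have "b = 0" using arg_cong[OF z, of "\<lambda>v. v $ 1"] by simp
    ultimately show False using assms by simp
  qed
  moreover have "vec_of_list [a, b] \<in> carrier_vec 2" by (rule carrier_vecI) simp
  ultimately show ?thesis unfolding P1_point_def proj_space_1 by blast
qed

lemma proj_space_1_cases:
  assumes "q \<in> proj_space 1" obtains a b where "(a, b) \<noteq> (0, 0)" "q = P1_point a b"
proof -
  obtain u where u: "u \<in> carrier_vec 2" "u \<noteq> 0\<^sub>v 2" "q = proj_point u"
    using assms unfolding proj_space_1 by blast
  have e: "u = vec_of_list [u $ 0, u $ 1]"
    by (rule eq_vecI) (use u(1) in \<open>auto simp: less_Suc_eq\<close>)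
  show ?thesis
  proof (rule that)
    show "q = P1_point (u $ 0) (u $ 1)" unfolding P1_point_def using u(3) e by simp
    show "(u $ 0, u $ 1) \<noteq> (0, 0)"
    proof
      assume "(u $ 0, u $ 1) = (0, 0)"
      then have "u = 0\<^sub>v 2" by (intro eq_vecI) (use u(1) in \<open>auto simp: less_Suc_eq numeral_2_eq_2\<close>)
      then show False using u(2) by simp
    qed
  qed
qed

lemma smult_scroll_point: "c \<cdot>\<^sub>v scroll_point m T0 T1 S0 S1 = scroll_point m (c * T0) (c * T1) S0 S1"
  by (rule eq_vecI) (auto simp: scroll_point_def)

lemma scroll_point_smult_S:
  "scroll_point m T0 T1 (c * S0) (c * S1) = scroll_point m (c ^ m * T0) (c ^ m * T1) S0 S1"
proof -
  have "(c * S0) ^ (m - j) * (c * S1) ^ j = c ^ m * (S0 ^ (m - j) * S1 ^ j)" if "j \<le> m" for j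
  proof -
    have "c ^ m = c ^ (m - j) * c ^ j" using that by (simp flip: power_add)
    then show ?thesis by (simp add: power_mult_distrib)
  qed
  note p = this
  show ?thesis
  proof (rule eq_vecI)
    fix i assume "i < dim_vec (scroll_point m (c ^ m * T0) (c ^ m * T1) S0 S1)"
    then have "i < 2 * m + 2" by simp
    then show "scroll_point m T0 T1 (c * S0) (c * S1) $ i = scroll_point m (c ^ m * T0) (c ^ m * T1) S0 S1 $ i"
      by (cases rule: block_index_cases)
        (simp_all only: scroll_point_index_lower scroll_point_index_upper p mult.left_commute mult.assoc)
  qed simp
qed

lemma scroll_line_eq:
  "scroll_line m S0 S1 = {proj_point (scroll_point m T0 T1 S0 S1) | T0 T1. (T0, T1) \<noteq> (0, 0)}"
  by (simp add: scroll_line_def scroll_point_def)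

lemma scroll_point_eq_0:
  assumes "m \<ge> 1" "T0 = 0 \<and> T1 = 0 \<or> S0 = 0 \<and> S1 = 0"
  shows "scroll_point m T0 T1 S0 S1 = 0\<^sub>v (2 * m + 2)"
  by (rule eq_vecI) (use assms in \<open>auto simp: scroll_point_def\<close>)

text \<open>The local trivialization that makes functions of \<open>(S0 : S1)\<close> regular. Some monomial \<open>z\<close> of
  degree one in \<open>T\<close> and \<open>m - 1\<close> in \<open>S\<close> is nonzero at the given parameters, and \<open>z S0\<close>,
  \<open>z S1\<close> are two consecutive coordinates. A linear polynomial in \<open>S\<close> thus becomes, after
  multiplication by \<open>z\<close>, a linear form on the ambient space.\<close>

lemma scroll_point_column:
  fixes T0 T1 S0 S1 :: "'a::field"
  assumes m: "m \<ge> 1" and T: "(T0, T1) \<noteq> (0, 0)" and S: "(S0, S1) \<noteq> (0, 0)"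
  obtains k z where "column_start m k"
    "\<forall>t0 t1 s0 s1. scroll_point m t0 t1 s0 s1 $ k = z t0 t1 s0 s1 * s0"
    "\<forall>t0 t1 s0 s1. scroll_point m t0 t1 s0 s1 $ Suc k = z t0 t1 s0 s1 * s1"
    "z T0 T1 S0 S1 \<noteq> 0"
proof -
  obtain j where j: "j \<le> m - 1" "S0 ^ (m - 1 - j) * S1 ^ j \<noteq> 0"
    using power_mult_power_nonzero[OF S] by blast
  have p: "s0 ^ (m - j) * s1 ^ j = (s0 ^ (m - 1 - j) * s1 ^ j) * s0"
    "s0 ^ (m - Suc j) * s1 ^ Suc j = (s0 ^ (m - 1 - j) * s1 ^ j) * s1" for s0 s1 :: 'a
  proof -
    have "m - j = Suc (m - 1 - j)" using j(1) m by simp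
    then show "s0 ^ (m - j) * s1 ^ j = (s0 ^ (m - 1 - j) * s1 ^ j) * s0" by simp
  qed simp
  have jm: "j \<le> m" "Suc j \<le> m" using j(1) m by simp_all
  have lo: "scroll_point m t0 t1 s0 s1 $ j = t0 * (s0 ^ (m - 1 - j) * s1 ^ j) * s0"
    "scroll_point m t0 t1 s0 s1 $ Suc j = t0 * (s0 ^ (m - 1 - j) * s1 ^ j) * s1" for t0 t1 s0 s1 :: 'a
    using scroll_point_index_lower[OF jm(1), of t0 t1 s0 s1] scroll_point_index_lower[OF jm(2), of t0 t1 s0 s1]
    unfolding p mult.assoc .
  have up: "scroll_point m t0 t1 s0 s1 $ Suc (m + j) = t1 * (s0 ^ (m - 1 - j) * s1 ^ j) * s0"
    "scroll_point m t0 t1 s0 s1 $ Suc (Suc (m + j)) = t1 * (s0 ^ (m - 1 - j) * s1 ^ j) * s1" for t0 t1 s0 s1 :: 'a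
    using scroll_point_index_upper[OF jm(1), of t0 t1 s0 s1] scroll_point_index_upper[OF jm(2), of t0 t1 s0 s1]
    unfolding p mult.assoc add_Suc_right .
  have cols: "column_start m j" "column_start m (Suc (m + j))" using jm by (auto simp: column_start_def)
  show ?thesis
  proof (cases "T0 = 0")
    case False
    then have "T0 * (S0 ^ (m - 1 - j) * S1 ^ j) \<noteq> 0" using j(2) by simp
    then show ?thesis using that[of j "\<lambda>t0 t1 s0 s1. t0 * (s0 ^ (m - 1 - j) * s1 ^ j)"] cols(1) lo by blast
  next
    case True
    then have "T1 * (S0 ^ (m - 1 - j) * S1 ^ j) \<noteq> 0" using T j(2) by simp
    then show ?thesis using that[of "Suc (m + j)" "\<lambda>t0 t1 s0 s1. t1 * (s0 ^ (m - 1 - j) * s1 ^ j)"] cols(2) up by blast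
  qed
qed

lemma scroll_point_eq_imp:
  assumes m: "m \<ge> 1" and T: "(T0, T1) \<noteq> (0, 0)" and S: "(S0, S1) \<noteq> (0, 0)"
    and eq: "scroll_point m T0 T1 S0 S1 = scroll_point m T0' T1' S0' S1'"
  shows "S0 * S1' = S1 * S0'"
proof -
  obtain k z where k1: "column_start m k"
    and k2: "\<forall>t0 t1 s0 s1. scroll_point m t0 t1 s0 s1 $ k = z t0 t1 s0 s1 * s0"
    and k3: "\<forall>t0 t1 s0 s1. scroll_point m t0 t1 s0 s1 $ Suc k = z t0 t1 s0 s1 * s1"
    and k4: "z T0 T1 S0 S1 \<noteq> 0" using scroll_point_column[OF m T S] .
  note k = k1 k2[rule_format] k3[rule_format] k4
  have "S1' * (z T0 T1 S0 S1 * S0) = S0' * (z T0 T1 S0 S1 * S1)"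
    using scroll_point_Suc[OF k(1), of S1' T0' T1' S0'] unfolding eq[symmetric] k(2,3) .
  then have "z T0 T1 S0 S1 * (S0 * S1') = z T0 T1 S0 S1 * (S1 * S0')" by (simp add: mult_ac)
  then show ?thesis using k(4) by simp
qed

lemma image_proj_point:
  assumes "A \<in> carrier_mat n k" "x \<in> carrier_vec k"
  shows "(\<lambda>x. A *\<^sub>v x) ` proj_point x = proj_point (A *\<^sub>v x)"
proof -
  have "A *\<^sub>v (c \<cdot>\<^sub>v x) = c \<cdot>\<^sub>v (A *\<^sub>v x)" for c using mult_mat_vec[OF assms] .
  then show ?thesis unfolding proj_point_def by (auto simp: image_iff) metis+
qed

text \<open>On the chart of the scroll the quotient of \<open>w\<close> by \<open>v\<close> is \<open>(b0 + b1 s)/(a0 + a1 s)\<close>, a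
  nonconstant fractional linear function of \<open>s\<close>.\<close>

locale scroll_pencil =
  fixes m :: nat and A Ai :: "'a::field_char_0 mat" and X :: "'a vec set set" and v w :: "'a vec"
    and a0 a1 b0 b1 :: 'a
  assumes m: "m \<ge> 1"
    and A: "A \<in> carrier_mat (2 * m + 2) (2 * m + 2)" and Ai: "Ai \<in> carrier_mat (2 * m + 2) (2 * m + 2)"
    and AiA: "Ai * A = 1\<^sub>m (2 * m + 2)"
    and X: "X = proj_image A (scroll m)"
    and v: "v \<in> carrier_vec (2 * m + 2)" and w: "w \<in> carrier_vec (2 * m + 2)"
    and v0: "transpose_mat A *\<^sub>v v \<noteq> 0\<^sub>v (2 * m + 2)"
    and det: "a0 * b1 - a1 * b0 \<noteq> 0"
    and lower: "lower_form m (transpose_mat A *\<^sub>v v) * [:b0, b1:] = lower_form m (transpose_mat A *\<^sub>v w) * [:a0, a1:]"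
    and upper: "upper_form m (transpose_mat A *\<^sub>v v) * [:b0, b1:] = upper_form m (transpose_mat A *\<^sub>v w) * [:a0, a1:]"
begin

abbreviation "n \<equiv> 2 * m + 2"
definition "pt T0 T1 S0 S1 = A *\<^sub>v scroll_point m T0 T1 S0 S1"
definition "num S0 S1 = b0 * S0 + b1 * S1"
definition "den S0 S1 = a0 * S0 + a1 * S1"

lemma cross: "num S0 S1 * den S0' S1' - den S0 S1 * num S0' S1' = (a0 * b1 - a1 * b0) * (S1 * S0' - S0 * S1')"
  by (simp add: num_def den_def algebra_simps)

lemma num_den_nonzero: assumes "(S0, S1) \<noteq> (0, 0)" shows "(num S0 S1, den S0 S1) \<noteq> (0, 0)"
proof
  assume "(num S0 S1, den S0 S1) = (0, 0)"
  then have "(a0 * b1 - a1 * b0) * (S1 * S0' - S0 * S1') = 0" for S0' S1'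
    using cross[of S0 S1 S0' S1'] by simp
  from this[of 1 0] this[of 0 1] show False using det assms by simp
qed

lemma pt_carrier: "pt T0 T1 S0 S1 \<in> carrier_vec n"
  unfolding pt_def using A by simp

lemma form_pt: "l \<in> carrier_vec n \<Longrightarrow> l \<bullet> pt T0 T1 S0 S1 = (transpose_mat A *\<^sub>v l) \<bullet> scroll_point m T0 T1 S0 S1"
  unfolding pt_def using A transpose_vec_mult_scalar[OF A _ , of "scroll_point m T0 T1 S0 S1" l] by simp

lemma Ai_pt: "Ai *\<^sub>v pt T0 T1 S0 S1 = scroll_point m T0 T1 S0 S1"
  unfolding pt_def using assoc_mult_mat_vec[OF Ai A, of "scroll_point m T0 T1 S0 S1"] AiA by simp

text \<open>Both components of the identity hold on the chart by assumption, and density extends it.\<close>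

lemma form_identity: "(v \<bullet> pt T0 T1 S0 S1) * num S0 S1 = (w \<bullet> pt T0 T1 S0 S1) * den S0 S1"
proof -
  let ?V = "transpose_mat A *\<^sub>v v" and ?W = "transpose_mat A *\<^sub>v w"
  have c: "?V \<in> carrier_vec n" "?W \<in> carrier_vec n" using A v w by simp_all
  have "(?V \<bullet> scroll_point m T0 T1 S0 S1) * num S0 S1 - (?W \<bullet> scroll_point m T0 T1 S0 S1) * den S0 S1 = 0"
  proof (rule polynomial_on_lines_eq_0_of_chart[of "\<lambda>T0 T1 S0 S1.
      (?V \<bullet> scroll_point m T0 T1 S0 S1) * num S0 S1 - (?W \<bullet> scroll_point m T0 T1 S0 S1) * den S0 S1"])
    show "polynomial_on_lines (\<lambda>T0 T1 S0 S1.
      (?V \<bullet> scroll_point m T0 T1 S0 S1) * num S0 S1 - (?W \<bullet> scroll_point m T0 T1 S0 S1) * den S0 S1)"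
      unfolding num_def den_def
      by (intro polynomial_on_lines_intros polynomial_on_lines_scalar_prod c)
    fix T0 T1 S0 S1 :: 'a assume nz: "T0 \<noteq> 0" "S0 \<noteq> 0"
    define s t where "s = S1 / S0" and "t = T1 / T0"
    have nd: "num S0 S1 = S0 * poly [:b0, b1:] s" "den S0 S1 = S0 * poly [:a0, a1:] s"
      using nz by (simp_all add: num_def den_def s_def field_simps)
    have lo: "poly (lower_form m ?V) s * poly [:b0, b1:] s = poly (lower_form m ?W) s * poly [:a0, a1:] s"
      using arg_cong[OF lower, of "\<lambda>p. poly p s"] by (simp only: poly_mult)
    have up: "poly (upper_form m ?V) s * poly [:b0, b1:] s = poly (upper_form m ?W) s * poly [:a0, a1:] s"
      using arg_cong[OF upper, of "\<lambda>p. poly p s"] by (simp only: poly_mult)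
    have "(?V \<bullet> scroll_point m 1 t 1 s) * poly [:b0, b1:] s = (?W \<bullet> scroll_point m 1 t 1 s) * poly [:a0, a1:] s"
      unfolding scalar_prod_scroll_point_affine[OF c(1)] scalar_prod_scroll_point_affine[OF c(2)]
      by (simp only: distrib_right mult.assoc lo up)
    then have e: "(?V \<bullet> scroll_point m 1 t 1 s) * poly [:b0, b1:] s - (?W \<bullet> scroll_point m 1 t 1 s) * poly [:a0, a1:] s = 0"
      by simp
    have sc: "l \<bullet> scroll_point m T0 T1 S0 S1 = T0 * S0 ^ m * (l \<bullet> scroll_point m 1 t 1 s)" if "l \<in> carrier_vec n" for l
      unfolding scroll_point_scale[OF nz] s_def t_def using that by simp
    have "(?V \<bullet> scroll_point m T0 T1 S0 S1) * num S0 S1 - (?W \<bullet> scroll_point m T0 T1 S0 S1) * den S0 S1 =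
      T0 * S0 ^ m * S0 * ((?V \<bullet> scroll_point m 1 t 1 s) * poly [:b0, b1:] s - (?W \<bullet> scroll_point m 1 t 1 s) * poly [:a0, a1:] s)"
      unfolding sc[OF c(1)] sc[OF c(2)] nd by (simp only: right_diff_distrib mult_ac)
    then show "(?V \<bullet> scroll_point m T0 T1 S0 S1) * num S0 S1 - (?W \<bullet> scroll_point m T0 T1 S0 S1) * den S0 S1 = 0"
      unfolding e by simp
  qed
  then show ?thesis using form_pt v w by simp
qed

lemma X_eq: "X = {proj_point (pt T0 T1 S0 S1) | T0 T1 S0 S1. (T0, T1) \<noteq> (0, 0) \<and> (S0, S1) \<noteq> (0, 0)}"
proof -
  have "(\<lambda>x. A *\<^sub>v x) ` proj_point (scroll_point m T0 T1 S0 S1) = proj_point (pt T0 T1 S0 S1)" for T0 T1 S0 S1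
    unfolding pt_def by (rule image_proj_point[OF A]) simp
  then show ?thesis unfolding X proj_image_def scroll_eq by (auto simp: image_iff) metis+
qed

lemma mem_point_cases:
  assumes "p \<in> X" "x \<in> p"
  obtains T0 T1 S0 S1 where "(T0, T1) \<noteq> (0, 0)" "(S0, S1) \<noteq> (0, 0)" "x = pt T0 T1 S0 S1" "p = proj_point x"
proof -
  obtain T0 T1 S0 S1 where T: "(T0, T1) \<noteq> (0, 0)" "(S0, S1) \<noteq> (0, 0)" "p = proj_point (pt T0 T1 S0 S1)"
    using assms(1) unfolding X_eq by blast
  obtain c where c: "c \<noteq> 0" "x = c \<cdot>\<^sub>v pt T0 T1 S0 S1" using assms(2) T(3) unfolding proj_point_def by blast
  have "x = pt (c * T0) (c * T1) S0 S1"
    unfolding c(2) pt_def smult_scroll_point[symmetric] using mult_mat_vec[OF A scroll_point_carrier] by simp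
  moreover have "(c * T0, c * T1) \<noteq> (0, 0)" using c T by auto
  moreover have "p = proj_point x" using proj_point_eqI_mem assms(2) T(3) by blast
  ultimately show ?thesis using that T(2) by blast
qed

lemma v_nonzero_somewhere: obtains T0 T1 S0 S1 where "v \<bullet> pt T0 T1 S0 S1 \<noteq> 0"
proof -
  let ?V = "transpose_mat A *\<^sub>v v"
  have c: "?V \<in> carrier_vec n" using A v by simp
  have "\<exists>s t. ?V \<bullet> scroll_point m 1 t 1 s \<noteq> 0"
  proof (rule ccontr)
    assume "\<not> ?thesis"
    then have "poly (lower_form m ?V) s + t * poly (upper_form m ?V) s + t * t * 0 = 0" for s t
      using scalar_prod_scroll_point_affine[OF c, of t s] by simp
    from quadratic_eq_0[OF this] have "lower_form m ?V = 0" "upper_form m ?V = 0"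
      by (simp_all add: poly_eqI_all)
    moreover have "lower_form m (0\<^sub>v n) = 0" "upper_form m (0\<^sub>v n) = 0"
      by (auto intro!: poly_eqI simp: coeff_lower_form coeff_upper_form)
    ultimately have "?V = 0\<^sub>v n" using form_polys_eqD[OF c, of "0\<^sub>v n"] by simp
    then show False using v0 by simp
  qed
  then show ?thesis using that form_pt[OF v] by metis
qed

lemma pt_eq_0:
  assumes "\<not> ((T0, T1) \<noteq> (0, 0) \<and> (S0, S1) \<noteq> (0, 0))" shows "pt T0 T1 S0 S1 = 0\<^sub>v n"
proof -
  have "scroll_point m T0 T1 S0 S1 = 0\<^sub>v n" using scroll_point_eq_0[OF m] assms by auto
  then show ?thesis unfolding pt_def using A by (auto intro!: eq_vecI)
qed

text \<open>A representative \<open>(F : G)\<close> satisfies \<open>F v = G w\<close> wherever \<open>v \<noteq> 0\<close>, hence \<open>F den = G num\<close> there,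
  and everywhere by density. So its value at any point is \<open>(num : den)\<close>. For the existence of a
  representative at a given point, \<open>z num\<close> and \<open>z den\<close> are linear forms for a suitable monomial
  \<open>z\<close>, and they have no common zero where \<open>z \<noteq> 0\<close>.\<close>

lemma graph_eq:
  "quotient_graph (2 * m + 1) X w v = {(proj_point (pt T0 T1 S0 S1), P1_point (num S0 S1) (den S0 S1)) | T0 T1 S0 S1.
     (T0, T1) \<noteq> (0, 0) \<and> (S0, S1) \<noteq> (0, 0)}" (is "_ = ?R")
proof (intro equalityI subsetI)
  fix y assume "y \<in> quotient_graph (2 * m + 1) X w v"
  then obtain p q d F G x where y: "y = (p, q)" "p \<in> X"
    and F: "homogeneous_poly (2 * m + 1 + 1) d F" and G: "homogeneous_poly (2 * m + 1 + 1) d G"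
    and x: "x \<in> p" "(F x, G x) \<noteq> (0, 0)" "q = P1_point (F x) (G x)"
    and agree: "\<And>p' x. p' \<in> X \<Longrightarrow> x \<in> p' \<Longrightarrow> v \<bullet> x \<noteq> 0 \<Longrightarrow> (F x, G x) \<noteq> (0, 0) \<Longrightarrow>
       P1_point (F x) (G x) = P1_point (w \<bullet> x) (v \<bullet> x)"
    unfolding quotient_graph_def by blast
  obtain T0 T1 S0 S1 where T: "(T0, T1) \<noteq> (0, 0)" "(S0, S1) \<noteq> (0, 0)" "x = pt T0 T1 S0 S1" "p = proj_point x"
    using mem_point_cases[OF y(2) x(1)] .
  obtain t0 t1 s0 s1 where nz: "v \<bullet> pt t0 t1 s0 s1 \<noteq> 0" using v_nonzero_somewhere .
  have "F (pt T0 T1 S0 S1) * den S0 S1 - G (pt T0 T1 S0 S1) * num S0 S1 = 0"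
  proof (rule polynomial_on_lines_mult_eq_0[of "\<lambda>T0 T1 S0 S1. F (pt T0 T1 S0 S1) * den S0 S1 - G (pt T0 T1 S0 S1) * num S0 S1"
        "\<lambda>T0 T1 S0 S1. v \<bullet> pt T0 T1 S0 S1"])
    show "polynomial_on_lines (\<lambda>T0 T1 S0 S1. F (pt T0 T1 S0 S1) * den S0 S1 - G (pt T0 T1 S0 S1) * num S0 S1)"
      unfolding num_def den_def pt_def
      by (intro polynomial_on_lines_intros polynomial_on_lines_homogeneous_mat[OF F _ A] polynomial_on_lines_homogeneous_mat[OF G _ A]) simp_all
    show "polynomial_on_lines (\<lambda>T0 T1 S0 S1. v \<bullet> pt T0 T1 S0 S1)"
      unfolding form_pt[OF v] using A v by (intro polynomial_on_lines_scalar_prod) simp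
    show "v \<bullet> pt t0 t1 s0 s1 \<noteq> 0" by (rule nz)
    fix T0 T1 S0 S1 :: 'a
    let ?x = "pt T0 T1 S0 S1"
    show "(F ?x * den S0 S1 - G ?x * num S0 S1) * (v \<bullet> ?x) = 0"
    proof (cases "v \<bullet> ?x = 0 \<or> (F ?x, G ?x) = (0, 0)")
      case False
      have "(T0, T1) \<noteq> (0, 0) \<and> (S0, S1) \<noteq> (0, 0)" using pt_eq_0[of T0 T1 S0 S1] False v by force
      then have "proj_point ?x \<in> X" unfolding X_eq by blast
      then have "F ?x * (v \<bullet> ?x) = G ?x * (w \<bullet> ?x)"
        using P1_point_eqD[OF agree[OF _ proj_point_self]] False by blast
      then have "F ?x * den S0 S1 * (v \<bullet> ?x) = G ?x * ((w \<bullet> ?x) * den S0 S1)" by (simp add: mult_ac)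
      then show ?thesis unfolding form_identity[symmetric] by (simp add: algebra_simps)
    qed auto
  qed
  then have "q = P1_point (num S0 S1) (den S0 S1)"
    unfolding x(3) using x(2) T by (intro P1_point_eqI num_den_nonzero) auto
  then show "y \<in> ?R" using y T by blast
next
  fix y assume "y \<in> ?R"
  then obtain T0 T1 S0 S1 where T: "(T0, T1) \<noteq> (0, 0)" "(S0, S1) \<noteq> (0, 0)"
    and y: "y = (proj_point (pt T0 T1 S0 S1), P1_point (num S0 S1) (den S0 S1))" by blast
  obtain k z where k1: "column_start m k"
    and k2: "\<forall>t0 t1 s0 s1. scroll_point m t0 t1 s0 s1 $ k = z t0 t1 s0 s1 * s0"
    and k3: "\<forall>t0 t1 s0 s1. scroll_point m t0 t1 s0 s1 $ Suc k = z t0 t1 s0 s1 * s1"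
    and k4: "z T0 T1 S0 S1 \<noteq> 0" using scroll_point_column[OF m T] .
  note k = k1 k2[rule_format] k3[rule_format] k4
  have kb: "k < n" "Suc k < n" using k(1) by (auto simp: column_start_def)
  define L where "L c d x = (\<Sum>i<n. (c * Ai $$ (k, i) + d * Ai $$ (Suc k, i)) * x $ i)" for c d and x :: "'a vec"
  have L: "L c d (pt T0 T1 S0 S1) = z T0 T1 S0 S1 * (c * S0 + d * S1)" for c d T0 T1 S0 S1
  proof -
    let ?x = "pt T0 T1 S0 S1"
    have "L c d ?x = c * (\<Sum>i<n. Ai $$ (k, i) * ?x $ i) + d * (\<Sum>i<n. Ai $$ (Suc k, i) * ?x $ i)"
      unfolding L_def by (simp only: distrib_right sum.distrib sum_distrib_left mult.assoc)
    also have "\<dots> = c * (Ai *\<^sub>v ?x) $ k + d * (Ai *\<^sub>v ?x) $ Suc k"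
      using kb Ai pt_carrier[of T0 T1 S0 S1] by (simp add: scalar_prod_def atLeast0LessThan)
    finally show ?thesis unfolding Ai_pt k(2,3) by (simp add: algebra_simps)
  qed
  have Lh: "homogeneous_poly (2 * m + 1 + 1) 1 (L c d)" for c d
    unfolding L_def using homogeneous_linear_form[of n] by simp
  have FG: "L b0 b1 (pt T0 T1 S0 S1) = z T0 T1 S0 S1 * num S0 S1"
    "L a0 a1 (pt T0 T1 S0 S1) = z T0 T1 S0 S1 * den S0 S1" for T0 T1 S0 S1
    unfolding L num_def den_def by (rule refl)+
  show "y \<in> quotient_graph (2 * m + 1) X w v"
    unfolding quotient_graph_def y mem_Collect_eq case_prod_conv
  proof (rule conjI, goal_cases)
    case 1
    show ?case using T unfolding X_eq by blast
  next
    case 2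
    show ?case
    proof (rule exI[of _ 1], rule exI[of _ "L b0 b1"], rule exI[of _ "L a0 a1"], intro conjI Lh)
    show "\<exists>x\<in>proj_point (pt T0 T1 S0 S1). (L b0 b1 x, L a0 a1 x) \<noteq> (0, 0) \<and>
        P1_point (num S0 S1) (den S0 S1) = P1_point (L b0 b1 x) (L a0 a1 x)"
    proof (intro bexI[of _ "pt T0 T1 S0 S1"] conjI)
      show "(L b0 b1 (pt T0 T1 S0 S1), L a0 a1 (pt T0 T1 S0 S1)) \<noteq> (0, 0)"
        using num_den_nonzero[OF T(2)] k(4) unfolding FG by simp
      show "P1_point (num S0 S1) (den S0 S1) = P1_point (L b0 b1 (pt T0 T1 S0 S1)) (L a0 a1 (pt T0 T1 S0 S1))"
        unfolding FG using P1_point_smult[OF k(4)] by simp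
    qed (rule proj_point_self)
    show "\<forall>p'\<in>X. \<forall>x\<in>p'. v \<bullet> x \<noteq> 0 \<and> (L b0 b1 x, L a0 a1 x) \<noteq> (0, 0) \<longrightarrow>
        P1_point (L b0 b1 x) (L a0 a1 x) = P1_point (w \<bullet> x) (v \<bullet> x)"
    proof (intro ballI impI)
      fix p' x assume px: "p' \<in> X" "x \<in> p'" and nz: "v \<bullet> x \<noteq> 0 \<and> (L b0 b1 x, L a0 a1 x) \<noteq> (0, 0)"
      obtain T0 T1 S0 S1 where x: "x = pt T0 T1 S0 S1" using mem_point_cases[OF px] by metis
      have "L b0 b1 x * (v \<bullet> x) = z T0 T1 S0 S1 * ((v \<bullet> x) * num S0 S1)" unfolding x FG by (simp add: mult_ac)
      also have "\<dots> = L a0 a1 x * (w \<bullet> x)" unfolding x FG form_identity by (simp add: mult_ac)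
      finally show "P1_point (L b0 b1 x) (L a0 a1 x) = P1_point (w \<bullet> x) (v \<bullet> x)"
        using nz by (intro P1_point_eqI) auto
    qed
    qed
  qed
qed

lemma proj_point_pt_eqD:
  assumes "(T0, T1) \<noteq> (0, 0)" "(S0, S1) \<noteq> (0, 0)" "proj_point (pt T0 T1 S0 S1) = proj_point (pt T0' T1' S0' S1')"
  shows "S0 * S1' = S1 * S0'"
proof -
  have "pt T0 T1 S0 S1 \<in> proj_point (pt T0' T1' S0' S1')" using assms(3) proj_point_self by blast
  then obtain c where "pt T0 T1 S0 S1 = c \<cdot>\<^sub>v pt T0' T1' S0' S1'" unfolding proj_point_def by blast
  then have "Ai *\<^sub>v pt T0 T1 S0 S1 = c \<cdot>\<^sub>v (Ai *\<^sub>v pt T0' T1' S0' S1')"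
    using mult_mat_vec[OF Ai pt_carrier] by simp
  then show ?thesis unfolding Ai_pt smult_scroll_point using scroll_point_eq_imp[OF m assms(1,2)] by blast
qed

lemma ex1_value:
  assumes "p \<in> X" shows "\<exists>!q. (p, q) \<in> quotient_graph (2 * m + 1) X w v"
proof -
  obtain T0 T1 S0 S1 where T: "(T0, T1) \<noteq> (0, 0)" "(S0, S1) \<noteq> (0, 0)" "p = proj_point (pt T0 T1 S0 S1)"
    using assms unfolding X_eq by blast
  show ?thesis
  proof (rule ex1I[of _ "P1_point (num S0 S1) (den S0 S1)"])
    show "(p, P1_point (num S0 S1) (den S0 S1)) \<in> quotient_graph (2 * m + 1) X w v"
      using T unfolding graph_eq by blast
    fix q assume "(p, q) \<in> quotient_graph (2 * m + 1) X w v"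
    then obtain T0' T1' S0' S1' where T': "(T0', T1') \<noteq> (0, 0)" "(S0', S1') \<noteq> (0, 0)"
      "p = proj_point (pt T0' T1' S0' S1')" "q = P1_point (num S0' S1') (den S0' S1')"
      unfolding graph_eq by blast
    have "S0' * S1 = S1' * S0" using proj_point_pt_eqD[OF T'(1,2)] T(3) T'(3) by blast
    then show "q = P1_point (num S0 S1) (den S0 S1)"
      unfolding T'(4) using cross[of S0' S1' S0 S1] T(2) T'(2) by (intro P1_point_eqI num_den_nonzero) simp_all
  qed
qed

text \<open>The map \<open>(S0 : S1) \<mapsto> (num : den)\<close> is injective because its determinant is nonzero. Points with
  proportional \<open>S\<close> lie on the same line, since a factor of \<open>S\<close> can be moved into \<open>T\<close>.\<close>

lemma fiber_eq:
  assumes S: "(S0, S1) \<noteq> (0, 0)"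
  shows "{p. (p, P1_point (num S0 S1) (den S0 S1)) \<in> quotient_graph (2 * m + 1) X w v} = proj_image A (scroll_line m S0 S1)"
    (is "?L = ?R")
proof -
  have R: "?R = {proj_point (pt T0 T1 S0 S1) | T0 T1. (T0, T1) \<noteq> (0, 0)}"
  proof -
    have "(\<lambda>x. A *\<^sub>v x) ` proj_point (scroll_point m T0 T1 S0 S1) = proj_point (pt T0 T1 S0 S1)" for T0 T1
      unfolding pt_def by (rule image_proj_point[OF A]) simp
    then show ?thesis unfolding proj_image_def scroll_line_eq by (auto simp: image_iff) metis+
  qed
  show ?thesis
  proof (intro equalityI subsetI)
    fix p assume "p \<in> ?L"
    then obtain T0 T1 S0' S1' where T: "(T0, T1) \<noteq> (0, 0)" "(S0', S1') \<noteq> (0, 0)" "p = proj_point (pt T0 T1 S0' S1')"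
      "P1_point (num S0 S1) (den S0 S1) = P1_point (num S0' S1') (den S0' S1')"
      unfolding graph_eq by blast
    have "S1 * S0' = S0 * S1'"
      using P1_point_eqD[OF T(4)] cross[of S0 S1 S0' S1'] det by simp
    then obtain c where c: "S0' = c * S0" "S1' = c * S1"
    proof (cases "S0 = 0")
      case True
      then have "S1 \<noteq> 0" using S by simp
      moreover from this have "S0' = 0" using \<open>S1 * S0' = S0 * S1'\<close> True by simp
      ultimately show ?thesis using that[of "S1' / S1"] True by simp
    next
      case False
      then show ?thesis using that[of "S0' / S0"] \<open>S1 * S0' = S0 * S1'\<close> by (simp add: field_simps)
    qed
    then have "c \<noteq> 0" using T(2) by auto
    then have "(c ^ m * T0, c ^ m * T1) \<noteq> (0, 0)" using T(1) by simp
    moreover have "p = proj_point (pt (c ^ m * T0) (c ^ m * T1) S0 S1)"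
      unfolding T(3) c pt_def scroll_point_smult_S ..
    ultimately show "p \<in> ?R" unfolding R by blast
  next
    fix p assume "p \<in> ?R"
    then show "p \<in> ?L" unfolding R graph_eq using S by blast
  qed
qed

lemma fibers_are_ruling:
  "{{p. (p, q) \<in> quotient_graph (2 * m + 1) X w v} | q. q \<in> proj_space 1} = proj_image A ` standard_ruling m"
proof (intro equalityI subsetI)
  fix l assume "l \<in> {{p. (p, q) \<in> quotient_graph (2 * m + 1) X w v} | q. q \<in> proj_space 1}"
  then obtain q where q: "q \<in> proj_space 1" "l = {p. (p, q) \<in> quotient_graph (2 * m + 1) X w v}" by blast
  obtain u0 u1 where u: "(u0, u1) \<noteq> (0, 0)" "q = P1_point u0 u1" using proj_space_1_cases[OF q(1)] .
  let ?d = "a0 * b1 - a1 * b0"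
  \<comment> \<open>Cramer's rule for \<open>num S0 S1 = u0\<close>, \<open>den S0 S1 = u1\<close>, without dividing by the determinant.\<close>
  define S0 S1 where "S0 = b1 * u1 - a1 * u0" and "S1 = a0 * u0 - b0 * u1"
  have nd: "num S0 S1 = ?d * u0" "den S0 S1 = ?d * u1" by (simp_all add: num_def den_def S0_def S1_def algebra_simps)
  have "(S0, S1) \<noteq> (0, 0)"
  proof
    assume "(S0, S1) = (0, 0)"
    then have "?d * u0 = 0" "?d * u1 = 0" unfolding nd[symmetric] by (simp_all add: num_def den_def)
    then show False using det u(1) by simp
  qed
  moreover have "q = P1_point (num S0 S1) (den S0 S1)" unfolding u(2) nd P1_point_smult[OF det] ..
  ultimately show "l \<in> proj_image A ` standard_ruling m"
    unfolding q(2) standard_ruling_def using fiber_eq by blast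
next
  fix l assume "l \<in> proj_image A ` standard_ruling m"
  then obtain S0 S1 where S: "(S0, S1) \<noteq> (0, 0)" "l = proj_image A (scroll_line m S0 S1)"
    unfolding standard_ruling_def by blast
  then show "l \<in> {{p. (p, q) \<in> quotient_graph (2 * m + 1) X w v} | q. q \<in> proj_space 1}"
    using fiber_eq[OF S(1)] P1_point_in_proj_space[OF num_den_nonzero[OF S(1)]] by blast
qed

end

section \<open>From weight vectors to rulings\<close>

lemma invertible_mat_witness:
  assumes "A \<in> carrier_mat n n" "invertible_mat A"
  obtains Ai where "Ai \<in> carrier_mat n n" "Ai * A = 1\<^sub>m n" "A * Ai = 1\<^sub>m n"
proof -
  obtain B where B: "A * B = 1\<^sub>m n" "B * A = 1\<^sub>m (dim_row B)"
    using assms unfolding invertible_mat_def inverts_mat_def by auto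
  have "dim_col B = n" using arg_cong[OF B(1), of dim_col] by simp
  moreover have r: "dim_row B = n" using arg_cong[OF B(2), of dim_col] assms(1) by simp
  ultimately have "B \<in> carrier_mat n n" by (intro carrier_matI)
  moreover have "B * A = 1\<^sub>m n" using B(2) unfolding r .
  ultimately show ?thesis using that B(1) by blast
qed

lemma general_linearI:
  assumes "A \<in> carrier_mat n n" "Ai \<in> carrier_mat n n" "Ai * A = 1\<^sub>m n" "A * Ai = 1\<^sub>m n"
  shows "A \<in> general_linear n"
  using assms unfolding general_linear_def invertible_mat_def inverts_mat_def by auto

text \<open>A predicate of its own because it is reached along two routes, in the original coordinates and
  in the exchanged ones.\<close>

definition has_ruling_fibers :: "nat \<Rightarrow> 'a::field vec set set \<Rightarrow> 'a vec \<Rightarrow> 'a vec \<Rightarrow> bool" where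
  "has_ruling_fibers m X w v \<longleftrightarrow> (\<forall>p\<in>X. \<exists>!q. (p, q) \<in> quotient_graph (2 * m + 1) X w v) \<and>
    (\<exists>R. is_ruling m X R \<and>
      {{p. (p, q) \<in> quotient_graph (2 * m + 1) X w v} | q. q \<in> proj_space 1} = R)"

text \<open>The lowering operator acts on forms by \<open>- F\<close>, so \<open>w/v = - m b/a\<close> for the eigenform \<open>a\<close> of \<open>H\<close>
  and \<open>b = F a\<close>. This is why the coefficients \<open>- m b0\<close> and \<open>- m b1\<close> appear.\<close>

lemma ruling_of_eigenforms:
  fixes A Ai :: "'a::field_char_0 mat"
  assumes m: "m \<ge> 1" and A: "A \<in> carrier_mat (2 * m + 2) (2 * m + 2)" and Ai: "Ai \<in> carrier_mat (2 * m + 2) (2 * m + 2)"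
    and inv: "Ai * A = 1\<^sub>m (2 * m + 2)" "A * Ai = 1\<^sub>m (2 * m + 2)" and X: "X = proj_image A (scroll m)"
    and v: "v \<in> carrier_vec (2 * m + 2)" and w: "w \<in> carrier_vec (2 * m + 2)"
    and v0: "transpose_mat A *\<^sub>v v \<noteq> 0\<^sub>v (2 * m + 2)"
    and triple: "vf_triple H E F" "E \<noteq> 0"
    and eigen: "lie_deriv m H (lower_form m (transpose_mat A *\<^sub>v v)) = - smult (of_nat m) (lower_form m (transpose_mat A *\<^sub>v v))"
      "lie_deriv m H (upper_form m (transpose_mat A *\<^sub>v v)) = - smult (of_nat m) (upper_form m (transpose_mat A *\<^sub>v v))"
    and lowering: "lower_form m (transpose_mat A *\<^sub>v w) = - lie_deriv m F (lower_form m (transpose_mat A *\<^sub>v v))"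
      "upper_form m (transpose_mat A *\<^sub>v w) = - lie_deriv m F (upper_form m (transpose_mat A *\<^sub>v v))"
  shows "has_ruling_fibers m X w v"
proof -
  obtain a0 a1 b0 b1 where a: "lie_deriv 1 H [:a0, a1:] = - [:a0, a1:]"
    and b: "lie_deriv 1 F [:a0, a1:] = [:b0, b1:]" and det: "a0 * b1 - a1 * b0 \<noteq> 0"
    using vf_triple_eigenform[OF triple] .
  have H: "H \<noteq> 0"
  proof
    assume "H = 0"
    then have "smult 2 E = 0" using triple(1) unfolding vf_triple_def by (auto simp: vf_bracket_def)
    then show False using triple(2) by simp
  qed
  let ?M = "of_nat m :: 'a"
  have ratio: "f * [:- ?M * b0, - ?M * b1:] = - lie_deriv m F f * [:a0, a1:]"
    if "lie_deriv m H f = - smult ?M f" for f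
  proof -
    have "[:- ?M * b0, - ?M * b1:] = smult (- ?M) [:b0, b1:]" by simp
    then have "f * [:- ?M * b0, - ?M * b1:] = - smult ?M (f * [:b0, b1:])"
      by (simp only: mult_smult_right smult_minus_left mult_minus_right)
    then show ?thesis using lie_deriv_eigen_ratio[OF that a H, of F] unfolding b
      by (simp only: mult_minus_left)
  qed
  interpret scroll_pencil m A Ai X v w a0 a1 "- ?M * b0" "- ?M * b1"
  proof
    have "a0 * (- ?M * b1) - a1 * (- ?M * b0) = - ?M * (a0 * b1 - a1 * b0)" by (simp add: algebra_simps)
    moreover have "?M \<noteq> 0" using m by simp
    ultimately show "a0 * (- ?M * b1) - a1 * (- ?M * b0) \<noteq> 0" using det by simp
    show "lower_form m (transpose_mat A *\<^sub>v v) * [:- ?M * b0, - ?M * b1:] = lower_form m (transpose_mat A *\<^sub>v w) * [:a0, a1:]"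
      unfolding ratio[OF eigen(1)] lowering ..
    show "upper_form m (transpose_mat A *\<^sub>v v) * [:- ?M * b0, - ?M * b1:] = upper_form m (transpose_mat A *\<^sub>v w) * [:a0, a1:]"
      unfolding ratio[OF eigen(2)] lowering ..
  qed (fact m A Ai inv(1) X v w v0)+
  have "is_ruling m X (proj_image A ` standard_ruling m)"
    unfolding is_ruling_def using general_linearI[OF A Ai inv] X by blast
  then show ?thesis unfolding has_ruling_fibers_def
    by (intro conjI ballI ex1_value exI[of _ "proj_image A ` standard_ruling m"] fibers_are_ruling)
qed

section \<open>The two rulings of the quadric\<close>

text \<open>For \<open>m = 1\<close> the coordinates on the chart are \<open>1, s, t, s t\<close>, and exchanging \<open>s\<close> and \<open>t\<close> exchanges
  the two in the middle.\<close>

definition swap_mat :: "'a::field mat" where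
  "swap_mat = mat 4 4 (\<lambda>(i, j). if (i, j) \<in> {(0, 0), (1, 2), (2, 1), (3, 3)} then 1 else 0)"

lemma swap_mat_carrier: "swap_mat \<in> carrier_mat 4 4" by (simp add: swap_mat_def)

lemma atLeastLessThan_0_4: "{0..<4} = {0, 1, 2, 3 :: nat}" by auto

lemma swap_mat_mult_vec:
  assumes "x \<in> carrier_vec 4"
  shows "(swap_mat *\<^sub>v x) $ 0 = x $ 0" "(swap_mat *\<^sub>v x) $ 1 = x $ 2"
    "(swap_mat *\<^sub>v x) $ 2 = x $ 1" "(swap_mat *\<^sub>v x) $ 3 = x $ 3"
  using assms by (simp_all add: swap_mat_def scalar_prod_def atLeastLessThan_0_4)

lemma transpose_swap_mat: "transpose_mat swap_mat = swap_mat"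
  by (rule eq_matI) (auto simp: swap_mat_def)

lemma swap_mat_squared: "swap_mat * swap_mat = 1\<^sub>m 4"
proof (rule eq_matI)
  fix i j assume "i < dim_row (1\<^sub>m 4 :: 'a mat)" "j < dim_col (1\<^sub>m 4 :: 'a mat)"
  then have ij: "i = 0 \<or> i = 1 \<or> i = 2 \<or> i = 3" "j = 0 \<or> j = 1 \<or> j = 2 \<or> j = 3" by auto
  then show "(swap_mat * swap_mat) $$ (i, j) = (1\<^sub>m 4 :: 'a mat) $$ (i, j)"
    by (elim disjE) (simp_all add: swap_mat_def scalar_prod_def atLeastLessThan_0_4)
qed (simp_all add: swap_mat_def)

lemma scroll_point_1_index:
  "scroll_point 1 T0 T1 S0 S1 $ 0 = T0 * S0" "scroll_point 1 T0 T1 S0 S1 $ 1 = T0 * S1"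
  "scroll_point 1 T0 T1 S0 S1 $ 2 = T1 * S0" "scroll_point 1 T0 T1 S0 S1 $ 3 = T1 * S1"
  by (simp_all add: scroll_point_def)

lemma scroll_point_1_carrier: "scroll_point 1 T0 T1 S0 S1 \<in> carrier_vec 4"
  using scroll_point_carrier[of 1 T0 T1 S0 S1] by simp

lemma eq_vec4I:
  assumes "x \<in> carrier_vec 4" "y \<in> carrier_vec 4" "x $ 0 = y $ 0" "x $ 1 = y $ 1" "x $ 2 = y $ 2" "x $ 3 = y $ 3"
  shows "x = y"
proof (rule eq_vecI)
  fix i assume "i < dim_vec y"
  then have "i = 0 \<or> i = 1 \<or> i = 2 \<or> i = 3" using assms(2) by auto
  then show "x $ i = y $ i" using assms by auto
qed (use assms in auto)

lemma swap_mat_scroll_point: "swap_mat *\<^sub>v scroll_point 1 T0 T1 S0 S1 = scroll_point 1 S0 S1 T0 T1"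
  by (rule eq_vec4I)
    (simp_all only: swap_mat_mult_vec[OF scroll_point_1_carrier] scroll_point_1_index scroll_point_1_carrier
      mult_mat_vec_carrier[OF swap_mat_carrier scroll_point_1_carrier] mult.commute)

lemma proj_image_swap_scroll: "proj_image swap_mat (scroll 1) = (scroll 1 :: 'a::field_char_0 vec set set)"
proof -
  have e: "(\<lambda>x. swap_mat *\<^sub>v x) ` proj_point (scroll_point 1 T0 T1 S0 S1) = proj_point (scroll_point 1 S0 S1 T0 T1)"
    for T0 T1 S0 S1 :: 'a
    using image_proj_point[OF swap_mat_carrier scroll_point_1_carrier] unfolding swap_mat_scroll_point by blast
  show ?thesis
  proof (intro equalityI subsetI)
    fix p :: "'a vec set" assume "p \<in> proj_image swap_mat (scroll 1)"
    then obtain T0 T1 S0 S1 where "(T0, T1) \<noteq> (0, 0)" "(S0, S1) \<noteq> (0, 0)"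
      "p = (\<lambda>x. swap_mat *\<^sub>v x) ` proj_point (scroll_point 1 T0 T1 S0 S1)"
      unfolding proj_image_def scroll_eq by blast
    then show "p \<in> scroll 1" unfolding e scroll_eq by blast
  next
    fix p :: "'a vec set" assume "p \<in> scroll 1"
    then obtain T0 T1 S0 S1 where T: "(T0, T1) \<noteq> (0, 0)" "(S0, S1) \<noteq> (0, 0)"
      "p = proj_point (scroll_point 1 T0 T1 S0 S1)"
      unfolding scroll_eq by blast
    have "proj_point (scroll_point 1 S0 S1 T0 T1) \<in> scroll 1" unfolding scroll_eq using T by blast
    moreover have "p = (\<lambda>x. swap_mat *\<^sub>v x) ` proj_point (scroll_point 1 S0 S1 T0 T1)" using T(3) e by simp
    ultimately show "p \<in> proj_image swap_mat (scroll 1)" unfolding proj_image_def by blast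
  qed
qed

lemma proj_image_mult:
  assumes A: "A \<in> carrier_mat n n" and B: "B \<in> carrier_mat n n" and S: "\<And>p x. p \<in> S \<Longrightarrow> x \<in> p \<Longrightarrow> x \<in> carrier_vec n"
  shows "proj_image (A * B) S = proj_image A (proj_image B S)"
proof -
  have "(\<lambda>x. (A * B) *\<^sub>v x) ` p = (\<lambda>x. A *\<^sub>v x) ` (\<lambda>x. B *\<^sub>v x) ` p" if "p \<in> S" for p
    unfolding image_image by (rule image_cong) (use S[OF that] assoc_mult_mat_vec[OF A B] in simp_all)
  then show ?thesis unfolding proj_image_def by (simp add: image_image cong: image_cong)
qed

lemma scroll_mem_carrier:
  assumes "p \<in> scroll m" "x \<in> p" shows "(x :: 'a::field_char_0 vec) \<in> carrier_vec (2 * m + 2)"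
  using assms unfolding scroll_eq proj_point_def by force

lemma swap_forms:
  assumes "l \<in> carrier_vec 4"
  shows "lower_form 1 (swap_mat *\<^sub>v l) = [:coeff (lower_form 1 l) 0, coeff (upper_form 1 l) 0:]"
    "upper_form 1 (swap_mat *\<^sub>v l) = [:coeff (lower_form 1 l) 1, coeff (upper_form 1 l) 1:]"
proof -
  have s: "Suc (Suc 0) = 2" "Suc (Suc (Suc 0)) = 3" by simp_all
  have "{..1::nat} = {0, 1}" by auto
  then have "lower_form 1 x = [:x $ 0, x $ 1:]" "upper_form 1 x = [:x $ 2, x $ 3:]" for x :: "'a vec"
    by (simp_all add: lower_form_def upper_form_def monom_Suc monom_0 s)
  then show "lower_form 1 (swap_mat *\<^sub>v l) = [:coeff (lower_form 1 l) 0, coeff (upper_form 1 l) 0:]"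
    "upper_form 1 (swap_mat *\<^sub>v l) = [:coeff (lower_form 1 l) 1, coeff (upper_form 1 l) 1:]"
    using swap_mat_mult_vec[OF assms] by simp_all
qed

text \<open>Without a component in \<open>s\<close>, the matrix differentiates along \<open>t\<close> only; after the exchange of the
  variables it differentiates along \<open>s\<close> only.\<close>

lemma acts_by_swap:
  fixes D :: "'a::field_char_0 mat"
  assumes D: "acts_by 1 D 0 \<rho> 0" and l: "l \<in> carrier_vec 4"
  shows "lower_form 1 (swap_mat *\<^sub>v (transpose_mat D *\<^sub>v l)) = lie_deriv 1 \<rho> (lower_form 1 (swap_mat *\<^sub>v l))"
    "upper_form 1 (swap_mat *\<^sub>v (transpose_mat D *\<^sub>v l)) = lie_deriv 1 \<rho> (upper_form 1 (swap_mat *\<^sub>v l))"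
proof -
  have deg: "degree \<rho> \<le> 2" and Dc: "D \<in> carrier_mat 4 4" using D unfolding acts_by_def by simp_all
  obtain p q r where \<rho>: "\<rho> = [:p, q, r:]" using quadratic_poly_cases[OF deg] .
  have cf: "coeff [:p, q, r:] 0 = p" "coeff [:p, q, r:] 1 = q" "coeff [:p, q, r:] 2 = r"
    by (simp_all add: numeral_2_eq_2)
  have l': "l \<in> carrier_vec (2 * 1 + 2)" using l by simp
  have Dl: "transpose_mat D *\<^sub>v l \<in> carrier_vec 4" using Dc l by simp
  note a = acts_byD[OF D l', unfolded \<rho> cf]
  show "lower_form 1 (swap_mat *\<^sub>v (transpose_mat D *\<^sub>v l)) = lie_deriv 1 \<rho> (lower_form 1 (swap_mat *\<^sub>v l))"
    "upper_form 1 (swap_mat *\<^sub>v (transpose_mat D *\<^sub>v l)) = lie_deriv 1 \<rho> (upper_form 1 (swap_mat *\<^sub>v l))"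
    unfolding swap_forms[OF l] swap_forms[OF Dl] \<rho> lie_deriv_linear a by simp_all
qed

section \<open>Conjugation of matrices and the Lie algebra \<open>sl\<^sub>2\<close>\<close>

lemma mult_mat_vec_zero:
  assumes "B \<in> carrier_mat n n" shows "B *\<^sub>v 0\<^sub>v n = 0\<^sub>v n"
  using assms by (intro eq_vecI) auto

lemma conj_bracket:
  assumes A: "A \<in> carrier_mat n n" and Ai: "Ai \<in> carrier_mat n n" and inv: "A * Ai = 1\<^sub>m n"
    and B: "B \<in> carrier_mat n n" and C: "C \<in> carrier_mat n n"
  shows "bracket (Ai * B * A) (Ai * C * A) = Ai * bracket B C * (A :: 'a::field mat)"
proof -
  have p: "(Ai * B * A) * (Ai * C * A) = Ai * (B * C) * A"
    if B: "B \<in> carrier_mat n n" and C: "C \<in> carrier_mat n n" for B C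
  proof -
    have "(Ai * B * A) * (Ai * C * A) = Ai * (B * ((A * Ai) * (C * A)))"
      using A Ai B C by (simp add: assoc_mult_mat[of _ n n _ n _ n] mult_carrier_mat[of _ n n _ n])
    also have "\<dots> = Ai * (B * C) * A"
      unfolding inv using A Ai B C by (simp add: assoc_mult_mat[of _ n n _ n _ n] mult_carrier_mat[of _ n n _ n])
    finally show ?thesis .
  qed
  have "B * C \<in> carrier_mat n n" "C * B \<in> carrier_mat n n" using B C by (auto intro: mult_carrier_mat)
  then show ?thesis unfolding bracket_def p[OF B C] p[OF C B]
    using A Ai mult_minus_distrib_mat[of Ai n n "B * C" n "C * B"]
      minus_mult_distrib_mat[of "Ai * (B * C)" n n "Ai * (C * B)" A n] by (simp add: mult_carrier_mat[of _ n n _ n])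
qed

lemma conj_smult:
  assumes A: "A \<in> carrier_mat n n" and Ai: "Ai \<in> carrier_mat n n" and B: "B \<in> carrier_mat n n"
  shows "Ai * (c \<cdot>\<^sub>m B) * A = c \<cdot>\<^sub>m (Ai * B * (A :: 'a::field mat))"
  using mult_smult_distrib[OF Ai B, of c] mult_smult_assoc_mat[OF mult_carrier_mat[OF Ai B] A, of c] by simp

text \<open>On forms, conjugation by \<open>A\<close> becomes the change of variables \<open>v \<mapsto> A\<^sup>T v\<close>.\<close>

lemma conj_transpose_mult_vec:
  assumes A: "A \<in> carrier_mat n n" and Ai: "Ai \<in> carrier_mat n n" and inv: "A * Ai = 1\<^sub>m n"
    and B: "B \<in> carrier_mat n n" and v: "v \<in> carrier_vec n"
  shows "transpose_mat (Ai * B * A) *\<^sub>v (transpose_mat A *\<^sub>v v) = transpose_mat A *\<^sub>v (transpose_mat B *\<^sub>v (v :: 'a::field vec))"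
proof -
  have "transpose_mat (Ai * B * A) = transpose_mat A * (transpose_mat B * transpose_mat Ai)"
    using transpose_mult[OF mult_carrier_mat[OF Ai B] A] transpose_mult[OF Ai B] by simp
  moreover have "transpose_mat Ai *\<^sub>v (transpose_mat A *\<^sub>v v) = v"
  proof -
    have "transpose_mat Ai * transpose_mat A = 1\<^sub>m n" using transpose_mult[OF A Ai] inv by simp
    then show ?thesis using assoc_mult_mat_vec[of "transpose_mat Ai" n n "transpose_mat A" n v] A Ai v by simp
  qed
  ultimately show ?thesis
    using assoc_mult_mat_vec[of "transpose_mat A" n n "transpose_mat B * transpose_mat Ai" n "transpose_mat A *\<^sub>v v"]
      assoc_mult_mat_vec[of "transpose_mat B" n n "transpose_mat Ai" n "transpose_mat A *\<^sub>v v"] A Ai B v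
    by (simp add: mult_carrier_mat[of _ n n _ n])
qed

lemma uminus_mat_mult_vec:
  assumes "B \<in> carrier_mat n n" "x \<in> carrier_vec n"
  shows "(- B) *\<^sub>v x = - (B *\<^sub>v (x :: 'a::field vec))"
  using assms by (intro eq_vecI) (auto simp: uminus_scalar_prod)

lemma mult_mat_uminus_vec:
  assumes "B \<in> carrier_mat n n" "x \<in> carrier_vec n"
  shows "B *\<^sub>v (- x) = - (B *\<^sub>v (x :: 'a::field vec))"
  using assms by (intro eq_vecI) (auto simp: scalar_prod_uminus_right)

lemma mat_subspace_smult:
  assumes "mat_subspace n S" "B \<in> S" shows "c \<cdot>\<^sub>m B \<in> S"
proof -
  have "submodule class_ring S (module_mat TYPE('a) n n)"
    using assms(1) unfolding VectorSpace.subspace_def by blast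
  from submodule.smult_closed[OF this, of c B] assms(2) show ?thesis
    by (simp add: module_mat_def)
qed

lemma sl2_mem: "sl2_h \<in> sl 2" "sl2_x \<in> sl 2" "sl2_y \<in> sl 2"
  by (auto simp: sl_def sl2_h_def sl2_x_def sl2_y_def trace_mat_def mat_of_rows_list_def numeral_2_eq_2)

lemma sl2_brackets:
  "bracket sl2_h sl2_x = 2 \<cdot>\<^sub>m (sl2_x :: 'a::field mat)"
  "bracket sl2_h sl2_y = - 2 \<cdot>\<^sub>m (sl2_y :: 'a::field mat)"
  "bracket sl2_x sl2_y = (sl2_h :: 'a::field mat)"
  by (rule eq_matI; auto simp: bracket_def sl2_h_def sl2_x_def sl2_y_def mat_of_rows_list_def scalar_prod_def
      numeral_2_eq_2 less_Suc_eq)+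

section \<open>The two summands of the Levi subalgebra\<close>

lemma acts_by_of_lie_algebra:
  fixes A Ai B :: "'a::field_char_0 mat" and m :: nat
  assumes "m \<ge> 1" and A: "A \<in> carrier_mat (2 * m + 2) (2 * m + 2)" and Ai: "Ai \<in> carrier_mat (2 * m + 2) (2 * m + 2)"
    and inv: "Ai * A = 1\<^sub>m (2 * m + 2)"
    and B: "B \<in> lie_algebra_of (2 * m + 1) (proj_image A (scroll m))"
  shows "\<exists>\<kappa> \<rho> \<mu>. acts_by m (Ai * B * A) \<kappa> \<rho> \<mu>"
proof (rule acts_by_of_minors[OF assms(1)])
  have "B \<in> carrier_mat (2 * m + 2) (2 * m + 2)"
    using B unfolding lie_algebra_of_def tangent_at_one_def by simp
  then show "Ai * B * A \<in> carrier_mat (2 * m + 2) (2 * m + 2)" using A Ai by (auto intro: mult_carrier_mat)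
  show "y $ i * x $ Suc k + x $ i * y $ Suc k - (y $ Suc i * x $ k + x $ Suc i * y $ k) = 0"
    if "column_start m i" "column_start m k" "x = scroll_point m 1 t 1 s" "y = (Ai * B * A) *\<^sub>v x" for i k t s x y
    using tangent_minor[OF B A Ai inv that] .
qed

text \<open>Relations between matrices pass to \<open>\<kappa>\<close>, \<open>\<rho>\<close> and \<open>\<mu>\<close> separately because these are unique. The
  constants vanish since \<open>h\<close> and \<open>y\<close> are multiples of brackets.\<close>

lemma vf_triple_of_acts_by:
  fixes Dh Dx Dy :: "'a::field_char_0 mat"
  assumes m: "m \<ge> 1"
    and h: "acts_by m Dh \<kappa>h \<rho>h \<mu>h" and x: "acts_by m Dx \<kappa>x \<rho>x \<mu>x" and y: "acts_by m Dy \<kappa>y \<rho>y \<mu>y"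
    and br: "bracket Dh Dx = 2 \<cdot>\<^sub>m Dx" "bracket Dh Dy = - 2 \<cdot>\<^sub>m Dy" "bracket Dx Dy = Dh"
  shows "vf_triple \<rho>h \<rho>x \<rho>y" "vf_triple \<mu>h \<mu>x \<mu>y" "\<kappa>h = 0" "\<kappa>y = 0"
proof -
  have deg: "degree \<rho>h \<le> 2" "degree \<rho>x \<le> 2" "degree \<rho>y \<le> 2" "degree \<mu>h \<le> 2" "degree \<mu>x \<le> 2" "degree \<mu>y \<le> 2"
    using h x y unfolding acts_by_def by blast+
  note hx = acts_by_unique[OF m acts_by_bracket[OF h x, unfolded br(1)] acts_by_smult[OF x, of 2]]
  note hy = acts_by_unique[OF m acts_by_bracket[OF h y, unfolded br(2)] acts_by_smult[OF y, of "- 2"]]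
  note xy = acts_by_unique[OF m acts_by_bracket[OF x y, unfolded br(3)] h]
  show "vf_triple \<rho>h \<rho>x \<rho>y" "vf_triple \<mu>h \<mu>x \<mu>y"
    unfolding vf_triple_def using deg hx(2,3) hy(2,3) xy(2,3) by blast+
  show "\<kappa>h = 0" "\<kappa>y = 0" using xy(1) hy(1) by simp_all
qed

text \<open>The vector fields of a matrix that commutes with \<open>h\<close> and \<open>x\<close> centralize both triples, so they
  are zero and only the constant remains.\<close>

lemma centralizer_scalar:
  fixes Dh Dx Dj :: "'a::field_char_0 mat"
  assumes m: "m \<ge> 1"
    and h: "acts_by m Dh \<kappa>h \<rho>h \<mu>h" and x: "acts_by m Dx \<kappa>x \<rho>x \<mu>x" and j: "acts_by m Dj \<kappa>j \<rho>j \<mu>j"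
    and triple: "vf_triple \<rho>h \<rho>x \<rho>y" "vf_triple \<mu>h \<mu>x \<mu>y" and nz: "\<rho>x \<noteq> 0" "\<mu>x \<noteq> 0"
    and br: "bracket Dh Dj = 0\<^sub>m (2 * m + 2) (2 * m + 2)" "bracket Dx Dj = 0\<^sub>m (2 * m + 2) (2 * m + 2)"
  shows "Dj = \<kappa>j \<cdot>\<^sub>m 1\<^sub>m (2 * m + 2)"
proof -
  have deg: "degree \<rho>j \<le> 2" "degree \<mu>j \<le> 2" and Dj: "Dj \<in> carrier_mat (2 * m + 2) (2 * m + 2)"
    using j unfolding acts_by_def by blast+
  have z: "0 \<cdot>\<^sub>m Dj = 0\<^sub>m (2 * m + 2) (2 * m + 2)" using Dj by (intro eq_matI) auto
  have zero: "acts_by m (0\<^sub>m (2 * m + 2) (2 * m + 2) :: 'a mat) 0 0 0"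
    using acts_by_smult[OF j, of 0] unfolding z by simp
  note hj = acts_by_unique[OF m acts_by_bracket[OF h j, unfolded br] zero]
  note xj = acts_by_unique[OF m acts_by_bracket[OF x j, unfolded br] zero]
  have "\<rho>j = 0" by (rule vf_triple_commutant[OF triple(1) nz(1) deg(1) hj(2) xj(2)])
  moreover have "\<mu>j = 0" by (rule vf_triple_commutant[OF triple(2) nz(2) deg(2) hj(3) xj(3)])
  ultimately show ?thesis using acts_by_scalar j by blast
qed

theorem theorem4p7:
  fixes m :: nat
    and X :: "'a::{alg_closed_field, field_char_0} vec set set"
    and LSA I J :: "'a mat set"
    and \<phi> \<psi> Rep :: "'a mat \<Rightarrow> 'a mat"
    and U W :: "'a vec set"
    and v w :: "'a vec"
  assumes "m \<ge> 1"
    and "proj_isomorphic (2 * m + 1) X (scroll m)"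
    and "levi_subalgebra (2 * m + 2) LSA (lie_algebra_of (2 * m + 1) X)"
    and "lie_direct_sum (2 * m + 2) I J LSA"
    and "lie_isomorphism (sl 2) I \<phi>"
    and "lie_isomorphism (sl 2) J \<psi>"
    and "\<And>z. z \<in> sl 2 \<Longrightarrow> Rep z = action_on_forms (\<phi> z)"
    and "irreducible_subrep (2 * m + 2) (sl 2) Rep U"
    and "irreducible_subrep (2 * m + 2) (sl 2) Rep W"
    and "vec_dim (2 * m + 2) U = m + 1"
    and "vec_dim (2 * m + 2) W = m + 1"
    and "vec_direct_sum (2 * m + 2) U W"
    and "eigenvector (Rep sl2_h) v (of_nat m)"
    and "w = Rep sl2_y *\<^sub>v v"
  shows "(\<forall>p\<in>X. \<exists>!q. (p, q) \<in> quotient_graph (2 * m + 1) X w v) \<and>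
    (\<exists>R. is_ruling m X R \<and>
      {{p. (p, q) \<in> quotient_graph (2 * m + 1) X w v} | q. q \<in> proj_space 1} = R)"
proof -
  note m = assms(1)
  let ?n = "2 * m + 2"
  let ?L = "lie_algebra_of (2 * m + 1) X"
  have n1: "2 * m + 1 + 1 = ?n" by simp
  obtain A where "A \<in> general_linear ?n" and X: "X = proj_image A (scroll m)"
    using assms(2) unfolding proj_isomorphic_def n1 by blast
  then have A: "A \<in> carrier_mat ?n ?n" and "invertible_mat A" by (simp_all add: general_linear_def)
  then obtain Ai where Ai: "Ai \<in> carrier_mat ?n ?n" and inv: "Ai * A = 1\<^sub>m ?n" "A * Ai = 1\<^sub>m ?n"
    using invertible_mat_witness by blast
  have LSA: "LSA \<subseteq> ?L" using assms(3) unfolding levi_subalgebra_def lie_subalgebra_def by blast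
  have ideals: "lie_ideal ?n I LSA" "lie_ideal ?n J LSA" and IJ: "I \<inter> J = {0\<^sub>m ?n ?n}"
    using assms(4) unfolding lie_direct_sum_def mat_direct_sum_def by blast+
  have \<phi>: "\<phi> z \<in> I" if "z \<in> sl 2" for z using assms(5) that unfolding lie_isomorphism_def by (blast dest: bij_betwE)
  have \<psi>: "\<psi> z \<in> J" if "z \<in> sl 2" for z using assms(6) that unfolding lie_isomorphism_def by (blast dest: bij_betwE)
  have sub: "I \<subseteq> LSA" "J \<subseteq> LSA" using ideals unfolding lie_ideal_def by blast+
  have Lc: "B \<in> carrier_mat ?n ?n" if "B \<in> ?L" for B
    using that unfolding lie_algebra_of_def tangent_at_one_def n1 by blast
  define conj where "conj B = Ai * B * A" for B
  have \<phi>L: "\<phi> z \<in> ?L" if "z \<in> sl 2" for z using \<phi>[OF that] sub LSA by blast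
  have \<psi>L: "\<psi> z \<in> ?L" if "z \<in> sl 2" for z using \<psi>[OF that] sub LSA by blast
  have normal: "\<exists>\<kappa> \<rho> \<mu>. acts_by m (conj B) \<kappa> \<rho> \<mu>" if "B \<in> ?L" for B
    using acts_by_of_lie_algebra[OF m A Ai inv(1)] that unfolding X conj_def by blast
  have br: "bracket (conj B) (conj C) = conj (bracket B C)" if "B \<in> ?L" "C \<in> ?L" for B C
    unfolding conj_def by (rule conj_bracket[OF A Ai inv(2) Lc[OF that(1)] Lc[OF that(2)]])
  have sm: "conj (c \<cdot>\<^sub>m B) = c \<cdot>\<^sub>m conj B" if "B \<in> ?L" for B c
    unfolding conj_def by (rule conj_smult[OF A Ai Lc[OF that]])
  have \<phi>_br: "\<phi> (bracket y z) = bracket (\<phi> y) (\<phi> z)" if "y \<in> sl 2" "z \<in> sl 2" for y z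
    using assms(5) that unfolding lie_isomorphism_def by blast
  have \<phi>_sm: "\<phi> (c \<cdot>\<^sub>m z) = c \<cdot>\<^sub>m \<phi> z" if "z \<in> sl 2" for c z
    using assms(5) that unfolding lie_isomorphism_def by blast
  let ?h = "sl2_h :: 'a mat" and ?x = "sl2_x :: 'a mat" and ?y = "sl2_y :: 'a mat"
  have brackets: "bracket (conj (\<phi> ?h)) (conj (\<phi> ?x)) = 2 \<cdot>\<^sub>m conj (\<phi> ?x)"
    "bracket (conj (\<phi> ?h)) (conj (\<phi> ?y)) = - 2 \<cdot>\<^sub>m conj (\<phi> ?y)"
    "bracket (conj (\<phi> ?x)) (conj (\<phi> ?y)) = conj (\<phi> ?h)"
    by (simp_all only: br \<phi>L sl2_mem \<phi>_br[symmetric] sl2_brackets \<phi>_sm sm)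
  obtain \<kappa>h \<rho>h \<mu>h where h: "acts_by m (conj (\<phi> ?h)) \<kappa>h \<rho>h \<mu>h" using normal[OF \<phi>L[OF sl2_mem(1)]] by blast
  obtain \<kappa>x \<rho>x \<mu>x where x: "acts_by m (conj (\<phi> ?x)) \<kappa>x \<rho>x \<mu>x" using normal[OF \<phi>L[OF sl2_mem(2)]] by blast
  obtain \<kappa>y \<rho>y \<mu>y where y: "acts_by m (conj (\<phi> ?y)) \<kappa>y \<rho>y \<mu>y" using normal[OF \<phi>L[OF sl2_mem(3)]] by blast
  note triple = vf_triple_of_acts_by[OF m h x y brackets]
  \<comment> \<open>Otherwise the second summand, which commutes with the first one, would consist of scalar
    matrices, and these have trace zero only if they are zero.\<close>
  have "\<rho>x = 0 \<or> \<mu>x = 0"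
  proof (rule ccontr)
    assume nz: "\<not> (\<rho>x = 0 \<or> \<mu>x = 0)"
    obtain \<kappa>j \<rho>j \<mu>j where j: "acts_by m (conj (\<psi> ?h)) \<kappa>j \<rho>j \<mu>j" using normal[OF \<psi>L[OF sl2_mem(1)]] by blast
    have comm: "bracket (\<phi> z) (\<psi> ?h) = 0\<^sub>m ?n ?n" if z: "z \<in> sl 2" for z
    proof -
      have c: "\<phi> z \<in> carrier_mat ?n ?n" "\<psi> ?h \<in> carrier_mat ?n ?n"
        using Lc \<phi>L[OF z] \<psi>L[OF sl2_mem(1)] by blast+
      have "bracket (\<psi> ?h) (\<phi> z) \<in> I"
        using ideals(1) \<phi>[OF z] \<psi>[OF sl2_mem(1)] sub unfolding lie_ideal_def by blast
      then have "- 1 \<cdot>\<^sub>m bracket (\<psi> ?h) (\<phi> z) \<in> I"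
        using mat_subspace_smult ideals(1) unfolding lie_ideal_def by blast
      moreover have "- 1 \<cdot>\<^sub>m bracket (\<psi> ?h) (\<phi> z) = bracket (\<phi> z) (\<psi> ?h)"
        unfolding bracket_def by (rule eq_matI) (use c in auto)
      moreover have "bracket (\<phi> z) (\<psi> ?h) \<in> J"
        using ideals(2) \<phi>[OF z] \<psi>[OF sl2_mem(1)] sub unfolding lie_ideal_def by blast
      ultimately show ?thesis using IJ by auto
    qed
    have conj0: "conj (0\<^sub>m ?n ?n) = 0\<^sub>m ?n ?n" unfolding conj_def using A Ai by simp
    have "conj (\<psi> ?h) = \<kappa>j \<cdot>\<^sub>m 1\<^sub>m ?n"
    proof (rule centralizer_scalar[OF m h x j triple(1,2)])
      show "bracket (conj (\<phi> ?h)) (conj (\<psi> ?h)) = 0\<^sub>m ?n ?n" "bracket (conj (\<phi> ?x)) (conj (\<psi> ?h)) = 0\<^sub>m ?n ?n"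
        by (simp_all only: br \<phi>L \<psi>L sl2_mem comm conj0)
    qed (use nz in simp_all)
    then have "A * (Ai * \<psi> ?h * A) * Ai = A * (\<kappa>j \<cdot>\<^sub>m 1\<^sub>m ?n) * Ai" unfolding conj_def by simp
    moreover have "A * (Ai * \<psi> ?h * A) * Ai = \<psi> ?h"
    proof -
      have c: "\<psi> ?h \<in> carrier_mat ?n ?n" using Lc \<psi>L[OF sl2_mem(1)] by blast
      have "A * (Ai * \<psi> ?h * A) * Ai = (A * Ai) * (\<psi> ?h * (A * Ai))"
        using A Ai c by (simp add: assoc_mult_mat[of _ ?n ?n _ ?n _ ?n] mult_carrier_mat[of _ ?n ?n _ ?n] del: add_2_eq_Suc')
      then show ?thesis unfolding inv using c by simp
    qed
    moreover have "A * (\<kappa>j \<cdot>\<^sub>m 1\<^sub>m ?n) * Ai = \<kappa>j \<cdot>\<^sub>m 1\<^sub>m ?n"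
      using mult_smult_distrib[OF A one_carrier_mat, of \<kappa>j] mult_smult_assoc_mat[OF A Ai, of \<kappa>j] A Ai inv by simp
    ultimately have \<psi>h: "\<psi> ?h = \<kappa>j \<cdot>\<^sub>m 1\<^sub>m ?n" by simp
    have "trace_mat (\<psi> ?h) = 0" using \<psi>L[OF sl2_mem(1)] unfolding lie_algebra_of_def sl_def by blast
    moreover have "trace_mat (\<kappa>j \<cdot>\<^sub>m 1\<^sub>m ?n) = of_nat ?n * \<kappa>j" by (simp add: trace_mat_def)
    ultimately have "of_nat ?n * \<kappa>j = 0" unfolding \<psi>h by simp
    then have "\<kappa>j = 0" by (simp only: mult_eq_0_iff of_nat_eq_0_iff) simp
    then have "\<psi> ?h = 0\<^sub>m ?n ?n" unfolding \<psi>h by (intro eq_matI) auto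
    moreover have "\<psi> (0 \<cdot>\<^sub>m ?h) = 0 \<cdot>\<^sub>m \<psi> ?h"
      using assms(6) sl2_mem(1) unfolding lie_isomorphism_def by blast
    ultimately have "\<psi> (0 \<cdot>\<^sub>m ?h) = \<psi> ?h" by simp
    moreover have "0 \<cdot>\<^sub>m ?h \<in> sl 2"
      by (auto simp: sl_def trace_mat_def sl2_h_def mat_of_rows_list_def numeral_2_eq_2)
    moreover have "inj_on \<psi> (sl 2)" using assms(6) unfolding lie_isomorphism_def bij_betw_def by blast
    ultimately have "0 \<cdot>\<^sub>m ?h = ?h" using sl2_mem(1) by (meson inj_onD)
    then have "(0 \<cdot>\<^sub>m ?h) $$ (0, 0) = ?h $$ (0, 0)" by simp
    then show False by (simp add: sl2_h_def mat_of_rows_list_def)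
  qed
  have hc: "\<phi> ?h \<in> carrier_mat ?n ?n" and yc: "\<phi> ?y \<in> carrier_mat ?n ?n"
    using Lc \<phi>L sl2_mem by blast+
  have Rep: "Rep ?h = - transpose_mat (\<phi> ?h)" "Rep ?y = - transpose_mat (\<phi> ?y)"
    using assms(7) sl2_mem unfolding action_on_forms_def by blast+
  have v: "v \<in> carrier_vec ?n" and vnz: "v \<noteq> 0\<^sub>v ?n" and eigen: "Rep ?h *\<^sub>v v = of_nat m \<cdot>\<^sub>v v"
    using assms(13) hc unfolding eigenvector_def Rep by auto
  have w: "w = - (transpose_mat (\<phi> ?y) *\<^sub>v v)"
    unfolding assms(14) Rep using yc v by (intro uminus_mat_mult_vec) simp_all
  have wc: "w \<in> carrier_vec ?n" unfolding w using yc v by simp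
  \<comment> \<open>The form \<open>v\<close> in the coordinates of the standard scroll.\<close>
  define V where "V = transpose_mat A *\<^sub>v v"
  have V: "V \<in> carrier_vec ?n" unfolding V_def using A v by simp
  have "transpose_mat Ai *\<^sub>v V = v"
  proof -
    have "transpose_mat Ai * transpose_mat A = 1\<^sub>m ?n" using transpose_mult[OF A Ai] inv by simp
    then show ?thesis unfolding V_def
      using assoc_mult_mat_vec[of "transpose_mat Ai" ?n ?n "transpose_mat A" ?n v] A Ai v by simp
  qed
  then have V0: "V \<noteq> 0\<^sub>v ?n" using vnz Ai by auto
  have hV: "transpose_mat (conj (\<phi> ?h)) *\<^sub>v V = (- of_nat m) \<cdot>\<^sub>v V"
  proof -
    have "- (transpose_mat (\<phi> ?h) *\<^sub>v v) = of_nat m \<cdot>\<^sub>v v"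
      using eigen uminus_mat_mult_vec[of "transpose_mat (\<phi> ?h)" ?n v] hc v unfolding Rep by simp
    then have "- (- (transpose_mat (\<phi> ?h) *\<^sub>v v)) = - (of_nat m \<cdot>\<^sub>v v)" by simp
    also have "\<dots> = (- of_nat m) \<cdot>\<^sub>v v" by (rule eq_vecI) simp_all
    finally have "transpose_mat (\<phi> ?h) *\<^sub>v v = (- of_nat m) \<cdot>\<^sub>v v" by simp
    then show ?thesis unfolding V_def conj_def conj_transpose_mult_vec[OF A Ai inv(2) hc v]
      using mult_mat_vec[of "transpose_mat A" ?n ?n v] A v by simp
  qed
  have yVc: "transpose_mat (conj (\<phi> ?y)) *\<^sub>v V \<in> carrier_vec ?n"
    unfolding conj_def V_def conj_transpose_mult_vec[OF A Ai inv(2) yc v] using A yc v by simp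
  have yV: "transpose_mat A *\<^sub>v w = - (transpose_mat (conj (\<phi> ?y)) *\<^sub>v V)"
    unfolding w V_def conj_def conj_transpose_mult_vec[OF A Ai inv(2) yc v]
    using A yc v by (intro mult_mat_uminus_vec[of _ ?n]) simp_all
  show ?thesis
    unfolding has_ruling_fibers_def[symmetric]
  proof (cases "\<rho>x = 0")
    case True
    \<comment> \<open>The summand acts by vector fields in \<open>s\<close> alone.\<close>
    have \<rho>: "\<rho>h = 0" "\<rho>y = 0" using vf_triple_zero[OF triple(1) True] by simp_all
    let ?f = "lower_form m V" and ?g = "upper_form m V"
    have eigen: "lie_deriv m \<mu>h ?f = - smult (of_nat m) ?f" "lie_deriv m \<mu>h ?g = - smult (of_nat m) ?g"
      using acts_byD[OF h V] unfolding hV form_polys_smult[OF V] triple(3) \<rho> by simp_all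
    have lowering: "lower_form m (transpose_mat A *\<^sub>v w) = - lie_deriv m \<mu>y ?f"
      "upper_form m (transpose_mat A *\<^sub>v w) = - lie_deriv m \<mu>y ?g"
      unfolding yV form_polys_minus[OF yVc] using acts_byD[OF y V] unfolding triple(4) \<rho> by simp_all
    have "\<mu>x \<noteq> 0"
    proof
      assume "\<mu>x = 0"
      then have "\<mu>h = 0" using vf_triple_zero[OF triple(2)] by simp
      then have "?f = 0" "?g = 0" using eigen m by simp_all
      then show False using form_polys_nonzero[OF V V0] by simp
    qed
    then show "has_ruling_fibers m X w v"
      using ruling_of_eigenforms[OF m A Ai inv X v wc V0[unfolded V_def] triple(2) _
          eigen[unfolded V_def] lowering[unfolded V_def]] by blast
  next
    case False
    \<comment> \<open>The summand acts by vector fields in \<open>t\<close> alone: this happens only on the quadric, for its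
      other ruling.\<close>
    then have "\<mu>x = 0" using \<open>\<rho>x = 0 \<or> \<mu>x = 0\<close> by blast
    then have \<mu>: "\<mu>h = 0" "\<mu>y = 0" using vf_triple_zero[OF triple(2)] by simp_all
    have "degree \<rho>h \<le> 2" using triple(1) unfolding vf_triple_def by blast
    then obtain p q r where \<rho>h: "\<rho>h = [:p, q, r:]" using quadratic_poly_cases by blast
    have disc: "q * q - 4 * p * r = 4" by (rule vf_triple_disc[OF triple(1)[unfolded \<rho>h] False])
    have cf: "coeff [:p, q, r:] 0 = p" "coeff [:p, q, r:] 1 = q" "coeff [:p, q, r:] 2 = r"
      by (simp_all add: numeral_2_eq_2)
    have "m = 1"
    proof (rule scalar_quadratic_eigen[OF disc])
      show "(lower_form m V, upper_form m V) \<noteq> (0, 0)"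
        by (rule form_polys_nonzero[OF V V0])
      show "smult p (upper_form m V) - smult (q / 2) (lower_form m V) = - smult (of_nat m) (lower_form m V)"
        "smult (q / 2) (upper_form m V) - smult r (lower_form m V) = - smult (of_nat m) (upper_form m V)"
        using acts_byD[OF h V] unfolding hV form_polys_smult[OF V] triple(3) \<rho>h \<mu> cf by simp_all
    qed
    have four: "2 * 1 + 2 = (4 :: nat)" by simp
    have A4: "A \<in> carrier_mat 4 4" and Ai4: "Ai \<in> carrier_mat 4 4" and V4: "V \<in> carrier_vec 4"
      and v4: "v \<in> carrier_vec 4" and w4: "w \<in> carrier_vec 4"
      using A Ai V v wc unfolding \<open>m = 1\<close> four by blast+
    have inv4: "Ai * A = 1\<^sub>m 4" "A * Ai = 1\<^sub>m 4" using inv unfolding \<open>m = 1\<close> four by blast+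
    let ?P = "swap_mat :: 'a mat"
    note P = swap_mat_carrier[where 'a = 'a]
    have Aw4: "transpose_mat (conj (\<phi> ?y)) *\<^sub>v V \<in> carrier_vec 4" using yVc unfolding \<open>m = 1\<close> four .
    have T: "transpose_mat (A * ?P) *\<^sub>v l = ?P *\<^sub>v (transpose_mat A *\<^sub>v l)" if "l \<in> carrier_vec 4" for l
      using transpose_mult[OF A4 P] assoc_mult_mat_vec[of ?P 4 4 "transpose_mat A" 4 l] P A4 that
      by (simp add: transpose_swap_mat)
    have PP: "?P *\<^sub>v (?P *\<^sub>v V) = V"
      using assoc_mult_mat_vec[OF P P V4] V4 by (simp add: swap_mat_squared)
    have "proj_image (A * ?P) (scroll 1) = proj_image A (proj_image ?P (scroll 1))"
    proof (rule proj_image_mult[OF A4 P])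
      show "x \<in> carrier_vec 4" if "p \<in> scroll 1" "x \<in> p" for p and x :: "'a vec"
        using scroll_mem_carrier[OF that] unfolding four .
    qed
    then have XP: "X = proj_image (A * ?P) (scroll 1)"
      using X unfolding \<open>m = 1\<close> proj_image_swap_scroll by simp
    note h1 = h[unfolded \<open>m = 1\<close> triple(3) \<mu>] and y1 = y[unfolded \<open>m = 1\<close> triple(4) \<mu>]
    have PV: "?P *\<^sub>v V \<in> carrier_vec (2 * 1 + 2)" using P V4 unfolding four by simp
    have PyV: "?P *\<^sub>v (transpose_mat (conj (\<phi> ?y)) *\<^sub>v V) \<in> carrier_vec (2 * 1 + 2)" using P Aw4 unfolding four by simp
    have hV1: "transpose_mat (conj (\<phi> ?h)) *\<^sub>v V = (- 1) \<cdot>\<^sub>v V" using hV unfolding \<open>m = 1\<close> by simp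
    have hPV: "?P *\<^sub>v (transpose_mat (conj (\<phi> ?h)) *\<^sub>v V) = (- 1) \<cdot>\<^sub>v (?P *\<^sub>v V)"
      unfolding hV1 by (rule mult_mat_vec[OF P V4])
    have yPV: "?P *\<^sub>v (transpose_mat A *\<^sub>v w) = - (?P *\<^sub>v (transpose_mat (conj (\<phi> ?y)) *\<^sub>v V))"
      unfolding yV by (rule mult_mat_uminus_vec[OF P Aw4])
    have "has_ruling_fibers 1 X w v"
    proof (rule ruling_of_eigenforms[of 1 "A * ?P" "?P * Ai" X v w \<rho>h \<rho>x \<rho>y])
      show "X = proj_image (A * ?P) (scroll 1)" by (rule XP)
      show "A * ?P \<in> carrier_mat (2 * 1 + 2) (2 * 1 + 2)" "?P * Ai \<in> carrier_mat (2 * 1 + 2) (2 * 1 + 2)"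
        unfolding four using A4 Ai4 P by (auto intro: mult_carrier_mat)
      have "?P * Ai * (A * ?P) = ?P * ((Ai * A) * ?P)"
        using A4 Ai4 P by (simp add: assoc_mult_mat[of _ 4 4 _ 4 _ 4] mult_carrier_mat[of _ 4 4 _ 4])
      then show "?P * Ai * (A * ?P) = 1\<^sub>m (2 * 1 + 2)" unfolding four inv4 using P by (simp add: swap_mat_squared)
      have "A * ?P * (?P * Ai) = A * ((?P * ?P) * Ai)"
        using A4 Ai4 P by (simp add: assoc_mult_mat[of _ 4 4 _ 4 _ 4] mult_carrier_mat[of _ 4 4 _ 4])
      then show "A * ?P * (?P * Ai) = 1\<^sub>m (2 * 1 + 2)" unfolding four swap_mat_squared using Ai4 inv4 by simp
      show "v \<in> carrier_vec (2 * 1 + 2)" "w \<in> carrier_vec (2 * 1 + 2)" unfolding four by (fact v4 w4)+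
      show "transpose_mat (A * ?P) *\<^sub>v v \<noteq> 0\<^sub>v (2 * 1 + 2)"
      proof
        assume "transpose_mat (A * ?P) *\<^sub>v v = 0\<^sub>v (2 * 1 + 2)"
        then have "?P *\<^sub>v V = 0\<^sub>v 4" unfolding T[OF v4] V_def[symmetric] four .
        then have "V = 0\<^sub>v 4" using PP P by (metis mult_mat_vec_zero)
        then show False using V0 unfolding \<open>m = 1\<close> four by simp
      qed
      show "vf_triple \<rho>h \<rho>x \<rho>y" "\<rho>x \<noteq> 0" by (fact triple(1) False)+
      show "lie_deriv 1 \<rho>h (lower_form 1 (transpose_mat (A * ?P) *\<^sub>v v)) =
          - smult (of_nat 1) (lower_form 1 (transpose_mat (A * ?P) *\<^sub>v v))"
        "lie_deriv 1 \<rho>h (upper_form 1 (transpose_mat (A * ?P) *\<^sub>v v)) =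
          - smult (of_nat 1) (upper_form 1 (transpose_mat (A * ?P) *\<^sub>v v))"
        unfolding T[OF v4] V_def[symmetric] acts_by_swap[OF h1 V4, symmetric] hPV form_polys_smult[OF PV] by simp_all
      show "lower_form 1 (transpose_mat (A * ?P) *\<^sub>v w) = - lie_deriv 1 \<rho>y (lower_form 1 (transpose_mat (A * ?P) *\<^sub>v v))"
        "upper_form 1 (transpose_mat (A * ?P) *\<^sub>v w) = - lie_deriv 1 \<rho>y (upper_form 1 (transpose_mat (A * ?P) *\<^sub>v v))"
        unfolding T[OF v4] T[OF w4] V_def[symmetric] acts_by_swap[OF y1 V4, symmetric] yPV form_polys_minus[OF PyV] by simp_all
    qed simp
    then show "has_ruling_fibers m X w v" unfolding \<open>m = 1\<close> .
  qed
qed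

end
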